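(* Let $\boxdot$ denote either $\boxplus$ or $\boxtimes$, and let $\phi\in\left(\bigoplus_{k=0}^{\infty}\mathbb{C}[\mathcal{P}_k/\mathfrak{S}_k]\right)^{*}$. There exists, for any $t\geq0$, a unique element $e^{\boxdot t\phi}$ of $\left(\bigoplus_{k=0}^{\infty}\mathbb{C}[\mathcal{P}_k/\mathfrak{S}_k]\right)^{*}$ such that, for all $t_0\geq 0$, $$\frac{d}{dt}\Big|_{t=t_0}e^{\boxdot t\phi}=\phi\boxdot e^{\boxdot t_0\phi},$$ and $e^{\boxdot 0\phi}=\epsilon_{\boxdot}$. Besides, the following assertions are equivalent: 1. $\phi$ is a $\boxdot$-infinitesimal character, 2. for any $t\geq0$, $e^{\boxdot t\phi}$ is a character.
   Context: $\mathcal{P}_k$ is the set of partitions of $\{1,\dots,k\}\cup\{1',\dots,k'\}$ ($1,\dots,k$ top row, $1',\dots,k'$ bottom row), $\mathcal{P}_0=\{\emptyset\}$, $\mathrm{id}_k=\{\{i,i'\}:1\le i\le k\}$, $\mathrm{id}_0=\emptyset$. $\mathfrak{S}_k$ acts on $\mathcal{P}_k$ by simultaneously permuting the labels $1,\dots,k$ and $1',\dots,k'$; $[p]$ or $\mathbf{p}$ is the orbit of $p$. For $p\in\mathcal{P}_k$, $q\in\mathcal{P}_l$, $p\otimes q\in\mathcal{P}_{k+l}$ is obtained by placing $q$ to the right of $p$; $[p]\otimes[q]=[p\otimes q]$ is a well-defined product on $\bigoplus_k\mathbb{C}[\mathcal{P}_k/\mathfrak{S}_k]$. Derivatives of families of linear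 forms are taken pointwise (evaluated on each orbit). Composition: $p\circ p'$ is obtained by putting a diagram of $p'$ above one of $p$, identifying the bottom vertex $i'$ of $p'$ with the top vertex $i$ of $p$, and taking the partition of top and bottom rows induced by the connected components; $\kappa(p,p')$ is the number of connected components entirely contained in the middle row. $\mathrm{nc}(p)$ is the number of blocks of $p$; $p\vee p'$ is the finest partition coarser than both; $d(p,p')=\frac12(\mathrm{nc}(p)+\mathrm{nc}(p'))-\mathrm{nc}(p\vee p')$. For $p,p'\in\mathcal{P}_k$, $\mathsf{K}_p(p')$ is the set of $p''\in\mathcal{P}_k$ such that $p=p'\circ p''$ and $d(\mathrm{id}_k,p)=d(\mathrm{id}_k,p')+d(\mathrm{id}_k,p'')-\frac{k+\mathrm{nc}(p)-\mathrm{nc}(p')-\mathrm{nc}(p'')}{2}-\kappa(p',p'')$. Coproducts (extended linearly): a partition $p\in\mathcal{P}_k$ is irreducible if $\mathrm{nc}(p\vee\mathrm{id}_k)=1$; every orbit has a representative $p_1\otimes\cdots\otimes p_r$ with irreducible $p_i$ ($r=0$ for $\emptyset$), and $$\Delta_{\boxplus}([p_1\otimes\cdots\otimes p_r])=\sum_{I\subset\{1,\dots,r\}}\Big[\bigotimes_{i\in I}p_i\Big]\otimes\Big[\bigotimes_{i\notin I}p_i\Big];\qquad \Delta_{\boxtimes}([p])=\sum_{p_1\circ p_2=p,\ p_2\in\mathsf{K}_{p_1\circ p_2}(p_1)}[p_1]\otimes[p_2].$$ Convolutions: $\phi_1\boxdot\phi_2=(\phi_1\otimes\phi_2)\Delta_{\boxdot}$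 for linear forms $\phi_1,\phi_2$. Counits: $\epsilon_{\boxplus}(\mathbf{p})=\delta_{\mathbf{p}=\{\emptyset\}}$; $\epsilon_{\boxtimes}([\mathrm{id}_k])=1$ for every $k\ge0$ and $\epsilon_{\boxtimes}([p])=0$ for any other partition. A character is a linear form $\phi$ on $\bigoplus_k\mathbb{C}[\mathcal{P}_k/\mathfrak{S}_k]$ with $\phi(\emptyset)=1$ and $\phi(\mathbf{p_1}\otimes\mathbf{p_2})=\phi(\mathbf{p_1})\phi(\mathbf{p_2})$ for all orbits $\mathbf{p_1},\mathbf{p_2}$. A $\boxdot$-infinitesimal character is a linear form $\phi$ such that $\phi(\mathbf{p_1}\otimes\mathbf{p_2})=\phi(\mathbf{p_1})\epsilon_{\boxdot}(\mathbf{p_2})+\epsilon_{\boxdot}(\mathbf{p_1})\phi(\mathbf{p_2})$ for all orbits $\mathbf{p_1},\mathbf{p_2}$. *)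

theory Defs
  imports
    Complex_Main
    "HOL-Library.Disjoint_Sets"
    "HOL-Library.FuncSet"
    "HOL-Library.Poly_Mapping"
    "HOL-Combinatorics.Permutations"
begin

section \<open>Partitions\<close>

text \<open>
  The vertex \<open>i\<close> of the top row is \<open>(Top, i)\<close>, the vertex \<open>i'\<close> of the bottom row is
  \<open>(Bot, i)\<close>. The row \<open>Mid\<close> only occurs while two diagrams are being composed.
\<close>

datatype row = Top | Mid | Bot

type_synonym vertex = "row \<times> nat"

type_synonym diagram = "vertex set set"

definition verts :: "nat \<Rightarrow> vertex set" where
  "verts k = {Top, Bot} \<times> {1..k}"

definition Parts :: "nat \<Rightarrow> diagram set" where
  "Parts k = {p. partition_on (verts k) p}"

definition pdeg :: "diagram \<Rightarrow> nat" where
  "pdeg p = (THE k. p \<in> Parts k)"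

definition id_part :: "nat \<Rightarrow> diagram" where
  "id_part k = (\<lambda>i. {(Top, i), (Bot, i)}) ` {1..k}"

definition nc :: "diagram \<Rightarrow> nat" where
  "nc p = card p"

definition vmap :: "(vertex \<Rightarrow> vertex) \<Rightarrow> diagram \<Rightarrow> diagram" where
  "vmap f p = (\<lambda>B. f ` B) ` p"

definition relabel :: "(nat \<Rightarrow> nat) \<Rightarrow> diagram \<Rightarrow> diagram" where
  "relabel \<sigma> = vmap (map_prod id \<sigma>)"

definition part_tensor :: "diagram \<Rightarrow> diagram \<Rightarrow> diagram" where
  "part_tensor p q = p \<union> relabel (\<lambda>i. pdeg p + i) q"

definition part_tensor_list :: "diagram list \<Rightarrow> diagram" where
  "part_tensor_list ps = foldr part_tensor ps {}"

text \<open>The connected components of \<open>\<Union>S\<close> when all vertices in a common member of \<open>S\<close> are joined.\<close>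

definition block_rel :: "diagram \<Rightarrow> (vertex \<times> vertex) set" where
  "block_rel S = {(x, y). \<exists>B\<in>S. x \<in> B \<and> y \<in> B}"

definition merge :: "diagram \<Rightarrow> diagram" where
  "merge S = (\<Union>S) // (block_rel S)\<^sup>+"

text \<open>See \<open>part_join_finest\<close> below: this is the finest partition coarser than both.\<close>

definition part_join :: "diagram \<Rightarrow> diagram \<Rightarrow> diagram" where
  "part_join p q = merge (p \<union> q)"

definition move_row :: "row \<Rightarrow> row \<Rightarrow> diagram \<Rightarrow> diagram" where
  "move_row r s = vmap (map_prod (id(r := s)) id)"

text \<open>Components of the three-row diagram with \<open>p'\<close> placed above \<open>p\<close>.\<close>

definition stack :: "diagram \<Rightarrow> diagram \<Rightarrow> diagram" where
  "stack p p' = merge (move_row Top Mid p \<union> move_row Bot Mid p')"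

definition part_comp :: "diagram \<Rightarrow> diagram \<Rightarrow> diagram" where
  "part_comp p p' = (\<lambda>C. C - {Mid} \<times> UNIV) ` stack p p' - {{}}"

definition kappa :: "diagram \<Rightarrow> diagram \<Rightarrow> nat" where
  "kappa p p' = card {C \<in> stack p p'. C \<subseteq> {Mid} \<times> UNIV}"

definition part_dist :: "diagram \<Rightarrow> diagram \<Rightarrow> real" where
  "part_dist p p' = (real (nc p) + real (nc p')) / 2 - real (nc (part_join p p'))"

definition Kset :: "nat \<Rightarrow> diagram \<Rightarrow> diagram \<Rightarrow> diagram set" where
  "Kset k p p' = {p'' \<in> Parts k. p = part_comp p' p'' \<and>
     part_dist (id_part k) p =
       part_dist (id_part k) p' + part_dist (id_part k) p''
       - (real k + real (nc p) - real (nc p') - real (nc p'')) / 2 - real (kappa p' p'')}"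

definition irreducible_part :: "diagram \<Rightarrow> bool" where
  "irreducible_part p \<longleftrightarrow> (\<exists>k. p \<in> Parts k \<and> nc (part_join p (id_part k)) = 1)"

subsection \<open>Basic facts\<close>

lemma finite_verts: "finite (verts k)"
  by (simp add: verts_def)

lemma finite_Parts: "finite (Parts k)"
  unfolding Parts_def by (rule finitely_many_partition_on[OF finite_verts])

lemma pdeg_eq:
  assumes "p \<in> Parts k" shows "pdeg p = k"
proof -
  have "l = k" if "p \<in> Parts l" for l
  proof -
    have "verts l = verts k"
      using assms that by (auto simp: Parts_def partition_on_def)
    then have "card (verts l) = card (verts k)" by simp
    then show ?thesis by (simp add: verts_def card_cartesian_product)
  qed
  with assms show ?thesis unfolding pdeg_def by blast
qed

lemma equiv_block_rel: "equiv (\<Union>S) ((block_rel S)\<^sup>+)"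
proof (rule equivI)
  have sub: "block_rel S \<subseteq> \<Union>S \<times> \<Union>S" by (auto simp: block_rel_def)
  show "(block_rel S)\<^sup>+ \<subseteq> \<Union>S \<times> \<Union>S" using trancl_subset_Sigma[OF sub] .
  show "refl_on (\<Union>S) ((block_rel S)\<^sup>+)"
    by (rule refl_onI) (auto simp: block_rel_def)
  have "sym (block_rel S)" by (auto simp: sym_def block_rel_def)
  then show "sym ((block_rel S)\<^sup>+)" by (rule sym_trancl)
qed simp

lemma partition_on_merge: "partition_on (\<Union>S) (merge S)"
  unfolding merge_def by (rule partition_on_quotient[OF equiv_block_rel])

lemma block_subset_merge:
  assumes "B \<in> S" "B \<noteq> {}" shows "\<exists>C\<in>merge S. B \<subseteq> C"
proof -
  obtain x where x: "x \<in> B" using assms by auto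
  have "B \<subseteq> (block_rel S)\<^sup>+ `` {x}" using x assms by (auto simp: block_rel_def)
  moreover have "(block_rel S)\<^sup>+ `` {x} \<in> merge S"
    unfolding merge_def using x assms by (auto intro!: quotientI)
  ultimately show ?thesis by blast
qed

lemma merge_subset_block:
  assumes r: "partition_on A r" and S: "\<And>B. B \<in> S \<Longrightarrow> \<exists>C\<in>r. B \<subseteq> C" and D: "D \<in> merge S"
  shows "\<exists>C\<in>r. D \<subseteq> C"
proof -
  obtain x where x: "x \<in> \<Union>S" "D = (block_rel S)\<^sup>+ `` {x}"
    using D unfolding merge_def by (rule quotientE)
  then obtain C where C: "C \<in> r" "x \<in> C" using S by blast
  have closed: "z \<in> C" if "y \<in> C" "(y, z) \<in> block_rel S" for y z
  proof -
    obtain B where B: "B \<in> S" "y \<in> B" "z \<in> B" using \<open>(y, z) \<in> block_rel S\<close>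
      unfolding block_rel_def by blast
    then obtain C' where C': "C' \<in> r" "B \<subseteq> C'" using S by blast
    then have "C' = C"
      using disjointD[OF partition_onD2[OF r] C'(1) C(1)] B \<open>y \<in> C\<close> by blast
    with B C' show ?thesis by blast
  qed
  have "y \<in> C" if "(x, y) \<in> (block_rel S)\<^sup>+" for y
    using that by induction (use C closed in blast)+
  with x C show ?thesis by blast
qed

lemma part_join_finest:
  assumes p: "p \<in> Parts k" and q: "q \<in> Parts k"
  shows "part_join p q \<in> Parts k"
    and "refines (verts k) p (part_join p q)"
    and "refines (verts k) q (part_join p q)"
    and "\<And>r. refines (verts k) p r \<Longrightarrow> refines (verts k) q r \<Longrightarrow>
           refines (verts k) (part_join p q) r"
proof -
  have U: "\<Union>(p \<union> q) = verts k" using p q by (auto simp: Parts_def partition_on_def)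
  have P: "partition_on (verts k) (part_join p q)"
    using partition_on_merge[of "p \<union> q"] by (simp only: U part_join_def)
  then show "part_join p q \<in> Parts k" by (simp add: Parts_def)
  have ne: "B \<noteq> {}" if "B \<in> p \<union> q" for B
    using p q that by (auto simp: Parts_def partition_on_def)
  have p': "partition_on (verts k) p" and q': "partition_on (verts k) q"
    using p q by (simp_all add: Parts_def)
  show "refines (verts k) p (part_join p q)" "refines (verts k) q (part_join p q)"
    unfolding refines_def using P p' q' ne block_subset_merge[of _ "p \<union> q"]
    by (simp_all add: part_join_def)
  show "refines (verts k) (part_join p q) r"
    if "refines (verts k) p r" "refines (verts k) q r" for r
  proof -
    have r: "partition_on (verts k) r" and "\<forall>B\<in>p \<union> q. \<exists>C\<in>r. B \<subseteq> C"
      using that unfolding refines_def by blast+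
    then have "\<exists>C\<in>r. D \<subseteq> C" if "D \<in> part_join p q" for D
      using merge_subset_block[OF r, of "p \<union> q" D] that unfolding part_join_def by blast
    with P r show ?thesis unfolding refines_def by blast
  qed
qed

lemma vmap_vmap: "vmap f (vmap g p) = vmap (f \<circ> g) p"
  by (simp add: vmap_def image_image comp_def)

lemma vmap_id [simp]: "vmap id p = p"
  by (simp add: vmap_def)

lemma vmap_Un: "vmap f (p \<union> q) = vmap f p \<union> vmap f q"
  by (simp add: vmap_def image_Un)

lemma vmap_cong:
  assumes "\<And>x. x \<in> \<Union>p \<Longrightarrow> f x = g x" shows "vmap f p = vmap g p"
  unfolding vmap_def by (rule image_cong[OF refl], rule image_cong[OF refl]) (use assms in blast)

lemma inj_map_prod_id: "inj \<sigma> \<Longrightarrow> inj (map_prod id \<sigma> :: vertex \<Rightarrow> vertex)"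
  by (simp add: prod.inj_map)

lemma map_prod_id_comp: "map_prod id \<sigma> \<circ> map_prod id \<tau> = map_prod id (\<sigma> \<circ> \<tau>)"
  by (simp add: map_prod.comp)

lemma relabel_Un: "relabel \<sigma> (p \<union> q) = relabel \<sigma> p \<union> relabel \<sigma> q"
  by (simp add: relabel_def vmap_Un)

lemma relabel_relabel: "relabel \<sigma> (relabel \<tau> p) = relabel (\<sigma> \<circ> \<tau>) p"
  by (simp add: relabel_def vmap_vmap map_prod_id_comp)

lemma relabel_id [simp]: "relabel id p = p"
  by (simp add: relabel_def map_prod.id)

lemma relabel_inv:
  assumes "\<sigma> permutes {1..k}"
  shows "relabel (inv \<sigma>) (relabel \<sigma> p) = p" "relabel \<sigma> (relabel (inv \<sigma>) p) = p"
  using permutes_inv_o[OF assms] by (simp_all add: relabel_relabel)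

lemma relabel_in_Parts:
  assumes "\<sigma> permutes {1..k}" "p \<in> Parts k"
  shows "relabel \<sigma> p \<in> Parts k"
proof -
  have "inj (map_prod id \<sigma> :: vertex \<Rightarrow> vertex)"
    using permutes_inj[OF assms(1)] by (rule inj_map_prod_id)
  then have inj: "inj_on (map_prod id \<sigma>) (verts k)" by (rule inj_on_subset) simp
  have im: "map_prod id \<sigma> ` verts k = verts k"
    using permutes_image[OF assms(1)] by (simp add: verts_def map_prod_surj_on)
  have p: "partition_on (verts k) p" using assms by (simp add: Parts_def)
  have "(`) (map_prod id \<sigma>) ` p - {{}} = relabel \<sigma> p"
    using partition_onD3[OF p] by (auto simp: relabel_def vmap_def)
  then show ?thesis
    using partition_on_inj_image[OF p inj] by (simp add: Parts_def im)
qed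

lemma block_rel_vmap: "block_rel (vmap f S) = map_prod f f ` block_rel S"
  by (fastforce simp: block_rel_def vmap_def)

lemma trancl_map_prod:
  assumes "inj f" shows "(map_prod f f ` R)\<^sup>+ = map_prod f f ` (R\<^sup>+)"
proof (intro equalityI subrelI)
  fix x y assume "(x, y) \<in> (map_prod f f ` R)\<^sup>+"
  then show "(x, y) \<in> map_prod f f ` (R\<^sup>+)"
  proof induction
    case (base y) then show ?case by auto
  next
    case (step y z)
    then obtain a b c d where "x = f a" "y = f b" "(a, b) \<in> R\<^sup>+" "y = f c" "z = f d" "(c, d) \<in> R"
      by auto
    moreover from this assms have "b = c" by (auto dest: injD)
    ultimately show ?case by (auto intro!: rev_image_eqI[of "(a, d)"])
  qed
next
  fix x y assume "(x, y) \<in> map_prod f f ` (R\<^sup>+)"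
  then obtain a b where ab: "(a, b) \<in> R\<^sup>+" "x = f a" "y = f b" by auto
  from ab(1) have "(f a, f b) \<in> (map_prod f f ` R)\<^sup>+"
  proof induction
    case (base y) then show ?case by force
  next
    case (step y z)
    then have "(f y, f z) \<in> map_prod f f ` R" by force
    with step show ?case by (meson trancl.trancl_into_trancl)
  qed
  with ab show "(x, y) \<in> (map_prod f f ` R)\<^sup>+" by simp
qed

lemma merge_vmap:
  assumes "inj f" shows "merge (vmap f S) = vmap f (merge S)"
proof -
  have U: "\<Union>(vmap f S) = f ` \<Union>S" by (auto simp: vmap_def)
  have I: "(map_prod f f ` R) `` {f x} = f ` (R `` {x})" for R :: "(vertex \<times> vertex) set" and x
  proof -
    have "(map_prod f f ` R) `` {f x} = {f b |a b. (a, b) \<in> R \<and> f a = f x}" by force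
    also have "\<dots> = f ` (R `` {x})" unfolding inj_eq[OF assms] by blast
    finally show ?thesis .
  qed
  show ?thesis
    unfolding merge_def U block_rel_vmap trancl_map_prod[OF assms] quotient_def
    by (auto simp: I vmap_def)
qed

lemma move_row_relabel: "move_row r s (relabel \<sigma> p) = relabel \<sigma> (move_row r s p)"
  by (simp add: move_row_def relabel_def vmap_vmap map_prod.comp)

context
  fixes \<sigma> :: "nat \<Rightarrow> nat" and k assumes \<sigma>: "\<sigma> permutes {1..k}"
begin

lemma inj_relabel_vertex: "inj (map_prod id \<sigma> :: vertex \<Rightarrow> vertex)"
  using permutes_inj[OF \<sigma>] by (rule inj_map_prod_id)

lemma inj_relabel: "inj (relabel \<sigma>)"
  by (metis injI relabel_inv(1)[OF \<sigma>])

lemma merge_relabel: "merge (relabel \<sigma> S) = relabel \<sigma> (merge S)"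
  unfolding relabel_def by (rule merge_vmap[OF inj_relabel_vertex])

lemma stack_relabel: "stack (relabel \<sigma> p) (relabel \<sigma> q) = relabel \<sigma> (stack p q)"
  by (simp add: stack_def move_row_relabel merge_relabel flip: relabel_Un)

lemma part_join_relabel: "part_join (relabel \<sigma> p) (relabel \<sigma> q) = relabel \<sigma> (part_join p q)"
  by (simp add: part_join_def merge_relabel flip: relabel_Un)

lemma nc_relabel: "nc (relabel \<sigma> p) = nc p"
proof -
  have "inj ((`) (map_prod id \<sigma> :: vertex \<Rightarrow> vertex))"
    using inj_relabel_vertex by (simp add: inj_on_def inj_image_eq_iff)
  then show ?thesis
    unfolding nc_def relabel_def vmap_def by (intro card_image) (rule inj_on_subset, auto)
qed

lemma part_dist_relabel: "part_dist (relabel \<sigma> p) (relabel \<sigma> q) = part_dist p q"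
  by (simp add: part_dist_def part_join_relabel nc_relabel)

lemma part_comp_relabel: "part_comp (relabel \<sigma> p) (relabel \<sigma> q) = relabel \<sigma> (part_comp p q)"
proof -
  have "map_prod id \<sigma> ` C - {Mid} \<times> UNIV = map_prod id \<sigma> ` (C - {Mid} \<times> UNIV)" for C :: "vertex set"
    by auto
  then show ?thesis
    unfolding part_comp_def stack_relabel by (auto simp: relabel_def vmap_def image_image)
qed

lemma kappa_relabel: "kappa (relabel \<sigma> p) (relabel \<sigma> q) = kappa p q"
proof -
  have "map_prod id \<sigma> ` C \<subseteq> {Mid} \<times> UNIV \<longleftrightarrow> C \<subseteq> {Mid} \<times> UNIV" for C :: "vertex set"
    by auto
  then have "{C \<in> stack (relabel \<sigma> p) (relabel \<sigma> q). C \<subseteq> {Mid} \<times> UNIV}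
      = relabel \<sigma> {C \<in> stack p q. C \<subseteq> {Mid} \<times> UNIV}"
    unfolding stack_relabel by (auto simp: relabel_def vmap_def)
  then show ?thesis unfolding kappa_def using nc_relabel by (simp add: nc_def)
qed

lemma id_part_relabel: "relabel \<sigma> (id_part k) = id_part k"
proof -
  have "relabel \<sigma> (id_part k) = (\<lambda>i. {(Top, i), (Bot, i)}) ` \<sigma> ` {1..k}"
    by (simp add: relabel_def vmap_def id_part_def image_image)
  then show ?thesis by (simp only: permutes_image[OF \<sigma>] id_part_def)
qed

lemma Kset_relabel:
  assumes "p'' \<in> Kset k p p'"
  shows "relabel \<sigma> p'' \<in> Kset k (relabel \<sigma> p) (relabel \<sigma> p')"
proof -
  have "part_dist (id_part k) (relabel \<sigma> q) = part_dist (id_part k) q" for q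
    using part_dist_relabel[of "id_part k" q] by (simp add: id_part_relabel)
  with assms show ?thesis
    unfolding Kset_def mem_Collect_eq
    by (metis relabel_in_Parts[OF \<sigma>] part_comp_relabel nc_relabel kappa_relabel)
qed

end


section \<open>Orbits\<close>

definition same_orbit :: "diagram \<Rightarrow> diagram \<Rightarrow> bool" where
  "same_orbit p q \<longleftrightarrow> (\<exists>k \<sigma>. p \<in> Parts k \<and> \<sigma> permutes {1..k} \<and> q = relabel \<sigma> p)"

lemma empty_in_Parts: "{} \<in> Parts 0"
  by (simp add: Parts_def verts_def partition_on_empty)

lemma same_orbitE:
  assumes "same_orbit p q"
  obtains k \<sigma> where "p \<in> Parts k" "q \<in> Parts k" "\<sigma> permutes {1..k}" "q = relabel \<sigma> p"
  using assms relabel_in_Parts unfolding same_orbit_def by blast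

text \<open>The type \<open>orbit\<close> is the disjoint union of all the quotients of \<open>Parts k\<close>; \<open>abs_orbit p\<close>
  is the orbit of \<open>p\<close>.\<close>

quotient_type orbit = diagram / partial: same_orbit
proof (rule part_equivpI)
  show "\<exists>p. same_orbit p p"
    using empty_in_Parts permutes_id relabel_id unfolding same_orbit_def by metis
  show "symp same_orbit"
  proof (rule sympI)
    fix p q assume "same_orbit p q"
    then obtain k \<sigma> where *: "q \<in> Parts k" "\<sigma> permutes {1..k}" "q = relabel \<sigma> p"
      by (rule same_orbitE)
    then have "p = relabel (inv \<sigma>) q" by (simp add: relabel_inv)
    with * permutes_inv show "same_orbit q p" unfolding same_orbit_def by blast
  qed
  show "transp same_orbit"
  proof (rule transpI)
    fix p q r assume "same_orbit p q" "same_orbit q r"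
    then obtain k \<sigma> l \<tau> where *: "p \<in> Parts k" "q \<in> Parts k" "\<sigma> permutes {1..k}" "q = relabel \<sigma> p"
      "q \<in> Parts l" "\<tau> permutes {1..l}" "r = relabel \<tau> q"
      by (metis same_orbitE)
    then have "l = k" using pdeg_eq by metis
    with * have "r = relabel (\<tau> \<circ> \<sigma>) p" "\<tau> \<circ> \<sigma> permutes {1..k}"
      by (simp_all add: relabel_relabel permutes_compose)
    with * show "same_orbit p r" unfolding same_orbit_def by blast
  qed
qed

lemma abs_orbit_eq_iff:
  assumes "p \<in> Parts k" "q \<in> Parts k"
  shows "abs_orbit p = abs_orbit q \<longleftrightarrow> (\<exists>\<sigma>. \<sigma> permutes {1..k} \<and> q = relabel \<sigma> p)"
proof -
  have refl: "same_orbit p p" "same_orbit q q"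
    using assms permutes_id relabel_id unfolding same_orbit_def by metis+
  have "abs_orbit p = abs_orbit q \<longleftrightarrow> same_orbit p q"
    using Quotient_rel_abs2 Quotient3_orbit refl by (metis Quotient3_rel)
  also have "\<dots> \<longleftrightarrow> (\<exists>\<sigma>. \<sigma> permutes {1..k} \<and> q = relabel \<sigma> p)"
    using assms pdeg_eq unfolding same_orbit_def by metis
  finally show ?thesis .
qed

lemma part_tensor_in_Parts:
  assumes p: "p \<in> Parts k" and q: "q \<in> Parts l"
  shows "part_tensor p q \<in> Parts (k + l)"
proof -
  let ?f = "map_prod id ((+) k) :: vertex \<Rightarrow> vertex"
  have q': "partition_on (verts l) q" using q by (simp add: Parts_def)
  have inj: "inj_on ?f (verts l)" by (rule inj_on_subset[OF inj_map_prod_id]) auto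
  have "(`) ?f ` q - {{}} = relabel ((+) k) q"
    using partition_onD3[OF q'] by (auto simp: relabel_def vmap_def)
  then have *: "partition_on (?f ` verts l) (relabel ((+) k) q)"
    using partition_on_inj_image[OF q' inj] by simp
  have im: "?f ` verts l = {Top, Bot} \<times> {k + 1..k + l}"
    by (simp add: verts_def map_prod_surj_on image_add_atLeastAtMost add.commute)
  have p': "partition_on (verts k) p" using p by (simp add: Parts_def)
  have "disjnt (verts k) (?f ` verts l)" by (auto simp: im verts_def disjnt_def)
  then have "partition_on (verts k \<union> ?f ` verts l) (p \<union> relabel ((+) k) q)"
    using p' * disjoint_union[of p "relabel ((+) k) q"]
    unfolding partition_on_def disjnt_def by simp
  moreover have "verts k \<union> ?f ` verts l = verts (k + l)"
    unfolding im unfolding verts_def by auto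
  ultimately show ?thesis by (simp add: Parts_def part_tensor_def pdeg_eq[OF p])
qed

lift_definition orbit_tensor :: "orbit \<Rightarrow> orbit \<Rightarrow> orbit" is part_tensor
proof -
  fix p p' q q' assume "same_orbit p p'" "same_orbit q q'"
  then obtain k \<sigma> l \<tau> where p: "p \<in> Parts k" "p' \<in> Parts k" "\<sigma> permutes {1..k}" "p' = relabel \<sigma> p"
    and q: "q \<in> Parts l" "q' \<in> Parts l" "\<tau> permutes {1..l}" "q' = relabel \<tau> q"
    by (metis same_orbitE)
  define \<rho> where "\<rho> = (\<lambda>i. if i \<le> k then \<sigma> i else k + \<tau> (i - k))"
  have rho1: "\<rho> i = \<sigma> i" if "i \<le> k" for i using that by (simp add: \<rho>_def)
  have rho2: "\<rho> (k + i) = k + \<tau> i" if "i \<ge> 1" for i using that by (simp add: \<rho>_def)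
  have "\<rho> permutes {1..k + l}"
  proof (rule bij_imp_permutes)
    have "bij_betw \<rho> {1..k} {1..k}"
      using permutes_imp_bij[OF p(3)] by (rule bij_betw_cong[THEN iffD1, rotated]) (simp add: \<rho>_def)
    moreover have "bij_betw \<rho> {k+1..k+l} {k+1..k+l}"
    proof -
      have b1: "bij_betw (\<lambda>i. i - k) {k+1..k+l} {1..l}"
        by (rule bij_betw_byWitness[where f' = "\<lambda>i. i + k"]) auto
      have b2: "bij_betw (\<lambda>i. k + i) {1..l} {k+1..k+l}"
        by (rule bij_betw_byWitness[where f' = "\<lambda>i. i - k"]) auto
      have "bij_betw ((\<lambda>i. k + i) \<circ> (\<tau> \<circ> (\<lambda>i. i - k))) {k+1..k+l} {k+1..k+l}"
        using b1 permutes_imp_bij[OF q(3)] b2 by (blast intro: bij_betw_trans)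
      then show ?thesis by (rule bij_betw_cong[THEN iffD1, rotated]) (simp add: \<rho>_def)
    qed
    ultimately have "bij_betw \<rho> ({1..k} \<union> {k+1..k+l}) ({1..k} \<union> {k+1..k+l})"
      by (rule bij_betw_combine) auto
    moreover have "{1..k} \<union> {k+1..k+l} = {1..k+l}" by auto
    ultimately show "bij_betw \<rho> {1..k+l} {1..k+l}" by simp
    show "\<rho> i = i" if "i \<notin> {1..k+l}" for i
    proof (cases "i \<le> k")
      case True
      with that have "i \<notin> {1..k}" by auto
      with True permutes_not_in[OF p(3)] show ?thesis by (simp add: \<rho>_def)
    next
      case False
      with that have "i - k \<notin> {1..l}" by auto
      with False permutes_not_in[OF q(3)] show ?thesis by (simp add: \<rho>_def)
    qed
  qed
  moreover have "part_tensor p' q' = relabel \<rho> (part_tensor p q)"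
  proof -
    have "relabel \<rho> p = relabel \<sigma> p"
      unfolding relabel_def using p(1)
      by (intro vmap_cong) (auto simp: Parts_def partition_on_def verts_def rho1)
    moreover have "relabel \<rho> (relabel ((+) k) q) = relabel ((+) k) (relabel \<tau> q)"
      unfolding relabel_relabel unfolding relabel_def using q(1)
      by (intro vmap_cong) (auto simp: Parts_def partition_on_def verts_def rho2)
    ultimately show ?thesis
      using p q by (simp add: part_tensor_def pdeg_eq relabel_Un)
  qed
  ultimately show "same_orbit (part_tensor p q) (part_tensor p' q')"
    using part_tensor_in_Parts[OF p(1) q(1)] unfolding same_orbit_def by blast
qed


section \<open>Linear forms\<close>

text \<open>
  The space \<open>\<Oplus>\<^sub>k \<complex>[\<P>\<^sub>k/\<SS>\<^sub>k]\<close> is the free complex vector space on \<open>orbit\<close>, and its tensor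
  square is the free vector space on \<open>orbit \<times> orbit\<close>.
\<close>

type_synonym orbit_space = "orbit \<Rightarrow>\<^sub>0 complex"
type_synonym orbit_space2 = "orbit \<times> orbit \<Rightarrow>\<^sub>0 complex"

definition pscale :: "complex \<Rightarrow> ('a \<Rightarrow>\<^sub>0 complex) \<Rightarrow> ('a \<Rightarrow>\<^sub>0 complex)" where
  "pscale c v = Poly_Mapping.map ((*) c) v"

lemma lookup_pscale: "Poly_Mapping.lookup (pscale c v) x = c * Poly_Mapping.lookup v x"
  by (simp add: pscale_def Poly_Mapping.map.rep_eq when_def)

lemma vector_space_pscale: "vector_space pscale"
  by unfold_locales (auto intro!: poly_mapping_eqI simp: lookup_pscale lookup_add algebra_simps)

definition basis :: "'a \<Rightarrow> ('a \<Rightarrow>\<^sub>0 complex)" where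
  "basis x = Poly_Mapping.single x 1"

definition linear_form :: "(orbit_space \<Rightarrow> complex) \<Rightarrow> bool" where
  "linear_form \<phi> \<longleftrightarrow> Vector_Spaces.linear pscale (*) \<phi>"

definition extend_form :: "('a \<Rightarrow> complex) \<Rightarrow> ('a \<Rightarrow>\<^sub>0 complex) \<Rightarrow> complex" where
  "extend_form f v = (\<Sum>x\<in>Poly_Mapping.keys v. Poly_Mapping.lookup v x * f x)"

definition extend_map :: "('a \<Rightarrow> ('b \<Rightarrow>\<^sub>0 complex)) \<Rightarrow> ('a \<Rightarrow>\<^sub>0 complex) \<Rightarrow> ('b \<Rightarrow>\<^sub>0 complex)" where
  "extend_map f v = (\<Sum>x\<in>Poly_Mapping.keys v. pscale (Poly_Mapping.lookup v x) (f x))"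

definition tensor_form ::
  "(orbit_space \<Rightarrow> complex) \<Rightarrow> (orbit_space \<Rightarrow> complex) \<Rightarrow> orbit_space2 \<Rightarrow> complex" where
  "tensor_form \<phi> \<psi> = extend_form (\<lambda>(a, b). \<phi> (basis a) * \<psi> (basis b))"


section \<open>Coproducts, counits and convolutions\<close>

text \<open>A list of irreducible partitions whose tensor product represents the orbit \<open>x\<close>; it is
  unique up to order and up to relabelling of its members.\<close>

definition irreducible_factors :: "orbit \<Rightarrow> diagram list" where
  "irreducible_factors x = (SOME ps. (\<forall>p\<in>set ps. irreducible_part p) \<and>
     abs_orbit (part_tensor_list ps) = x)"

definition coproduct_boxplus_orbit :: "orbit \<Rightarrow> orbit_space2" where
  "coproduct_boxplus_orbit x =
    (let ps = irreducible_factors x in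
      \<Sum>I\<in>Pow {..<length ps}.
        basis (abs_orbit (part_tensor_list (nths ps I)),
               abs_orbit (part_tensor_list (nths ps ({..<length ps} - I)))))"

definition boxtimes_pairs :: "diagram \<Rightarrow> (diagram \<times> diagram) set" where
  "boxtimes_pairs p =
    {(p1, p2). p1 \<in> Parts (pdeg p) \<and> p2 \<in> Parts (pdeg p) \<and> part_comp p1 p2 = p \<and>
       p2 \<in> Kset (pdeg p) (part_comp p1 p2) p1}"

lemma finite_boxtimes_pairs: "finite (boxtimes_pairs p)"
  by (rule finite_subset[of _ "Parts (pdeg p) \<times> Parts (pdeg p)"])
    (auto simp: boxtimes_pairs_def finite_Parts)

lift_definition coproduct_boxtimes_orbit :: "orbit \<Rightarrow> orbit_space2" is
  "\<lambda>p. \<Sum>(p1, p2)\<in>boxtimes_pairs p. basis (abs_orbit p1, abs_orbit p2)"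
proof -
  fix p q assume "same_orbit p q"
  then obtain k \<sigma> where *: "p \<in> Parts k" "q \<in> Parts k" "\<sigma> permutes {1..k}" "q = relabel \<sigma> p"
    by (rule same_orbitE)
  have pairs: "map_prod (relabel \<tau>) (relabel \<tau>) ` boxtimes_pairs r \<subseteq> boxtimes_pairs (relabel \<tau> r)"
    if "\<tau> permutes {1..k}" "r \<in> Parts k" for r \<tau>
    unfolding boxtimes_pairs_def pdeg_eq[OF that(2)] pdeg_eq[OF relabel_in_Parts[OF that]]
    using relabel_in_Parts[OF that(1)] Kset_relabel[OF that(1)] part_comp_relabel[OF that(1)]
    by auto
  have "p = relabel (inv \<sigma>) q" using * by (simp add: relabel_inv)
  then have bij: "bij_betw (map_prod (relabel \<sigma>) (relabel \<sigma>)) (boxtimes_pairs p) (boxtimes_pairs q)"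
    using pairs[OF *(3,1)] pairs[OF permutes_inv[OF *(3)] *(2)] *
    by (intro bij_betw_byWitness[where f' = "map_prod (relabel (inv \<sigma>)) (relabel (inv \<sigma>))"])
      (auto simp: relabel_inv)
  have orb: "abs_orbit (relabel \<sigma> r) = abs_orbit r" if "r \<in> Parts k" for r
    using that abs_orbit_eq_iff relabel_in_Parts *(3) by metis
  show "(\<Sum>(p1, p2)\<in>boxtimes_pairs p. basis (abs_orbit p1, abs_orbit p2)) =
        (\<Sum>(p1, p2)\<in>boxtimes_pairs q. basis (abs_orbit p1, abs_orbit p2))"
    unfolding sum.reindex_bij_betw[OF bij, symmetric] using *(1)
    by (intro sum.cong) (auto simp: boxtimes_pairs_def pdeg_eq orb)
qed

datatype convolution = Boxplus | Boxtimes

primrec coproduct :: "convolution \<Rightarrow> orbit_space \<Rightarrow> orbit_space2" where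
  "coproduct Boxplus = extend_map coproduct_boxplus_orbit"
| "coproduct Boxtimes = extend_map coproduct_boxtimes_orbit"

primrec counit :: "convolution \<Rightarrow> orbit_space \<Rightarrow> complex" where
  "counit Boxplus = extend_form (\<lambda>x. if x = abs_orbit {} then 1 else 0)"
| "counit Boxtimes = extend_form (\<lambda>x. if \<exists>k. x = abs_orbit (id_part k) then 1 else 0)"

definition convolve ::
  "convolution \<Rightarrow> (orbit_space \<Rightarrow> complex) \<Rightarrow> (orbit_space \<Rightarrow> complex) \<Rightarrow> orbit_space \<Rightarrow> complex" where
  "convolve c \<phi> \<psi> = tensor_form \<phi> \<psi> \<circ> coproduct c"


section \<open>Characters and convolution exponentials\<close>

definition character :: "(orbit_space \<Rightarrow> complex) \<Rightarrow> bool" where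
  "character \<phi> \<longleftrightarrow> linear_form \<phi> \<and> \<phi> (basis (abs_orbit {})) = 1 \<and>
     (\<forall>x y. \<phi> (basis (orbit_tensor x y)) = \<phi> (basis x) * \<phi> (basis y))"

definition infinitesimal_character :: "convolution \<Rightarrow> (orbit_space \<Rightarrow> complex) \<Rightarrow> bool" where
  "infinitesimal_character c \<phi> \<longleftrightarrow> linear_form \<phi> \<and>
     (\<forall>x y. \<phi> (basis (orbit_tensor x y)) =
        \<phi> (basis x) * counit c (basis y) + counit c (basis x) * \<phi> (basis y))"

text \<open>The family is defined for \<open>t \<ge> 0\<close> only (\<open>undefined\<close> elsewhere, by extensionality), so the
  derivative at \<open>0\<close> is one-sided.\<close>

definition conv_exponential ::
  "convolution \<Rightarrow> (orbit_space \<Rightarrow> complex) \<Rightarrow> (real \<Rightarrow> orbit_space \<Rightarrow> complex) \<Rightarrow> bool" where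
  "conv_exponential c \<phi> e \<longleftrightarrow>
     e \<in> {0..} \<rightarrow>\<^sub>E {\<psi>. linear_form \<psi>} \<and>
     (\<forall>t0\<ge>0. \<forall>x. ((\<lambda>t. e t (basis x)) has_vector_derivative convolve c \<phi> (e t0) (basis x))
        (at t0 within {0..})) \<and>
     e 0 = counit c"

end

theory Submission
  imports Defs "HOL-Analysis.Derivative"
begin

text \<open>
  On orbits of degree at most \<open>n\<close>, convolution by \<open>\<phi>\<close> is an endomorphism of a finite-dimensional
  space, so the differential equation is linear with constant coefficients and has exactly one
  solution. Both coproducts are multiplicative for \<open>\<otimes>\<close> and both counits are two-sided. If \<open>\<phi>\<close> is
  infinitesimal, then \<open>e\<^sub>t(x \<otimes> y)\<close> and \<open>e\<^sub>t(x) e\<^sub>t(y)\<close> therefore solve the same linear system with the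
  same initial value; conversely, differentiating the character identity at \<open>0\<close> gives the
  infinitesimal one.

  Multiplicativity of \<open>\<Delta>\<^sub>\<boxtimes>\<close> rests on an inequality: writing \<open>|q|\<close> for the number of blocks,
  the condition \<open>p\<^sub>2 \<in> K\<^sub>p(p\<^sub>1)\<close> for \<open>p = p\<^sub>1 \<circ> p\<^sub>2\<close> says
  \<open>|p| + \<kappa> + |p\<^sub>1 \<or> id| + |p\<^sub>2 \<or> id| = |p\<^sub>1| + |p\<^sub>2| + |p \<or> id|\<close>, whereas counting connected components always
  gives \<open>|p| + \<kappa> + |p\<^sub>1 \<or> id| + |p\<^sub>2 \<or> id| \<le> |p\<^sub>1| + |p\<^sub>2| + |p\<^sub>1 \<or> p\<^sub>2 \<or> id|\<close>, and
  \<open>p\<^sub>1 \<or> p\<^sub>2 \<or> id\<close> is coarser than \<open>p \<or> id\<close>. Equality forces the two joins to coincide, so \<open>p\<^sub>1\<close> and \<open>p\<^sub>2\<close>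
  split along every tensor decomposition of \<open>p\<close>. Multiplicativity of \<open>\<Delta>\<^sub>\<boxplus>\<close> follows by rewriting
  it as a sum over the sets of columns that are unions of blocks of \<open>p \<or> id\<close>, which does not depend on
  a choice of irreducible factors.
\<close>


section \<open>Linear differential equations\<close>

text \<open>For \<open>Boxtimes\<close> the obstacle is that a split composition can have factors
  that do not split. In degree 2, let \<open>p2\<close> consist of singletons and let
  \<open>p1\<close> differ from it only by joining its two top vertices. The component so created
  lies in the middle row and is discarded, so \<open>p1 \<circ> p2\<close> consists of singletons.
  The left-hand count is 4 + 1 + 1 + 2 = 8: it attains the general bound 3 + 4 + 1 but misses the
  geodesic value 3 + 4 + 2. So the general bound has to be stated with the triple join, and it is
  the geodesic condition that removes such pairs. For \<open>Boxplus\<close> the obstacle is that a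
  list of irreducible factors is chosen for each orbit, and the list chosen for a tensor product
  need not be related to those chosen for its factors. The two counit laws serve different ends. The
  left one contracts the counits produced by the infinitesimal identity; the right one makes
  \<open>\<phi>\<close> itself the derivative at 0. Coproduct identities are stated by pairing both
  sides with an arbitrary function \<open>h\<close> on pairs of orbits, which turns them into
  equalities of finite sums.\<close>

unbundle inner_syntax

text \<open>Gronwall's argument: the energy \<open>E\<close>, a sum of squared norms, satisfies
  \<open>E' s \<le> 2 * K * E s\<close>, so multiplying by the integrating factor
  \<open>exp (- 2 * K * s)\<close> gives a function that cannot rise above its initial value 0.
  Complex numbers are treated as a real inner product space.\<close>

lemma linear_ode_zero:
  fixes w :: "'a \<Rightarrow> real \<Rightarrow> complex" and M :: "'a \<Rightarrow> 'a \<Rightarrow> complex"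
  assumes D: "finite D"
    and der: "\<And>x t. x \<in> D \<Longrightarrow> t \<ge> 0 \<Longrightarrow>
      (w x has_vector_derivative (\<Sum>y\<in>D. M x y * w y t)) (at t within {0..})"
    and init: "\<And>x. x \<in> D \<Longrightarrow> w x 0 = 0"
    and x: "x \<in> D" and t: "t \<ge> 0"
  shows "w x t = 0"
proof -
  define E where "E s = (\<Sum>x\<in>D. (norm (w x s))\<^sup>2)" for s
  \<comment> \<open>Every product \<open>norm (w a s) * norm (w b s)\<close> is at most
    \<open>E s\<close>, so the total size of the entries of \<open>M\<close> bounds the quadratic
    form.\<close>
  define K where "K = (\<Sum>x\<in>D. \<Sum>y\<in>D. norm (M x y))"
  define E' where "E' s = (\<Sum>x\<in>D. 2 * (w x s \<bullet> (\<Sum>y\<in>D. M x y * w y s)))" for s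
  have derE: "(E has_real_derivative E' s) (at s within {0..})" if "s \<ge> 0" for s
  proof -
    have "((\<lambda>s. (norm (w x s))\<^sup>2) has_vector_derivative 2 * (w x s \<bullet> (\<Sum>y\<in>D. M x y * w y s)))
        (at s within {0..})" if "x \<in> D" for x
    proof -
      have "((\<lambda>s. w x s \<bullet> w x s) has_vector_derivative
          (w x s \<bullet> (\<Sum>y\<in>D. M x y * w y s) + (\<Sum>y\<in>D. M x y * w y s) \<bullet> w x s)) (at s within {0..})"
        by (rule bounded_bilinear.has_vector_derivative[OF bounded_bilinear_inner
            der[OF \<open>x \<in> D\<close> \<open>s \<ge> 0\<close>] der[OF \<open>x \<in> D\<close> \<open>s \<ge> 0\<close>]])
      then show ?thesis by (simp add: power2_norm_eq_inner inner_commute)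
    qed
    then show ?thesis
      unfolding E_def E'_def has_real_derivative_iff_has_vector_derivative
      by (rule has_vector_derivative_sum)
  qed
  have E'_le: "E' s \<le> 2 * K * E s" for s
  proof -
    have nw: "norm (w a s) * norm (w b s) \<le> E s" if "a \<in> D" "b \<in> D" for a b
    proof -
      have "norm (w c s) \<le> sqrt (E s)" if "c \<in> D" for c
        using member_le_sum[OF that, of "\<lambda>x. (norm (w x s))\<^sup>2"] D
        by (intro real_le_rsqrt) (simp add: E_def)
      then have "norm (w a s) * norm (w b s) \<le> sqrt (E s) * sqrt (E s)"
        using that by (intro mult_mono) (auto simp: E_def sum_nonneg)
      then show ?thesis by (simp add: E_def sum_nonneg)
    qed
    have "w a s \<bullet> (\<Sum>y\<in>D. M a y * w y s) \<le> (\<Sum>y\<in>D. norm (M a y)) * E s" if "a \<in> D" for a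
    proof -
      have "w a s \<bullet> (\<Sum>y\<in>D. M a y * w y s) \<le> (\<Sum>y\<in>D. norm (w a s) * norm (M a y * w y s))"
        unfolding inner_sum_right by (intro sum_mono norm_cauchy_schwarz)
      also have "\<dots> \<le> (\<Sum>y\<in>D. norm (M a y) * E s)"
        using mult_left_mono[OF nw[OF that], of _ "norm (M a _)"]
        by (intro sum_mono) (simp add: norm_mult mult.left_commute)
      finally show ?thesis by (simp add: sum_distrib_right)
    qed
    then have "(\<Sum>a\<in>D. w a s \<bullet> (\<Sum>y\<in>D. M a y * w y s)) \<le> (\<Sum>a\<in>D. (\<Sum>y\<in>D. norm (M a y)) * E s)"
      by (rule sum_mono)
    then show ?thesis
      unfolding E'_def K_def by (simp add: sum_distrib_right flip: sum_distrib_left)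
  qed
  define G where "G s = exp (- 2 * K * s) * E s" for s
  define G' where "G' s = exp (- 2 * K * s) * (E' s - 2 * K * E s)" for s
  \<comment> \<open>On \<open>{0..t}\<close> the derivative at 0 stays one-sided, as the hypothesis
    supplies it, and the mean value theorem applies.\<close>
  have derG: "(G has_real_derivative G' s) (at s within {0..t})" if "0 \<le> s" "s \<le> t" for s
  proof -
    have "(G has_real_derivative G' s) (at s within {0..})"
      unfolding G_def G'_def
      by (rule derivative_eq_intros derE that refl | simp add: algebra_simps)+
    then show ?thesis by (rule DERIV_subset) auto
  qed
  have "\<exists>s\<in>{0..t}. G t - G 0 = (*) (G' s) (t - 0)"
    using t derG by (intro mvt_very_simple) (auto simp: has_field_derivative_def)
  then obtain s where "G t - G 0 = G' s * t" by auto
  moreover have "G' s \<le> 0" unfolding G'_def using E'_le[of s] by (simp add: mult_le_0_iff)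
  ultimately have "G t \<le> G 0" using t mult_nonpos_nonneg[of "G' s" t] by linarith
  moreover have "G 0 = 0" using init by (simp add: G_def E_def)
  ultimately have "E t \<le> 0" by (simp add: G_def mult_le_0_iff)
  moreover have "(norm (w x t))\<^sup>2 \<le> E t"
    unfolding E_def using D x by (intro member_le_sum) auto
  ultimately show ?thesis by (smt (verit) norm_eq_zero zero_less_norm_iff zero_less_power)
qed

text \<open>By the recursion \<open>a n\<close> is the n-th iterate of \<open>M\<close> on
  \<open>a 0\<close>, so the series is a matrix exponential applied to \<open>a 0\<close>. The
  growth bound \<open>B * K ^ n\<close> gives convergence everywhere and hence termwise
  differentiation.\<close>

lemma linear_ode_series:
  fixes a :: "nat \<Rightarrow> 'a \<Rightarrow> complex" and M :: "'a \<Rightarrow> 'a \<Rightarrow> complex"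
  assumes D: "finite D"
    and rec: "\<And>n x. x \<in> D \<Longrightarrow> a (Suc n) x = (\<Sum>y\<in>D. M x y * a n y)"
    and x: "x \<in> D"
  shows "((\<lambda>t. suminf (\<lambda>n. a n x / fact n * of_real t ^ n)) has_vector_derivative
      (\<Sum>y\<in>D. M x y * (suminf (\<lambda>n. a n y / fact n * of_real t ^ n)))) (at t within S)"
proof -
  define B where "B = (\<Sum>x\<in>D. norm (a 0 x))"
  define K where "K = (\<Sum>x\<in>D. \<Sum>y\<in>D. norm (M x y))"
  have B0: "B \<ge> 0" and K0: "K \<ge> 0" by (simp_all add: B_def K_def sum_nonneg)
  have bound: "norm (a n y) \<le> B * K ^ n" if "y \<in> D" for n y
    using that
  proof (induction n arbitrary: y)
    case 0
    then show ?case
      using member_le_sum[of y D "\<lambda>x. norm (a 0 x)"] D by (simp add: B_def)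
  next
    case (Suc n)
    have "norm (a (Suc n) y) \<le> (\<Sum>z\<in>D. norm (M y z) * norm (a n z))"
      unfolding rec[OF Suc.prems] by (rule order_trans[OF norm_sum]) (simp add: norm_mult)
    also have "\<dots> \<le> (\<Sum>z\<in>D. norm (M y z) * (B * K ^ n))"
      by (intro sum_mono mult_left_mono Suc.IH) auto
    also have "\<dots> = (\<Sum>z\<in>D. norm (M y z)) * (B * K ^ n)" by (simp add: sum_distrib_right)
    also have "\<dots> \<le> K * (B * K ^ n)"
      unfolding K_def using Suc.prems D B0 K0
      by (intro mult_right_mono member_le_sum[of y D "\<lambda>y. \<Sum>z\<in>D. norm (M y z)"])
        (auto simp: sum_nonneg K_def)
    finally show ?case by (simp add: mult_ac)
  qed
  have summ: "summable (\<lambda>n. a n y / fact n * z ^ n)" if "y \<in> D" for y and z :: complex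
  proof (rule summable_comparison_test')
    show "summable (\<lambda>n. B * (inverse (fact n) * (K * norm z) ^ n))"
      by (intro summable_mult summable_exp)
    show "norm (a n y / fact n * z ^ n) \<le> B * (inverse (fact n) * (K * norm z) ^ n)" for n
      using mult_right_mono[OF bound[OF that, of n], of "norm z ^ n / fact n"]
      by (simp add: norm_mult norm_divide norm_power power_mult_distrib field_simps)
  qed
  \<comment> \<open>The factor \<open>n + 1\<close> brought down by differentiation cancels against
    \<open>fact (Suc n)\<close>.\<close>
  have diffs: "diffs (\<lambda>n. a n x / fact n) n = (\<Sum>y\<in>D. M x y * (a n y / fact n))" for n
  proof -
    have "diffs (\<lambda>n. a n x / fact n) n = a (Suc n) x / fact n"
      by (simp add: diffs_def field_simps del: of_nat_Suc)
    then show ?thesis by (simp add: rec[OF x] sum_divide_distrib)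
  qed
  have "((\<lambda>z. suminf (\<lambda>n. a n x / fact n * z ^ n)) has_field_derivative
      (suminf (\<lambda>n. diffs (\<lambda>n. a n x / fact n) n * of_real t ^ n))) (at (of_real t))"
    by (rule termdiffs_strong_converges_everywhere) (rule summ[OF x])
  moreover have "(suminf (\<lambda>n. diffs (\<lambda>n. a n x / fact n) n * of_real t ^ n)) =
      (\<Sum>y\<in>D. M x y * (suminf (\<lambda>n. a n y / fact n * of_real t ^ n)))"
  proof -
    have "(suminf (\<lambda>n. \<Sum>y\<in>D. M x y * (a n y / fact n * of_real t ^ n))) =
        (\<Sum>y\<in>D. suminf (\<lambda>n. M x y * (a n y / fact n * of_real t ^ n)))"
      by (rule suminf_sum) (rule summable_mult[OF summ])
    also have "\<dots> = (\<Sum>y\<in>D. M x y * (suminf (\<lambda>n. a n y / fact n * of_real t ^ n)))"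
      by (intro sum.cong refl suminf_mult summ)
    finally show ?thesis by (simp add: diffs sum_distrib_right mult.assoc)
  qed
  ultimately show ?thesis
    using has_vector_derivative_real_field has_vector_derivative_at_within by fastforce
qed


section \<open>Linear forms on a free vector space\<close>

lemma extend_form_superset:
  assumes "finite K" "Poly_Mapping.keys v \<subseteq> K"
  shows "extend_form f v = (\<Sum>x\<in>K. Poly_Mapping.lookup v x * f x)"
  unfolding extend_form_def using assms
  by (intro sum.mono_neutral_left) (auto simp: in_keys_iff)

lemma extend_form_add: "extend_form f (u + v) = extend_form f u + extend_form f v"
  using Poly_Mapping.keys_add[of u v]
  by (simp add: extend_form_superset[of "Poly_Mapping.keys u \<union> Poly_Mapping.keys v"]
      lookup_add algebra_simps sum.distrib)

lemma extend_form_pscale: "extend_form f (pscale k v) = k * extend_form f v"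
  by (subst extend_form_superset[of "Poly_Mapping.keys v"])
    (auto simp: lookup_pscale in_keys_iff extend_form_def sum_distrib_left mult.assoc)

lemma extend_form_zero [simp]: "extend_form f 0 = 0"
  by (simp add: extend_form_def)

lemma extend_form_basis [simp]: "extend_form f (basis x) = f x"
  by (simp add: extend_form_def basis_def)

lemma extend_form_sum: "extend_form f (\<Sum>i\<in>I. g i) = (\<Sum>i\<in>I. extend_form f (g i))"
  by (induction I rule: infinite_finite_induct) (simp_all add: extend_form_add)

lemma extend_map_basis: "extend_map f (basis x) = f x"
  by (auto simp: extend_map_def basis_def lookup_pscale intro!: poly_mapping_eqI)

interpretation pscale: vector_space pscale by (rule vector_space_pscale)
interpretation cmul: vector_space "(*) :: complex \<Rightarrow> complex \<Rightarrow> complex"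
  by unfold_locales (simp_all add: algebra_simps)

lemma linear_form_extend_form: "linear_form (extend_form f)"
  unfolding linear_form_def
  by unfold_locales (simp_all add: extend_form_add extend_form_pscale)

text \<open>Every vector is the finite combination of its keys, so forms can be compared on orbits
  alone.\<close>

lemma linear_form_eq_extend_form:
  assumes "linear_form \<phi>" shows "\<phi> = extend_form (\<lambda>x. \<phi> (basis x))"
proof
  fix v :: orbit_space
  interpret L: Vector_Spaces.linear pscale "(*)" \<phi> using assms by (simp add: linear_form_def)
  have "v = (\<Sum>x\<in>Poly_Mapping.keys v. pscale (Poly_Mapping.lookup v x) (basis x))"
    by (auto intro!: poly_mapping_eqI simp: lookup_sum lookup_pscale basis_def lookup_single when_def
        in_keys_iff if_distrib sum.If_cases cong: if_cong)
  then have "\<phi> v = \<phi> (\<Sum>x\<in>Poly_Mapping.keys v. pscale (Poly_Mapping.lookup v x) (basis x))" by simp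
  then show "\<phi> v = extend_form (\<lambda>x. \<phi> (basis x)) v"
    by (simp add: L.sum L.scale extend_form_def)
qed


section \<open>Connected components\<close>

text \<open>The transitive closure is enough: \<open>block_rel S\<close> is symmetric and already
  relates every vertex of \<open>\<Union>S\<close> to itself. Outside \<open>\<Union>S\<close> the
  predicate is false even for \<open>x = y\<close>.\<close>

definition linked :: "diagram \<Rightarrow> vertex \<Rightarrow> vertex \<Rightarrow> bool" where
  "linked S x y \<longleftrightarrow> (x, y) \<in> (block_rel S)\<^sup>+"

lemma linked_block: "B \<in> S \<Longrightarrow> x \<in> B \<Longrightarrow> y \<in> B \<Longrightarrow> linked S x y"
  by (auto simp: linked_def block_rel_def)

lemma linked_refl: "x \<in> \<Union>S \<Longrightarrow> linked S x x"
  using linked_block by blast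

lemma linked_sym: "linked S x y \<Longrightarrow> linked S y x"
  unfolding linked_def using equiv_block_rel[of S] by (meson equivE symD)

lemma linked_trans: "linked S x y \<Longrightarrow> linked S y z \<Longrightarrow> linked S x z"
  unfolding linked_def by (rule trancl_trans)

lemma linked_in: "linked S x y \<Longrightarrow> x \<in> \<Union>S \<and> y \<in> \<Union>S"
  unfolding linked_def using equiv_block_rel[of S] by (auto simp: equiv_def)

text \<open>The induction principle for connectivity. Separation of vertices is shown by choosing as
  \<open>g\<close> a membership predicate or the component of another diagram.\<close>

lemma linked_invariant:
  assumes "linked S x y" and g: "\<And>B x y. B \<in> S \<Longrightarrow> x \<in> B \<Longrightarrow> y \<in> B \<Longrightarrow> g x = g y"
  shows "g x = g y"
  using assms(1) unfolding linked_def
proof induction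
  case (base y)
  then show ?case using g unfolding block_rel_def by blast
next
  case (step y z)
  then have "g y = g z" using g unfolding block_rel_def by blast
  with step show ?case by simp
qed

lemma linked_subsume:
  assumes "linked S x y" and T: "\<And>B x y. B \<in> S \<Longrightarrow> x \<in> B \<Longrightarrow> y \<in> B \<Longrightarrow> linked T x y"
  shows "linked T x y"
  using assms(1) unfolding linked_def
proof induction
  case (base y)
  then show ?case using T unfolding block_rel_def linked_def by blast
next
  case (step y z)
  then have "linked T y z" using T unfolding block_rel_def by blast
  with step show ?case by (auto simp: linked_def)
qed

lemma linked_mono: "S \<subseteq> T \<Longrightarrow> linked S x y \<Longrightarrow> linked T x y"
  by (rule linked_subsume) (auto intro: linked_block)

lemma linked_cls_eq: "x \<in> \<Union>S \<Longrightarrow> {w. linked S x w} = {w. linked S y w} \<longleftrightarrow> linked S x y"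
  by (blast intro: linked_refl linked_sym linked_trans)

lemma linked_cls: "linked S x y \<Longrightarrow> {w. linked S x w} = {w. linked S y w}"
  using linked_cls_eq linked_in by metis

lemma merge_eq_image: "merge S = (\<lambda>x. {y. linked S x y}) ` \<Union>S"
  by (auto simp: merge_def quotient_def linked_def Image_def)

lemma Union_merge: "\<Union>(merge S) = \<Union>S"
  using partition_on_merge[of S] by (simp add: partition_on_def)

lemma merge_mem_iff: "C \<in> merge S \<Longrightarrow> x \<in> C \<Longrightarrow> y \<in> C \<longleftrightarrow> linked S x y"
  unfolding merge_eq_image by (blast intro: linked_sym linked_trans)

lemma linked_class_in_merge: "x \<in> \<Union>S \<Longrightarrow> {y. linked S x y} \<in> merge S"
  by (auto simp: merge_eq_image)

lemma card_image_eq_kernel: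
  assumes "\<And>x y. x \<in> V \<Longrightarrow> y \<in> V \<Longrightarrow> g x = g y \<longleftrightarrow> h x = h y"
  shows "card (g ` V) = card (h ` V)"
proof (rule bij_betw_same_card)
  show "bij_betw (\<lambda>z. h (inv_into V g z)) (g ` V) (h ` V)"
    unfolding bij_betw_def
  proof
    have *: "h (inv_into V g (g x)) = h x" if "x \<in> V" for x
      using assms that by (metis f_inv_into_f image_eqI inv_into_into)
    show "inj_on (\<lambda>z. h (inv_into V g z)) (g ` V)"
      by (rule inj_onI) (use assms * in auto)
    show "(\<lambda>z. h (inv_into V g z)) ` g ` V = h ` V"
      unfolding image_image using * by (rule image_cong[OF refl])
  qed
qed

text \<open>Components can be counted through any labelling whose kernel is connectivity; the labels
  may be components of a different diagram.\<close>

lemma card_merge: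
  assumes "\<And>x y. x \<in> \<Union>S \<Longrightarrow> y \<in> \<Union>S \<Longrightarrow> g x = g y \<longleftrightarrow> linked S x y"
  shows "card (merge S) = card (g ` \<Union>S)"
  unfolding merge_eq_image
  by (rule card_image_eq_kernel) (simp only: assms linked_cls_eq)

lemma finite_merge: "finite (\<Union>S) \<Longrightarrow> finite (merge S)"
  by (simp add: merge_eq_image)

lemma linked_Un_left:
  assumes "\<Union>S \<inter> \<Union>T = {}" "x \<in> \<Union>S"
  shows "linked (S \<union> T) x y \<longleftrightarrow> linked S x y"
proof
  assume "linked (S \<union> T) x y"
  then have "{w. linked S x w} = {w. linked S y w}"
  proof (rule linked_invariant)
    fix B x y assume B: "B \<in> S \<union> T" "x \<in> B" "y \<in> B"
    show "{w. linked S x w} = {w. linked S y w}"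
    proof (cases "B \<in> S")
      case True
      then show ?thesis using B by (intro linked_cls linked_block)
    next
      case False
      \<comment> \<open>Vertices outside \<open>\<Union>S\<close> have the empty set as class, so
        the label is constant on the blocks of \<open>T\<close> too.\<close>
      then have "x \<notin> \<Union>S" "y \<notin> \<Union>S" using assms(1) B by blast+
      moreover have "\<not> linked S z w" if "z \<notin> \<Union>S" for z w using that linked_in[of S z w] by argo
      ultimately show ?thesis by simp
    qed
  qed
  then show "linked S x y" using linked_cls_eq[OF assms(2)] by simp
qed (rule linked_mono, auto)

lemma merge_Un:
  assumes "\<Union>S \<inter> \<Union>T = {}"
  shows "merge (S \<union> T) = merge S \<union> merge T"
proof -
  have "linked (S \<union> T) x = linked S x" if "x \<in> \<Union>S" for x
    using linked_Un_left[OF assms that] by blast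
  moreover have "linked (S \<union> T) x = linked T x" if "x \<in> \<Union>T" for x
    using linked_Un_left[of T S x] assms that by (auto simp: Un_commute Int_commute)
  ultimately show ?thesis
    unfolding merge_eq_image Union_Un_distrib image_Un
    by (intro arg_cong2[where f = "(\<union>)"] image_cong) auto
qed

lemma Union_vmap: "\<Union>(vmap f S) = f ` \<Union>S"
  by (auto simp: vmap_def)

text \<open>An image vertex is labelled by the class of some preimage, which by hypothesis does not
  depend on the preimage. The condition is weaker than injectivity, so rows may be folded together
  along edges.\<close>

lemma linked_vmap:
  assumes "\<And>x y. x \<in> \<Union>S \<Longrightarrow> y \<in> \<Union>S \<Longrightarrow> f x = f y \<Longrightarrow> linked S x y"
    and x: "x \<in> \<Union>S" and y: "y \<in> \<Union>S"
  shows "linked (vmap f S) (f x) (f y) \<longleftrightarrow> linked S x y"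
proof
  let ?g = "\<lambda>z. {w. linked S (inv_into (\<Union>S) f z) w}"
  have inv: "?g (f z) = {w. linked S z w}" if "z \<in> \<Union>S" for z
    using that linked_cls_eq assms(1) by (metis f_inv_into_f image_eqI inv_into_into)
  assume "linked (vmap f S) (f x) (f y)"
  then have "?g (f x) = ?g (f y)"
  proof (rule linked_invariant)
    fix B u v assume "B \<in> vmap f S" "u \<in> B" "v \<in> B"
    then obtain C a b where C: "C \<in> S" "a \<in> C" "b \<in> C" "u = f a" "v = f b"
      by (auto simp: vmap_def)
    then have "{w. linked S a w} = {w. linked S b w}"
      by (blast intro: linked_block linked_sym linked_trans)
    then have "?g (f a) = ?g (f b)" using inv C by blast
    then show "?g u = ?g v" using C by simp
  qed
  then show "linked S x y" using inv x y linked_cls_eq by metis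
next
  assume "linked S x y"
  then show "linked (vmap f S) (f x) (f y)"
    unfolding linked_def block_rel_vmap
  proof induction
    case (base y)
    then show ?case by force
  next
    case (step y z)
    then have "(f y, f z) \<in> map_prod f f ` block_rel S" by force
    with step show ?case by (meson trancl.trancl_into_trancl)
  qed
qed

lemma card_merge_vmap:
  assumes "\<And>x y. x \<in> \<Union>S \<Longrightarrow> y \<in> \<Union>S \<Longrightarrow> f x = f y \<Longrightarrow> linked S x y"
  shows "card (merge (vmap f S)) = card (merge S)"
proof -
  let ?g = "\<lambda>z. {w. linked (vmap f S) z w}"
  have "card (merge S) = card ((\<lambda>x. ?g (f x)) ` \<Union>S)"
  proof (rule card_merge)
    fix x y assume xy: "x \<in> \<Union>S" "y \<in> \<Union>S"
    have "?g (f x) = ?g (f y) \<longleftrightarrow> linked (vmap f S) (f x) (f y)"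
      by (rule linked_cls_eq) (unfold Union_vmap, rule imageI[OF xy(1)])
    also have "\<dots> \<longleftrightarrow> linked S x y"
      by (rule linked_vmap[OF assms xy])
    finally show "?g (f x) = ?g (f y) \<longleftrightarrow> linked S x y" .
  qed
  then show ?thesis unfolding merge_eq_image[of "vmap f S"] Union_vmap image_image by simp
qed

text \<open>Sending each component of \<open>S\<close> to the component of \<open>T\<close>
  containing it is onto. If the finite numbers agree it is also injective, so \<open>T\<close> joins
  nothing that \<open>S\<close> keeps apart.\<close>

lemma card_merge_coarser:
  assumes fin: "finite (\<Union>S)" and U: "\<Union>S = \<Union>T" and le: "\<And>x y. linked S x y \<Longrightarrow> linked T x y"
  shows "card (merge T) \<le> card (merge S)"
    and "card (merge T) = card (merge S) \<Longrightarrow> linked T x y \<Longrightarrow> linked S x y"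
proof -
  let ?f = "\<lambda>x. {w. linked S x w}" and ?g = "\<lambda>x. {w. linked T x w}"
  define h where "h C = ?g (inv_into (\<Union>S) ?f C)" for C
  have h: "h (?f z) = ?g z" if "z \<in> \<Union>S" for z
  proof -
    have "?f (inv_into (\<Union>S) ?f (?f z)) = ?f z" using that by (meson f_inv_into_f image_eqI)
    then have "linked S z (inv_into (\<Union>S) ?f (?f z))" using linked_cls_eq that by metis
    then have "linked T z (inv_into (\<Union>S) ?f (?f z))" by (rule le)
    then show ?thesis unfolding h_def using linked_cls_eq that U by metis
  qed
  have T: "merge T = h ` merge S"
    unfolding merge_eq_image image_image U[symmetric] using h by (intro image_cong) auto
  then show "card (merge T) \<le> card (merge S)"
    using card_image_le[OF finite_merge[OF fin]] by simp
  assume eq: "card (merge T) = card (merge S)" and xy: "linked T x y"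
  have inj: "inj_on h (merge S)"
    using eq T finite_merge[OF fin] by (simp add: eq_card_imp_inj_on)
  have xyS: "x \<in> \<Union>S" "y \<in> \<Union>S" using linked_in[OF xy] U by auto
  then have "h (?f x) = h (?f y)" using h xy linked_cls_eq U by metis
  then have "?f x = ?f y" using inj xyS by (meson inj_onD linked_class_in_merge)
  then show "linked S x y" using linked_cls_eq xyS by metis
qed

text \<open>A path through the new edge can be shortened so that it crosses the edge only once, in
  one of the two directions.\<close>

lemma linked_insert_edge:
  assumes "u \<in> \<Union>S" "v \<in> \<Union>S"
  shows "linked (insert {u, v} S) x y \<longleftrightarrow>
    linked S x y \<or> linked S x u \<and> linked S v y \<or> linked S x v \<and> linked S u y"
proof
  assume "linked (insert {u, v} S) x y"
  then show "linked S x y \<or> linked S x u \<and> linked S v y \<or> linked S x v \<and> linked S u y"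
    unfolding linked_def[of "insert _ _"]
  proof induction
    case (base y)
    then have "linked S x y \<or> x \<in> {u, v} \<and> y \<in> {u, v}"
      by (auto simp: block_rel_def intro: linked_block)
    then show ?case using linked_refl assms by blast
  next
    case (step y z)
    from step(2) have "linked S y z \<or> y \<in> {u, v} \<and> z \<in> {u, v}"
      by (auto simp: block_rel_def intro: linked_block)
    with step(3) show ?case
      using linked_refl[OF assms(1)] linked_refl[OF assms(2)]
      by (blast intro: linked_sym linked_trans)
  qed
next
  have uv: "linked (insert {u, v} S) u v" by (rule linked_block[of "{u, v}"]) auto
  have le: "linked (insert {u, v} S) a b" if "linked S a b" for a b
    using that by (rule linked_mono[rotated]) auto
  assume "linked S x y \<or> linked S x u \<and> linked S v y \<or> linked S x v \<and> linked S u y"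
  then show "linked (insert {u, v} S) x y"
    by (elim disjE conjE)
      (assumption | rule le linked_trans[OF linked_trans[OF le uv] le]
        linked_trans[OF linked_trans[OF le linked_sym[OF uv]] le])+
qed

lemma card_merge_insert_edge:
  assumes fin: "finite (\<Union>S)" and uv: "u \<in> \<Union>S" "v \<in> \<Union>S"
  shows "card (merge S) = card (merge (insert {u, v} S)) + (if linked S u v then 0 else 1)"
proof (cases "linked S u v")
  case True
  then have "linked (insert {u, v} S) = linked S"
    unfolding fun_eq_iff linked_insert_edge[OF uv] by (meson linked_sym linked_trans)
  moreover have "\<Union>(insert {u, v} S) = \<Union>S" using uv by auto
  ultimately show ?thesis using True by (simp add: merge_eq_image)
next
  case False
  let ?c = "\<lambda>x. {w. linked S x w}"
  \<comment> \<open>The component of \<open>v\<close> takes over the label of the component of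
    \<open>u\<close>; the labels in use are then all classes of \<open>S\<close> except that of
    \<open>v\<close>.\<close>
  define g where "g x = (if linked S v x then ?c u else ?c x)" for x
  have U: "\<Union>(insert {u, v} S) = \<Union>S" using uv by auto
  have "card (merge (insert {u, v} S)) = card (g ` \<Union>(insert {u, v} S))"
  proof (rule card_merge)
    fix x y assume "x \<in> \<Union>(insert {u, v} S)" "y \<in> \<Union>(insert {u, v} S)"
    then have xy: "x \<in> \<Union>S" "y \<in> \<Union>S" using U by auto
    have c: "?c a = ?c b \<longleftrightarrow> linked S a b" if "a \<in> \<Union>S" for a b
      using that by (rule linked_cls_eq)
    have "g x = g y \<longleftrightarrow> linked S (if linked S v x then u else x) (if linked S v y then u else y)"
      using c[OF xy(1)] c[OF uv(1)] by (simp add: g_def linked_refl[OF uv(1)])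
    also have "\<dots> \<longleftrightarrow> linked (insert {u, v} S) x y"
      unfolding linked_insert_edge[OF uv] using False
      by (cases "linked S v x"; cases "linked S v y"; simp add: linked_refl[OF uv(1)];
        metis linked_sym linked_trans)
    finally show "g x = g y \<longleftrightarrow> linked (insert {u, v} S) x y" .
  qed
  also have "g ` \<Union>(insert {u, v} S) = merge S - {?c v}"
    unfolding U merge_eq_image
  proof (intro equalityI subsetI)
    fix C assume "C \<in> g ` \<Union>S"
    then obtain x where x: "x \<in> \<Union>S" "C = g x" by auto
    show "C \<in> ?c ` \<Union>S - {?c v}"
    proof (cases "linked S v x")
      case True
      then show ?thesis using x uv False linked_cls_eq[of u S v] by (auto simp: g_def)
    next
      case f: False
      then show ?thesis using x linked_cls_eq[of x S v] linked_sym[of S x v] by (auto simp: g_def)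
    qed
  next
    fix C assume "C \<in> ?c ` \<Union>S - {?c v}"
    then obtain x where x: "x \<in> \<Union>S" "C = ?c x" "?c x \<noteq> ?c v" by auto
    then have "\<not> linked S v x" using linked_cls_eq uv(2) by metis
    then show "C \<in> g ` \<Union>S" using x by (auto simp: g_def)
  qed
  finally have "card (merge (insert {u, v} S)) = card (merge S - {?c v})" .
  moreover have "?c v \<in> merge S" using uv by (rule_tac linked_class_in_merge)
  ultimately show ?thesis
    using False finite_merge[OF fin] card_Suc_Diff1[of "merge S" "?c v"] by simp
qed

text \<open>Merging along \<open>E\<close> lowers the number of components less, the coarser the starting point.\<close>

lemma card_merge_submodular:
  assumes fin: "finite (\<Union>S)" and U: "\<Union>S = \<Union>T" and le: "\<And>x y. linked S x y \<Longrightarrow> linked T x y"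
    and E: "finite E" "\<And>e. e \<in> E \<Longrightarrow> \<exists>u\<in>\<Union>S. \<exists>v\<in>\<Union>S. e = {u, v}"
  shows "card (merge (E \<union> S)) + card (merge T) \<le> card (merge S) + card (merge (E \<union> T))"
  using E
proof (induction rule: finite_induct)
  case (insert e E)
  obtain u v where uv: "u \<in> \<Union>S" "v \<in> \<Union>S" "e = {u, v}"
    using insert.prems[OF insertI1] by blast
  have E: "\<exists>u\<in>\<Union>S. \<exists>v\<in>\<Union>S. e' = {u, v}" if "e' \<in> E" for e'
    using insert.prems[OF insertI2[OF that]] .
  have "e' \<subseteq> \<Union>S" if "e' \<in> E" for e'
    using E[OF that] by (elim bexE) (simp only: insert_subset empty_subsetI simp_thms)
  then have "\<Union>E \<subseteq> \<Union>S" by (rule Sup_least)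
  then have "\<Union>(E \<union> S) = \<Union>S" and "\<Union>(E \<union> T) = \<Union>T"
    unfolding Union_Un_distrib U by (simp_all only: Un_absorb1)
  then have S: "card (merge (E \<union> S)) = card (merge (insert e (E \<union> S))) + (if linked (E \<union> S) u v then 0 else 1)"
    and T: "card (merge (E \<union> T)) = card (merge (insert e (E \<union> T))) + (if linked (E \<union> T) u v then 0 else 1)"
    using uv U fin card_merge_insert_edge[of "E \<union> S" u v] card_merge_insert_edge[of "E \<union> T" u v]
    by simp_all
  \<comment> \<open>An edge that is redundant over \<open>S\<close> is redundant over the coarser
    \<open>T\<close>, so adding it costs \<open>T\<close> at most as many components as
    \<open>S\<close>.\<close>
  have "linked (E \<union> T) u v" if "linked (E \<union> S) u v"
    using that
  proof (rule linked_subsume)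
    fix B x y assume B: "B \<in> E \<union> S" "x \<in> B" "y \<in> B"
    show "linked (E \<union> T) x y"
    proof (cases "B \<in> E")
      case True then show ?thesis using B by (intro linked_block[of B]) auto
    next
      case False
      then have "linked T x y" using B by (intro le linked_block[of B]) auto
      then show ?thesis by (rule linked_mono[rotated]) auto
    qed
  qed
  then have "(if linked (E \<union> T) u v then 0 else 1) \<le> (if linked (E \<union> S) u v then 0 else 1 :: nat)"
    by simp
  moreover have "card (merge (E \<union> S)) + card (merge T) \<le> card (merge S) + card (merge (E \<union> T))"
    by (rule insert.IH[OF E])
  ultimately show ?case unfolding Un_insert_left using S T by linarith
qed simp


section \<open>Components of a composition\<close>

definition two_rows :: "nat set \<Rightarrow> vertex set" where
  "two_rows A = {Top, Bot} \<times> A"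

text \<open>Column sets are arbitrary, because the right factor of a tensor product occupies shifted
  columns and the pieces of a diagram may occupy scattered ones. On disjoint column sets the tensor
  product becomes a plain union.\<close>

definition PartsOn :: "nat set \<Rightarrow> diagram set" where
  "PartsOn A = {p. partition_on (two_rows A) p}"

definition id_on :: "nat set \<Rightarrow> diagram" where
  "id_on A = (\<lambda>i. {(Top, i), (Bot, i)}) ` A"

definition joined :: "nat set \<Rightarrow> diagram \<Rightarrow> nat" where
  "joined A p = card (merge (p \<union> id_on A))"

lemma Parts_eq: "Parts k = PartsOn {1..k}"
  by (simp add: Parts_def PartsOn_def verts_def two_rows_def)

lemma two_rows_Un: "two_rows (A \<union> B) = two_rows A \<union> two_rows B"
  by (auto simp: two_rows_def)

lemma two_rows_disjoint: "A \<inter> B = {} \<Longrightarrow> two_rows A \<inter> two_rows B = {}"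
  by (auto simp: two_rows_def)

lemma finite_two_rows: "finite A \<Longrightarrow> finite (two_rows A)"
  by (simp add: two_rows_def)

lemma Union_PartsOn: "p \<in> PartsOn A \<Longrightarrow> \<Union>p = two_rows A"
  by (simp add: PartsOn_def partition_on_def)

lemma empty_notin_PartsOn: "p \<in> PartsOn A \<Longrightarrow> {} \<notin> p"
  by (simp add: PartsOn_def partition_on_def)

lemma PartsOn_block_subset: "p \<in> PartsOn A \<Longrightarrow> C \<in> p \<Longrightarrow> C \<subseteq> two_rows A"
  using Union_PartsOn by blast

lemma finite_PartsOn_mem: "p \<in> PartsOn A \<Longrightarrow> finite A \<Longrightarrow> finite p"
  unfolding PartsOn_def using finite_elements finite_two_rows by blast

lemma PartsOn_disjoint: "p \<in> PartsOn A \<Longrightarrow> q \<in> PartsOn B \<Longrightarrow> A \<inter> B = {} \<Longrightarrow> p \<inter> q = {}"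
  using two_rows_disjoint[of A B] PartsOn_block_subset[of p A] PartsOn_block_subset[of q B]
    empty_notin_PartsOn[of p A] by (metis Int_emptyI Int_subset_iff subset_empty)

lemma Union_id_on: "\<Union>(id_on A) = two_rows A"
  by (auto simp: id_on_def two_rows_def)

lemma id_on_Un: "id_on (A \<union> B) = id_on A \<union> id_on B"
  by (auto simp: id_on_def)

lemma id_part_eq: "id_part k = id_on {1..k}"
  by (simp add: id_part_def id_on_def)

lemma id_on_in_PartsOn: "id_on A \<in> PartsOn A"
  unfolding PartsOn_def mem_Collect_eq
  by (rule partition_onI) (auto simp: id_on_def two_rows_def disjnt_def)

lemma PartsOn_Un:
  assumes "p \<in> PartsOn A" "q \<in> PartsOn B" "A \<inter> B = {}"
  shows "p \<union> q \<in> PartsOn (A \<union> B)"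
  using assms(1,2) two_rows_disjoint[OF assms(3)] disjoint_union[of p q]
  unfolding PartsOn_def two_rows_Un mem_Collect_eq partition_on_def by auto

lemma merge_partition:
  assumes p: "partition_on V p" shows "merge p = p"
proof -
  have U: "\<Union>p = V" using p by (simp add: partition_on_def)
  have cls: "{y. linked p x y} = C" if C: "C \<in> p" "x \<in> C" for x C
  proof -
    have "y \<in> C" if "linked p x y" for y
    proof -
      have "(x \<in> C) = (y \<in> C)"
        using that
      proof (rule linked_invariant)
        fix B x y assume "B \<in> p" "x \<in> B" "y \<in> B"
        then show "(x \<in> C) = (y \<in> C)"
          using partition_onD2[OF p] C(1) by (auto simp: disjoint_def)
      qed
      with C show ?thesis by simp
    qed
    with C show ?thesis by (auto intro: linked_block)
  qed
  show ?thesis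
  proof (intro equalityI subsetI)
    fix C assume "C \<in> merge p"
    then obtain x where x: "x \<in> \<Union>p" "C = {y. linked p x y}" by (auto simp: merge_eq_image)
    then show "C \<in> p" using cls by blast
  next
    fix C assume C: "C \<in> p"
    then obtain x where "x \<in> C" using partition_onD3[OF p] by (metis ex_in_conv)
    with C cls show "C \<in> merge p" by (metis UnionI linked_class_in_merge)
  qed
qed

lemma card_merge_Un:
  assumes "\<Union>S \<inter> \<Union>T = {}" "finite (\<Union>S)" "finite (\<Union>T)"
  shows "card (merge (S \<union> T)) = card (merge S) + card (merge T)"
proof -
  have "C \<notin> merge T" if C: "C \<in> merge S" for C
  proof
    assume "C \<in> merge T"
    then have "C \<subseteq> \<Union>S \<inter> \<Union>T"
      unfolding Union_merge[of S, symmetric] Union_merge[of T, symmetric] using C by (intro Int_greatest Union_upper)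
    then show False using assms(1) C partition_onD3[OF partition_on_merge[of S]] by auto
  qed
  then have "merge S \<inter> merge T = {}" by blast
  then show ?thesis
    using assms by (simp add: merge_Un card_Un_disjoint finite_merge)
qed

lemma joined_Un:
  assumes "p \<in> PartsOn A" "q \<in> PartsOn B" "A \<inter> B = {}" "finite A" "finite B"
  shows "joined (A \<union> B) (p \<union> q) = joined A p + joined B q"
proof -
  have "p \<union> q \<union> id_on (A \<union> B) = (p \<union> id_on A) \<union> (q \<union> id_on B)" by (auto simp: id_on_Un)
  moreover have "\<Union>(p \<union> id_on A) = two_rows A" "\<Union>(q \<union> id_on B) = two_rows B"
    using assms by (simp_all add: Union_PartsOn Union_id_on)
  ultimately show ?thesis
    using assms two_rows_disjoint by (simp add: joined_def card_merge_Un finite_two_rows)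
qed

definition row_move :: "row \<Rightarrow> row \<Rightarrow> vertex \<Rightarrow> vertex" where
  "row_move r s = map_prod (id(r := s)) id"

lemma move_row_eq: "move_row r s = vmap (row_move r s)"
  by (simp add: fun_eq_iff move_row_def row_move_def)

lemma row_move_simps [simp]:
  "row_move r s (r, i) = (s, i)" "t \<noteq> r \<Longrightarrow> row_move r s (t, i) = (t, i)"
  by (simp_all add: row_move_def)

lemma row_move_image: "row_move r s ` (R \<times> A) = (id(r := s)) ` R \<times> A"
  unfolding row_move_def by (rule map_prod_surj_on) simp_all

lemma inj_on_row_move: "r \<in> {Top, Bot} \<Longrightarrow> inj_on (row_move r Mid) (two_rows A)"
  by (auto simp: inj_on_def two_rows_def row_move_def split: if_splits)

lemma card_merge_move:
  assumes "r \<in> {Top, Bot}" "\<Union>S = two_rows A"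
  shows "card (merge (move_row r Mid S)) = card (merge S)"
  unfolding move_row_eq
  by (rule card_merge_vmap)
    (use inj_on_row_move[OF assms(1), of A] assms(2) in \<open>auto dest!: inj_onD intro: linked_refl\<close>)

lemma Union_move_Top: "\<Union>S = two_rows A \<Longrightarrow> \<Union>(move_row Top Mid S) = {Mid, Bot} \<times> A"
  by (auto simp: move_row_eq Union_vmap two_rows_def row_move_image)

lemma Union_move_Bot: "\<Union>S = two_rows A \<Longrightarrow> \<Union>(move_row Bot Mid S) = {Top, Mid} \<times> A"
  by (auto simp: move_row_eq Union_vmap two_rows_def row_move_image)

lemma card_merge_singletons:
  "finite A \<Longrightarrow> card (merge ((\<lambda>i. {(r, i)}) ` A)) = card A"
proof -
  have "partition_on ({r} \<times> A) ((\<lambda>i. {(r, i)}) ` A)"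
    by (rule partition_onI) (auto simp: disjnt_def)
  then show ?thesis by (simp add: merge_partition card_image inj_on_def)
qed

lemma Union_stack_parts:
  assumes "p1 \<in> PartsOn A" "p2 \<in> PartsOn A"
  shows "\<Union>(move_row Top Mid p1 \<union> move_row Bot Mid p2) = {Top, Mid, Bot} \<times> A"
  using Union_move_Top[OF Union_PartsOn[OF assms(1)]] Union_move_Bot[OF Union_PartsOn[OF assms(2)]]
  by auto

text \<open>
  The two joins with the identity arise by adding to \<open>p2\<close> (resp. \<open>p1\<close>) the vertical edges between the
  rows it lives on. By submodularity, adding the same edges to the stacked diagram, which is coarser,
  merges at most as many components; with all of them added it becomes the join of \<open>p1\<close>, \<open>p2\<close> and
  the identity.
\<close>

lemma card_stack_le:
  assumes A: "finite A" and p1: "p1 \<in> PartsOn A" and p2: "p2 \<in> PartsOn A"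
  shows "card (stack p1 p2) + joined A p1 + joined A p2 \<le>
    card p1 + card p2 + card (merge (p1 \<union> p2 \<union> id_on A))"
proof -
  let ?q1 = "move_row Top Mid p1" and ?q2 = "move_row Bot Mid p2"
  let ?S = "?q1 \<union> ?q2"
  let ?E = "(\<lambda>i. {(Top, i), (Mid, i)}) ` A" and ?F = "(\<lambda>i. {(Mid, i), (Bot, i)}) ` A"
  \<comment> \<open>These singletons supply the outer row missing from \<open>?q1\<close> and from
    \<open>?q2\<close> respectively, since submodularity compares diagrams on the same vertices.
    They add \<open>card A\<close> components on both sides, which cancel.\<close>
  let ?T = "(\<lambda>i. {(Top, i)}) ` A" and ?B = "(\<lambda>i. {(Bot, i)}) ` A"
  let ?V = "{Top, Mid, Bot} \<times> A"
  have US: "\<Union>?S = ?V" by (rule Union_stack_parts[OF p1 p2])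
  have U1: "\<Union>?q1 = {Mid, Bot} \<times> A" and U2: "\<Union>?q2 = {Top, Mid} \<times> A"
    using Union_move_Top Union_move_Bot Union_PartsOn p1 p2 by metis+
  have UT: "\<Union>?T = {Top} \<times> A" and UB: "\<Union>?B = {Bot} \<times> A" by auto
  have UES: "\<Union>(?E \<union> ?S) = ?V" unfolding Union_Un_distrib[of ?E] US by auto
  have fin: "finite (R \<times> A)" for R :: "row set"
  proof -
    have "R \<subseteq> {Top, Mid, Bot}" using row.exhaust by blast
    then show ?thesis using A by (auto intro!: finite_cartesian_product elim: finite_subset)
  qed
  have E: "?E = move_row Bot Mid (id_on A)" and F: "?F = move_row Top Mid (id_on A)"
    by (simp_all add: move_row_eq vmap_def id_on_def image_image)
  have m2: "card (merge (?E \<union> ?q2)) = joined A p2"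
    using card_merge_move[of Bot "p2 \<union> id_on A" A] p2
    by (simp add: E joined_def move_row_eq vmap_Un Un_commute Union_PartsOn Union_id_on)
  have m1: "card (merge (?F \<union> ?q1)) = joined A p1"
    using card_merge_move[of Top "p1 \<union> id_on A" A] p1
    by (simp add: F joined_def move_row_eq vmap_Un Un_commute Union_PartsOn Union_id_on)
  have mp: "merge p = p" if "p \<in> PartsOn A" for p
    using that merge_partition by (simp add: PartsOn_def)
  have n2: "card (merge ?q2) = card p2" and n1: "card (merge ?q1) = card p1"
    using card_merge_move[of Bot p2 A] card_merge_move[of Top p1 A]
    by (simp_all add: Union_PartsOn p1 p2 mp)
  have "card (merge (?E \<union> (?q2 \<union> ?B))) + card (merge ?S) \<le>
      card (merge (?q2 \<union> ?B)) + card (merge (?E \<union> ?S))"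
  proof (rule card_merge_submodular)
    show "finite (\<Union>(?q2 \<union> ?B))" unfolding Union_Un_distrib U2 UB by (intro finite_UnI fin)
    show "\<Union>(?q2 \<union> ?B) = \<Union>?S" unfolding US unfolding Union_Un_distrib U2 UB by auto
    show "linked ?S x y" if "linked (?q2 \<union> ?B) x y" for x y
      using that
    proof (rule linked_subsume)
      fix B x y assume "B \<in> ?q2 \<union> ?B" "x \<in> B" "y \<in> B"
      then consider "B \<in> ?S" | "x = y" "x \<in> ?V" by auto
      then show "linked ?S x y"
        using \<open>x \<in> B\<close> \<open>y \<in> B\<close> US by cases (auto intro: linked_block linked_refl)
    qed
    show "\<exists>u\<in>\<Union>(?q2 \<union> ?B). \<exists>v\<in>\<Union>(?q2 \<union> ?B). e = {u, v}" if "e \<in> ?E" for e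
      using that unfolding Union_Un_distrib U2 UB by auto
  qed (use A in simp)
  moreover have "card (merge (?E \<union> (?q2 \<union> ?B))) = joined A p2 + card A"
  proof -
    have "\<Union>(?E \<union> ?q2) = {Top, Mid} \<times> A" unfolding Union_Un_distrib U2 by auto
    then show ?thesis
      using card_merge_Un[of "?E \<union> ?q2" ?B] UB fin A m2 card_merge_singletons[of A Bot]
      by (auto simp: Un_assoc)
  qed
  moreover have "card (merge (?q2 \<union> ?B)) = card p2 + card A"
    using card_merge_Un[of "?q2" ?B] U2 UB fin A n2 card_merge_singletons[of A Bot] by auto
  moreover have "card (merge (?F \<union> (?q1 \<union> ?T))) + card (merge (?E \<union> ?S)) \<le>
      card (merge (?q1 \<union> ?T)) + card (merge (?F \<union> (?E \<union> ?S)))"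
  proof (rule card_merge_submodular)
    show "finite (\<Union>(?q1 \<union> ?T))" unfolding Union_Un_distrib U1 UT by (intro finite_UnI fin)
    show "\<Union>(?q1 \<union> ?T) = \<Union>(?E \<union> ?S)" unfolding UES unfolding Union_Un_distrib U1 UT by auto
    show "linked (?E \<union> ?S) x y" if "linked (?q1 \<union> ?T) x y" for x y
      using that
    proof (rule linked_subsume)
      fix B x y assume "B \<in> ?q1 \<union> ?T" "x \<in> B" "y \<in> B"
      then consider "B \<in> ?E \<union> ?S" | "x = y" "x \<in> ?V" by auto
      then show "linked (?E \<union> ?S) x y"
        using \<open>x \<in> B\<close> \<open>y \<in> B\<close> UES by cases (blast intro: linked_block linked_refl)+
    qed
    show "\<exists>u\<in>\<Union>(?q1 \<union> ?T). \<exists>v\<in>\<Union>(?q1 \<union> ?T). e = {u, v}" if "e \<in> ?F" for e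
      using that unfolding Union_Un_distrib U1 UT by auto
  qed (use A in simp)
  moreover have "card (merge (?F \<union> (?q1 \<union> ?T))) = joined A p1 + card A"
  proof -
    have "\<Union>(?F \<union> ?q1) = {Mid, Bot} \<times> A" unfolding Union_Un_distrib U1 by auto
    then show ?thesis
      using card_merge_Un[of "?F \<union> ?q1" ?T] UT fin A m1 card_merge_singletons[of A Top]
      by (auto simp: Un_assoc)
  qed
  moreover have "card (merge (?q1 \<union> ?T)) = card p1 + card A"
    using card_merge_Un[of "?q1" ?T] U1 UT fin A n1 card_merge_singletons[of A Top] by auto
  moreover have "card (merge (?F \<union> (?E \<union> ?S))) \<le> card (merge (p1 \<union> p2 \<union> id_on A))"
  proof -
    \<comment> \<open>Folding \<open>Mid\<close> onto \<open>Top\<close> identifies only vertices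
      joined by an edge of \<open>?E\<close>, so the number of components is kept, and the folded
      diagram lives on the same two rows as the triple join.\<close>
    let ?g = "row_move Mid Top" and ?X = "?F \<union> (?E \<union> ?S)"
    have EX: "linked ?X (Top, i) (Mid, i)" if "i \<in> A" for i
      using that by (intro linked_block[of "{(Top, i), (Mid, i)}"]) auto
    have UX: "\<Union>?X = ?V" unfolding Union_Un_distrib[of ?F] UES by auto
    have "card (merge (vmap ?g ?X)) = card (merge ?X)"
    proof (rule card_merge_vmap)
      fix x y assume xy: "x \<in> \<Union>?X" "y \<in> \<Union>?X" "?g x = ?g y"
      have g: "linked ?X (?g z) z" if "z \<in> \<Union>?X" for z
        using EX linked_refl[OF that] that[unfolded UX] by (cases z) auto
      show "linked ?X x y"
        using linked_trans[OF linked_sym[OF g[OF xy(1)]]] g[OF xy(2)] unfolding xy(3) .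
    qed
    moreover have "card (merge (vmap ?g ?X)) \<le> card (merge (p1 \<union> p2 \<union> id_on A))"
    proof (rule card_merge_coarser(1))
      have U: "\<Union>(p1 \<union> p2 \<union> id_on A) = two_rows A" using p1 p2 by (simp add: Union_PartsOn Union_id_on)
      then show "finite (\<Union>(p1 \<union> p2 \<union> id_on A))" using finite_two_rows[OF A] by simp
      show "\<Union>(p1 \<union> p2 \<union> id_on A) = \<Union>(vmap ?g ?X)"
        unfolding U Union_vmap UX by (auto simp: two_rows_def row_move_image)
      have I: "id_on A = vmap ?g ?F" by (simp add: vmap_def id_on_def image_image)
      have q1: "vmap ?g ?q1 = p1"
      proof -
        have "vmap ?g ?q1 = vmap id p1"
          unfolding move_row_eq vmap_vmap
          by (rule vmap_cong) (use Union_PartsOn[OF p1] in \<open>auto simp: two_rows_def\<close>)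
        then show ?thesis by simp
      qed
      have q2: "vmap ?g ?q2 = vmap (row_move Bot Top) p2"
        unfolding move_row_eq vmap_vmap
        by (rule vmap_cong) (use Union_PartsOn[OF p2] in \<open>auto simp: two_rows_def\<close>)
      fix x y assume "linked (p1 \<union> p2 \<union> id_on A) x y"
      then show "linked (vmap ?g ?X) x y"
      proof (rule linked_subsume)
        fix B x y assume B: "B \<in> p1 \<union> p2 \<union> id_on A" "x \<in> B" "y \<in> B"
        show "linked (vmap ?g ?X) x y"
        proof (cases "B \<in> p1 \<union> id_on A")
          case True
          then have "B \<in> vmap ?g ?X" unfolding vmap_Un q1 I by blast
          then show ?thesis using B by (auto intro: linked_block)
        next
          case False
          \<comment> \<open>After folding, only the image of \<open>B\<close> with its bottom
            vertices moved to the top row is present; identity edges lead from this image back to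
            \<open>B\<close>.\<close>
          then have "B \<in> p2" using B by blast
          then have "row_move Bot Top ` B \<in> vmap ?g ?X" unfolding vmap_Un q2 by (auto simp: vmap_def)
          then have 1: "linked (vmap ?g ?X) (row_move Bot Top x) (row_move Bot Top y)"
            by (rule linked_block) (use B in auto)
          have 2: "linked (vmap ?g ?X) (row_move Bot Top z) z" if "z \<in> B" for z
          proof -
            from that \<open>B \<in> p2\<close> obtain r i where z: "z = (r, i)" "i \<in> A" "r \<in> {Top, Bot}"
              using PartsOn_block_subset[OF p2] by (force simp: two_rows_def)
            then have "{(Top, i), (Bot, i)} \<in> vmap ?g ?X"
              unfolding vmap_Un I[symmetric] by (auto simp: id_on_def)
            then show ?thesis by (rule linked_block) (use z in auto)
          qed
          show ?thesis by (rule linked_trans[OF linked_trans[OF linked_sym[OF 2] 1] 2]) (use B in auto)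
        qed
      qed
    qed
    ultimately show ?thesis by simp
  qed
  ultimately show ?thesis unfolding stack_def by linarith
qed

lemma card_id_on: "card (id_on A) = card A"
  unfolding id_on_def by (rule card_image) (auto simp: inj_on_def doubleton_eq_iff)

lemma part_comp_block:
  "C \<in> part_comp p1 p2 \<longleftrightarrow> C \<noteq> {} \<and> (\<exists>D\<in>stack p1 p2. C = D - {Mid} \<times> UNIV)"
  by (auto simp: part_comp_def)

lemma Union_stack:
  assumes "p1 \<in> PartsOn A" "p2 \<in> PartsOn A"
  shows "\<Union>(stack p1 p2) = {Top, Mid, Bot} \<times> A"
  unfolding stack_def Union_merge by (rule Union_stack_parts[OF assms])

lemma Union_part_comp:
  assumes "p1 \<in> PartsOn A" "p2 \<in> PartsOn A"
  shows "\<Union>(part_comp p1 p2) = two_rows A"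
proof -
  have "\<Union>(part_comp p1 p2) = \<Union>(stack p1 p2) - {Mid} \<times> UNIV"
    by (auto simp: part_comp_def)
  also have "\<dots> = two_rows A" unfolding Union_stack[OF assms] by (auto simp: two_rows_def)
  finally show ?thesis .
qed

lemma finite_stack:
  assumes "p1 \<in> PartsOn A" "p2 \<in> PartsOn A" "finite A"
  shows "finite (stack p1 p2)"
  unfolding stack_def
  by (rule finite_merge) (simp only: Union_stack_parts[OF assms(1,2)], simp add: assms(3))

text \<open>Deleting the middle row is injective on the components that reach an outer row, because
  components are disjoint; the remaining ones are counted by \<open>kappa\<close>.\<close>

lemma card_part_comp_kappa:
  assumes "p1 \<in> PartsOn A" "p2 \<in> PartsOn A" "finite A"
  shows "card (part_comp p1 p2) + kappa p1 p2 = card (stack p1 p2)"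
proof -
  let ?S = "stack p1 p2" and ?M = "{Mid} \<times> UNIV :: vertex set"
  have fin: "finite ?S" by (rule finite_stack[OF assms])
  have "part_comp p1 p2 = (\<lambda>C. C - ?M) ` {C \<in> ?S. \<not> C \<subseteq> ?M}"
    unfolding part_comp_def by blast
  moreover have "inj_on (\<lambda>C. C - ?M) {C \<in> ?S. \<not> C \<subseteq> ?M}"
  proof (rule inj_onI)
    fix C D assume C: "C \<in> {C \<in> ?S. \<not> C \<subseteq> ?M}" and D: "D \<in> {C \<in> ?S. \<not> C \<subseteq> ?M}" and eq: "C - ?M = D - ?M"
    then obtain x where "x \<in> C" "x \<in> D" by blast
    moreover have "disjoint ?S" unfolding stack_def by (rule partition_onD2[OF partition_on_merge])
    ultimately show "C = D" using C D by (auto dest: disjointD)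
  qed
  ultimately have "card (part_comp p1 p2) = card {C \<in> ?S. \<not> C \<subseteq> ?M}"
    by (simp add: card_image)
  moreover have "card {C \<in> ?S. \<not> C \<subseteq> ?M} + card {C \<in> ?S. C \<subseteq> ?M} = card ?S"
    using fin by (subst card_Un_disjoint[symmetric]) (auto intro!: arg_cong[of _ _ card])
  ultimately show ?thesis by (simp add: kappa_def)
qed

text \<open>Folding the middle row onto the top row sends paths of the stacked diagram to paths of
  the triple join: a middle vertex is a top vertex of \<open>p1\<close> and, across an identity
  edge, a bottom vertex of \<open>p2\<close>.\<close>

lemma linked_part_comp_id:
  assumes p1: "p1 \<in> PartsOn A" and p2: "p2 \<in> PartsOn A"
    and xy: "linked (part_comp p1 p2 \<union> id_on A) x y"
  shows "linked (p1 \<union> p2 \<union> id_on A) x y"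
  using xy
proof (rule linked_subsume)
  let ?T = "p1 \<union> p2 \<union> id_on A"
  let ?g = "\<lambda>z. {w. linked ?T (row_move Mid Top z) w}"
  have U: "\<Union>?T = two_rows A" using p1 p2 by (simp add: Union_PartsOn Union_id_on)
  fix B x y assume B: "B \<in> part_comp p1 p2 \<union> id_on A" "x \<in> B" "y \<in> B"
  show "linked ?T x y"
  proof (cases "B \<in> id_on A")
    case True
    with B show ?thesis by (intro linked_block[of B]) auto
  next
    case False
    with B obtain D where D: "D \<in> stack p1 p2" "B = D - {Mid} \<times> UNIV" by (auto simp: part_comp_block)
    have xyD: "x \<in> D" "y \<in> D" "row_move Mid Top x = x" "row_move Mid Top y = y"
      using B(2,3) D(2) by (cases x; cases y; force)+
    have "linked (move_row Top Mid p1 \<union> move_row Bot Mid p2) x y"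
      using merge_mem_iff D(1) xyD unfolding stack_def by blast
    then have "?g x = ?g y"
    proof (rule linked_invariant)
      fix C u v assume C: "C \<in> move_row Top Mid p1 \<union> move_row Bot Mid p2" "u \<in> C" "v \<in> C"
      have "\<exists>K\<in>p1 \<union> p2. \<forall>z\<in>C. \<exists>k\<in>K. linked ?T (row_move Mid Top z) k"
      proof (cases "C \<in> move_row Top Mid p1")
        case True
        then obtain K where K: "K \<in> p1" "C = row_move Top Mid ` K" by (auto simp: move_row_eq vmap_def)
        have "linked ?T (row_move Mid Top (row_move Top Mid k)) k" if k: "k \<in> K" for k
        proof -
          have "k \<in> two_rows A" using PartsOn_block_subset[OF p1 K(1)] k by blast
          then have "row_move Mid Top (row_move Top Mid k) = k" by (auto simp: two_rows_def)
          then show ?thesis using K k by (auto intro: linked_block)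
        qed
        with K show ?thesis by blast
      next
        case False
        then obtain K where K: "K \<in> p2" "C = row_move Bot Mid ` K" using C by (auto simp: move_row_eq vmap_def)
        have "linked ?T (row_move Mid Top (row_move Bot Mid k)) k" if k: "k \<in> K" for k
        proof -
          have "k \<in> two_rows A" using PartsOn_block_subset[OF p2 K(1)] k by blast
          then obtain i where i: "i \<in> A" "k = (Top, i) \<or> k = (Bot, i)" by (auto simp: two_rows_def)
          then have "{(Top, i), (Bot, i)} \<in> ?T" by (auto simp: id_on_def)
          then show ?thesis by (rule linked_block) (use i in auto)
        qed
        with K show ?thesis by blast
      qed
      then obtain K k l where "K \<in> ?T" "k \<in> K" "l \<in> K"
        and kl: "linked ?T (row_move Mid Top u) k" "linked ?T (row_move Mid Top v) l"
        using C(2,3) by blast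
      then have "linked ?T k l" by (auto intro: linked_block)
      then have "linked ?T (row_move Mid Top u) (row_move Mid Top v)"
        by (rule linked_trans[OF linked_trans[OF kl(1)] linked_sym[OF kl(2)]])
      then show "?g u = ?g v" by (rule linked_cls)
    qed
    then have "{w. linked ?T x w} = {w. linked ?T y w}" using xyD by simp
    moreover have "x \<in> \<Union>?T" unfolding U using B(1,2) D(2) False Union_part_comp[OF p1 p2] by blast
    ultimately show ?thesis by (simp only: linked_cls_eq)
  qed
qed

text \<open>The metric condition of \<open>Kset\<close> with all denominators cleared, see \<open>boxtimes_pairs_eq\<close>.\<close>

definition geodesic :: "nat set \<Rightarrow> diagram \<Rightarrow> diagram \<Rightarrow> bool" where
  "geodesic A p1 p2 \<longleftrightarrow> card (stack p1 p2) + joined A p1 + joined A p2 =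
    card p1 + card p2 + joined A (part_comp p1 p2)"

lemma geodesic_le:
  assumes p1: "p1 \<in> PartsOn A" and p2: "p2 \<in> PartsOn A" and A: "finite A"
  shows "card (stack p1 p2) + joined A p1 + joined A p2 \<le>
      card p1 + card p2 + joined A (part_comp p1 p2)"
    and "geodesic A p1 p2 \<Longrightarrow> linked (p1 \<union> p2 \<union> id_on A) x y \<Longrightarrow>
      linked (part_comp p1 p2 \<union> id_on A) x y"
proof -
  let ?S = "part_comp p1 p2 \<union> id_on A" and ?T = "p1 \<union> p2 \<union> id_on A"
  have U: "\<Union>?S = two_rows A" "\<Union>?T = two_rows A"
    using p1 p2 by (simp_all add: Union_PartsOn Union_id_on Union_part_comp)
  have le: "card (merge ?T) \<le> card (merge ?S)"
    by (rule card_merge_coarser(1))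
      (use U linked_part_comp_id[OF p1 p2] finite_two_rows[OF A] in \<open>simp_all\<close>)
  then show "card (stack p1 p2) + joined A p1 + joined A p2 \<le>
      card p1 + card p2 + joined A (part_comp p1 p2)"
    using card_stack_le[OF A p1 p2] unfolding joined_def[of A "part_comp p1 p2"] by linarith
  assume "geodesic A p1 p2" and xy: "linked ?T x y"
  \<comment> \<open>The geodesic equation combined with \<open>card_stack_le\<close> gives the
    inequality opposite to \<open>le\<close>.\<close>
  then have "card (merge ?T) = card (merge ?S)"
    using le card_stack_le[OF A p1 p2] unfolding geodesic_def joined_def[of A "part_comp p1 p2"] by linarith
  then show "linked ?S x y"
    using card_merge_coarser(2)[of ?S ?T x y] xy linked_part_comp_id[OF p1 p2] finite_two_rows[OF A]
    by (simp only: U)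
qed

definition geodesic_pairs :: "nat set \<Rightarrow> diagram \<Rightarrow> (diagram \<times> diagram) set" where
  "geodesic_pairs A p =
    {(p1, p2). p1 \<in> PartsOn A \<and> p2 \<in> PartsOn A \<and> part_comp p1 p2 = p \<and> geodesic A p1 p2}"

text \<open>Since \<open>id\<close> has \<open>k\<close> blocks, the distance from \<open>id\<close>
  to \<open>q\<close> is \<open>(k + |q|) / 2 - |q \<or> id|\<close>. After substitution the terms
  in \<open>k\<close> cancel and the halves of \<open>|p|\<close>, \<open>|p1|\<close>,
  \<open>|p2|\<close> combine to whole numbers; \<open>|p| + \<kappa>\<close> is the number of
  components of the stacked diagram.\<close>

lemma boxtimes_pairs_eq:
  assumes "p \<in> Parts k" shows "boxtimes_pairs p = geodesic_pairs {1..k} p"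
proof -
  have "p2 \<in> Kset k (part_comp p1 p2) p1 \<longleftrightarrow> geodesic {1..k} p1 p2"
    if "p1 \<in> Parts k" "p2 \<in> Parts k" for p1 p2
  proof -
    have stack: "real (card (part_comp p1 p2)) + real (kappa p1 p2) = real (card (stack p1 p2))"
      using card_part_comp_kappa[of p1 "{1..k}" p2] that
      by (simp only: of_nat_add[symmetric] Parts_eq finite_atLeastAtMost)
    have geo: "geodesic {1..k} p1 p2 \<longleftrightarrow>
      real (card (stack p1 p2)) + real (joined {1..k} p1) + real (joined {1..k} p2) =
      real (card p1) + real (card p2) + real (joined {1..k} (part_comp p1 p2))"
      unfolding geodesic_def by (simp only: of_nat_add[symmetric] of_nat_eq_iff)
    have dist: "part_dist (id_part k) q = (real k + real (card q)) / 2 - real (joined {1..k} q)" for q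
      by (simp add: part_dist_def nc_def part_join_def joined_def Un_commute id_part_eq card_id_on)
    have "part_dist (id_part k) (part_comp p1 p2) = part_dist (id_part k) p1 + part_dist (id_part k) p2 -
        (real k + real (nc (part_comp p1 p2)) - real (nc p1) - real (nc p2)) / 2 - real (kappa p1 p2) \<longleftrightarrow>
      geodesic {1..k} p1 p2"
      unfolding dist nc_def geo using stack by argo
    with that show ?thesis unfolding Kset_def by simp
  qed
  then show ?thesis
    unfolding boxtimes_pairs_def geodesic_pairs_def pdeg_eq[OF assms] Parts_eq[symmetric] by blast
qed

section \<open>Compositions over disjoint sets of columns\<close>

lemma stack_Un:
  assumes "p1 \<in> PartsOn A" "p2 \<in> PartsOn A" "q1 \<in> PartsOn B" "q2 \<in> PartsOn B" "A \<inter> B = {}"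
  shows "stack (p1 \<union> q1) (p2 \<union> q2) = stack p1 p2 \<union> stack q1 q2"
    and "stack p1 p2 \<inter> stack q1 q2 = {}"
proof -
  let ?f = "\<lambda>p1 p2. move_row Top Mid p1 \<union> move_row Bot Mid p2"
  have U: "\<Union>(?f p1 p2) = {Top, Mid, Bot} \<times> A" "\<Union>(?f q1 q2) = {Top, Mid, Bot} \<times> B"
    by (rule Union_stack_parts; fact)+
  have "?f (p1 \<union> q1) (p2 \<union> q2) = ?f p1 p2 \<union> ?f q1 q2"
    by (auto simp: move_row_eq vmap_Un)
  moreover have disj: "\<Union>(?f p1 p2) \<inter> \<Union>(?f q1 q2) = {}"
    unfolding U using assms(5) by auto
  ultimately show "stack (p1 \<union> q1) (p2 \<union> q2) = stack p1 p2 \<union> stack q1 q2"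
    unfolding stack_def by (simp only: merge_Un)
  have "C \<notin> stack q1 q2" if C: "C \<in> stack p1 p2" for C
  proof
    assume "C \<in> stack q1 q2"
    then have "C \<subseteq> \<Union>(stack p1 p2) \<inter> \<Union>(stack q1 q2)" using C by blast
    then have "C = {}" unfolding stack_def Union_merge by (simp only: disj subset_empty)
    then show False using C partition_onD3[OF partition_on_merge] unfolding stack_def by blast
  qed
  then show "stack p1 p2 \<inter> stack q1 q2 = {}" by blast
qed

lemma part_comp_Un:
  assumes "p1 \<in> PartsOn A" "p2 \<in> PartsOn A" "q1 \<in> PartsOn B" "q2 \<in> PartsOn B" "A \<inter> B = {}"
  shows "part_comp (p1 \<union> q1) (p2 \<union> q2) = part_comp p1 p2 \<union> part_comp q1 q2"
  unfolding part_comp_def stack_Un[OF assms] by auto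

lemma part_comp_in_PartsOn:
  assumes "p1 \<in> PartsOn A" "p2 \<in> PartsOn A"
  shows "part_comp p1 p2 \<in> PartsOn A"
  unfolding PartsOn_def mem_Collect_eq
proof (rule partition_onI)
  show "\<Union>(part_comp p1 p2) = two_rows A" by (rule Union_part_comp[OF assms])
  have d: "disjoint (stack p1 p2)" unfolding stack_def by (rule partition_onD2[OF partition_on_merge])
  show "disjnt C D" if CD: "C \<in> part_comp p1 p2" "D \<in> part_comp p1 p2" "C \<noteq> D" for C D
  proof -
    obtain C' D' where *: "C' \<in> stack p1 p2" "D' \<in> stack p1 p2" "C = C' - {Mid} \<times> UNIV" "D = D' - {Mid} \<times> UNIV"
      using CD by (auto simp: part_comp_block)
    then have "C' \<inter> D' = {}" using CD(3) d by (auto dest: disjointD)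
    then show ?thesis using * by (auto simp: disjnt_def)
  qed
qed (auto simp: part_comp_block)

definition restr :: "diagram \<Rightarrow> nat set \<Rightarrow> diagram" where
  "restr p A = {C \<in> p. C \<subseteq> two_rows A}"

text \<open>The sets of columns that are unions of blocks of the partition and of the identity.\<close>

definition closed_cols :: "nat set \<Rightarrow> diagram \<Rightarrow> nat set set" where
  "closed_cols A p = {U. U \<subseteq> A \<and> (\<forall>C\<in>p. C \<subseteq> two_rows U \<or> C \<subseteq> two_rows (A - U))}"

lemma restr_in_PartsOn:
  assumes p: "p \<in> PartsOn A" and U: "U \<in> closed_cols A p"
  shows "restr p U \<in> PartsOn U"
  unfolding PartsOn_def mem_Collect_eq
proof (rule partition_onI)
  show "disjnt C D" if "C \<in> restr p U" "D \<in> restr p U" "C \<noteq> D" for C D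
    using that p partition_onD2[of "two_rows A" p] by (auto simp: restr_def PartsOn_def disjoint_def disjnt_def)
  show "{} \<notin> restr p U" using empty_notin_PartsOn[OF p] by (simp add: restr_def)
  have "x \<in> \<Union>(restr p U)" if x: "x \<in> two_rows U" for x
  proof -
    have "x \<in> two_rows A" using x U by (auto simp: closed_cols_def two_rows_def)
    then obtain C where C: "C \<in> p" "x \<in> C" using Union_PartsOn[OF p] by blast
    moreover have "\<not> C \<subseteq> two_rows (A - U)" using C x by (auto simp: two_rows_def)
    ultimately show ?thesis using U by (auto simp: closed_cols_def restr_def)
  qed
  then show "\<Union>(restr p U) = two_rows U" by (auto simp: restr_def)
qed

lemma closed_cols_compl: "U \<in> closed_cols A p \<Longrightarrow> A - U \<in> closed_cols A p"
  by (auto simp: closed_cols_def double_diff)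

lemma restr_Un_compl: "U \<in> closed_cols A p \<Longrightarrow> restr p U \<union> restr p (A - U) = p"
  by (auto simp: closed_cols_def restr_def)

lemma restr_Un_disjoint:
  assumes "p \<in> PartsOn A" "q \<in> PartsOn B" "A \<inter> B = {}" "U \<subseteq> A" "V \<subseteq> B"
  shows "restr (p \<union> q) (U \<union> V) = restr p U \<union> restr q V"
proof -
  have sub: "two_rows U \<subseteq> two_rows A" "two_rows V \<subseteq> two_rows B" "two_rows A \<inter> two_rows B = {}"
    using assms(4,5) two_rows_disjoint[OF assms(3)] by (auto simp: two_rows_def)
  have "C \<subseteq> two_rows (U \<union> V) \<longleftrightarrow> C \<subseteq> two_rows U" if "C \<in> p" for C
    using PartsOn_block_subset[OF assms(1) that] sub unfolding two_rows_Un by blast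
  moreover have "C \<subseteq> two_rows (U \<union> V) \<longleftrightarrow> C \<subseteq> two_rows V" if "C \<in> q" for C
    using PartsOn_block_subset[OF assms(2) that] sub unfolding two_rows_Un by blast
  ultimately show ?thesis unfolding restr_def by blast
qed

lemma restr_self: "p \<in> PartsOn A \<Longrightarrow> restr p A = p"
  using PartsOn_block_subset by (auto simp: restr_def)

lemma restr_Un:
  assumes "p \<in> PartsOn A" "q \<in> PartsOn B" "A \<inter> B = {}"
  shows "restr (p \<union> q) A = p" "restr (p \<union> q) B = q"
proof -
  have "C \<notin> p" if "C \<subseteq> two_rows B" for C
  proof
    assume C: "C \<in> p"
    then have "C \<subseteq> two_rows A \<inter> two_rows B" using PartsOn_block_subset[OF assms(1)] that by blast
    then have "C = {}" using two_rows_disjoint[OF assms(3)] by auto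
    then show False using empty_notin_PartsOn[OF assms(1)] C by blast
  qed
  moreover have "C \<notin> q" if "C \<subseteq> two_rows A" for C
  proof
    assume C: "C \<in> q"
    then have "C \<subseteq> two_rows A \<inter> two_rows B" using PartsOn_block_subset[OF assms(2)] that by blast
    then have "C = {}" using two_rows_disjoint[OF assms(3)] by auto
    then show False using empty_notin_PartsOn[OF assms(2)] C by blast
  qed
  ultimately show "restr (p \<union> q) A = p" "restr (p \<union> q) B = q"
    using PartsOn_block_subset[OF assms(1)] PartsOn_block_subset[OF assms(2)]
    unfolding restr_def by blast+
qed

text \<open>Both sides of the geodesic inequality are additive over disjoint columns, and a sum of
  two inequalities is an equality only if each of them is.\<close>

lemma geodesic_Un:
  assumes p: "p1 \<in> PartsOn A" "p2 \<in> PartsOn A" and q: "q1 \<in> PartsOn B" "q2 \<in> PartsOn B"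
    and AB: "A \<inter> B = {}" and fin: "finite A" "finite B"
  shows "geodesic (A \<union> B) (p1 \<union> q1) (p2 \<union> q2) \<longleftrightarrow> geodesic A p1 p2 \<and> geodesic B q1 q2"
proof -
  have "card (stack (p1 \<union> q1) (p2 \<union> q2)) = card (stack p1 p2) + card (stack q1 q2)"
    unfolding stack_Un(1)[OF p q AB]
    by (rule card_Un_disjoint[OF finite_stack[OF p fin(1)] finite_stack[OF q fin(2)] stack_Un(2)[OF p q AB]])
  moreover have "card (r \<union> s) = card r + card s" if "r \<in> PartsOn A" "s \<in> PartsOn B" for r s
    using that AB fin by (intro card_Un_disjoint PartsOn_disjoint finite_PartsOn_mem)
  note this[OF p(1) q(1)] this[OF p(2) q(2)]
  moreover note joined_Un[OF p(1) q(1) AB fin] joined_Un[OF p(2) q(2) AB fin]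
    joined_Un[OF part_comp_in_PartsOn[OF p] part_comp_in_PartsOn[OF q] AB fin]
    geodesic_le(1)[OF p fin(1)] geodesic_le(1)[OF q fin(2)]
  ultimately show ?thesis
    unfolding geodesic_def part_comp_Un[OF p q AB] by linarith
qed

text \<open>By \<open>geodesic_le\<close>, two vertices in one block of \<open>r1\<close> or
  \<open>r2\<close> are linked in \<open>p \<union> q \<union> id_on (A \<union> B)\<close>, and
  every block of that diagram lies over \<open>A\<close> or over \<open>B\<close>.\<close>

lemma geodesic_split:
  assumes r: "r1 \<in> PartsOn (A \<union> B)" "r2 \<in> PartsOn (A \<union> B)"
    and g: "geodesic (A \<union> B) r1 r2" and c: "part_comp r1 r2 = p \<union> q"
    and p: "p \<in> PartsOn A" and q: "q \<in> PartsOn B" and AB: "A \<inter> B = {}" and fin: "finite A" "finite B"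
  shows "A \<in> closed_cols (A \<union> B) r1" "A \<in> closed_cols (A \<union> B) r2"
proof -
  have "C \<subseteq> two_rows A \<or> C \<subseteq> two_rows B" if C: "C \<in> r1 \<union> r2" for C
  proof -
    have "(x \<in> two_rows A) = (y \<in> two_rows A)" if xy: "x \<in> C" "y \<in> C" for x y
    proof -
      have "linked (r1 \<union> r2 \<union> id_on (A \<union> B)) x y" by (rule linked_block[of C]) (use C xy in auto)
      then have "linked (p \<union> q \<union> id_on (A \<union> B)) x y"
        using geodesic_le(2)[OF r _ g] fin unfolding c by blast
      then show ?thesis
      proof (rule linked_invariant)
        fix D x y assume D: "D \<in> p \<union> q \<union> id_on (A \<union> B)" "x \<in> D" "y \<in> D"
        then have "D \<subseteq> two_rows A \<or> D \<subseteq> two_rows B"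
          using PartsOn_block_subset[OF p] PartsOn_block_subset[OF q]
          by (auto simp: id_on_def two_rows_def)
        then show "(x \<in> two_rows A) = (y \<in> two_rows A)"
          using D two_rows_disjoint[OF AB] by blast
      qed
    qed
    moreover have "C \<subseteq> two_rows A \<union> two_rows B"
      using C PartsOn_block_subset[OF r(1)] PartsOn_block_subset[OF r(2)] by (auto simp: two_rows_Un)
    ultimately show ?thesis by blast
  qed
  moreover have "A \<union> B - A = B" using AB by blast
  ultimately show "A \<in> closed_cols (A \<union> B) r1" "A \<in> closed_cols (A \<union> B) r2"
    unfolding closed_cols_def by auto
qed

definition union_pair :: "(diagram \<times> diagram) \<times> (diagram \<times> diagram) \<Rightarrow> diagram \<times> diagram" where
  "union_pair = (\<lambda>((p1, p2), (q1, q2)). (p1 \<union> q1, p2 \<union> q2))"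

text \<open>The inverse restricts both factors to the columns \<open>A\<close> and \<open>B\<close>;
  \<open>geodesic_split\<close> guarantees that these restrictions are partitions which together
  exhaust the factors.\<close>

lemma bij_betw_geodesic_pairs_Un:
  assumes p: "p \<in> PartsOn A" and q: "q \<in> PartsOn B" and AB: "A \<inter> B = {}" and fin: "finite A" "finite B"
  shows "bij_betw union_pair (geodesic_pairs A p \<times> geodesic_pairs B q) (geodesic_pairs (A \<union> B) (p \<union> q))"
proof (rule bij_betw_byWitness[where f' = "\<lambda>(r1, r2). ((restr r1 A, restr r2 A), (restr r1 B, restr r2 B))"])
  show "\<forall>x\<in>geodesic_pairs A p \<times> geodesic_pairs B q.
      (\<lambda>(r1, r2). ((restr r1 A, restr r2 A), (restr r1 B, restr r2 B))) (union_pair x) = x"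
    by (auto simp: geodesic_pairs_def union_pair_def restr_Un[OF _ _ AB])
  have split: "restr r1 A \<in> PartsOn A \<and> restr r1 B \<in> PartsOn B \<and> restr r1 A \<union> restr r1 B = r1
      \<and> restr r2 A \<in> PartsOn A \<and> restr r2 B \<in> PartsOn B \<and> restr r2 A \<union> restr r2 B = r2"
    if "(r1, r2) \<in> geodesic_pairs (A \<union> B) (p \<union> q)" for r1 r2
  proof -
    have r: "r1 \<in> PartsOn (A \<union> B)" "r2 \<in> PartsOn (A \<union> B)"
      and g: "geodesic (A \<union> B) r1 r2" "part_comp r1 r2 = p \<union> q"
      using that by (auto simp: geodesic_pairs_def)
    note cl = geodesic_split[OF r g p q AB fin]
    have "A \<union> B - A = B" using AB by blast
    then show ?thesis
      using restr_in_PartsOn[OF r(1) cl(1)] restr_in_PartsOn[OF r(1) closed_cols_compl[OF cl(1)]]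
        restr_in_PartsOn[OF r(2) cl(2)] restr_in_PartsOn[OF r(2) closed_cols_compl[OF cl(2)]]
        restr_Un_compl[OF cl(1)] restr_Un_compl[OF cl(2)] by simp
  qed
  then show "\<forall>x\<in>geodesic_pairs (A \<union> B) (p \<union> q).
      union_pair ((\<lambda>(r1, r2). ((restr r1 A, restr r2 A), (restr r1 B, restr r2 B))) x) = x"
    by (auto simp: union_pair_def)
  show "union_pair ` (geodesic_pairs A p \<times> geodesic_pairs B q) \<subseteq> geodesic_pairs (A \<union> B) (p \<union> q)"
    by (auto simp: union_pair_def geodesic_pairs_def PartsOn_Un[OF _ _ AB] part_comp_Un[OF _ _ _ _ AB]
        geodesic_Un[OF _ _ _ _ AB fin])
  show "(\<lambda>(r1, r2). ((restr r1 A, restr r2 A), (restr r1 B, restr r2 B))) `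
      geodesic_pairs (A \<union> B) (p \<union> q) \<subseteq> geodesic_pairs A p \<times> geodesic_pairs B q"
  proof clarify
    fix r1 r2 assume r: "(r1, r2) \<in> geodesic_pairs (A \<union> B) (p \<union> q)"
    then have A: "restr r1 A \<in> PartsOn A" "restr r2 A \<in> PartsOn A"
      and B: "restr r1 B \<in> PartsOn B" "restr r2 B \<in> PartsOn B"
      and eq: "r1 = restr r1 A \<union> restr r1 B" "r2 = restr r2 A \<union> restr r2 B"
      using split by blast+
    have "geodesic (A \<union> B) r1 r2" "part_comp r1 r2 = p \<union> q" using r by (auto simp: geodesic_pairs_def)
    then have g: "geodesic A (restr r1 A) (restr r2 A)" "geodesic B (restr r1 B) (restr r2 B)"
      and c: "part_comp (restr r1 A) (restr r2 A) \<union> part_comp (restr r1 B) (restr r2 B) = p \<union> q"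
      using geodesic_Un[OF A B AB fin] part_comp_Un[OF A B AB] eq by simp_all
    have "part_comp (restr r1 A) (restr r2 A) = p" "part_comp (restr r1 B) (restr r2 B) = q"
      using restr_Un[OF part_comp_in_PartsOn[OF A] part_comp_in_PartsOn[OF B] AB] restr_Un[OF p q AB]
      unfolding c by simp_all
    then show "(restr r1 A, restr r2 A) \<in> geodesic_pairs A p \<and> (restr r1 B, restr r2 B) \<in> geodesic_pairs B q"
      using A B g by (simp add: geodesic_pairs_def)
  qed
qed


section \<open>Orbits and the multiplicative coproduct\<close>

lemma relabel_in_PartsOn:
  assumes p: "p \<in> PartsOn A" and f: "inj_on f A"
  shows "relabel f p \<in> PartsOn (f ` A)"
proof -
  have "inj_on (map_prod id f) (two_rows A)" using f by (auto simp: inj_on_def two_rows_def)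
  moreover have "map_prod id f ` two_rows A = two_rows (f ` A)"
    unfolding two_rows_def by (rule map_prod_surj_on) simp_all
  moreover have "(`) (map_prod id f) ` p - {{}} = relabel f p"
    using empty_notin_PartsOn[OF p] by (auto simp: relabel_def vmap_def)
  ultimately show ?thesis
    using p partition_on_inj_image[of "two_rows A" p "map_prod id f"] by (simp add: PartsOn_def)
qed

lemma relabel_cong:
  assumes "p \<in> PartsOn A" "\<And>i. i \<in> A \<Longrightarrow> f i = g i"
  shows "relabel f p = relabel g p"
  unfolding relabel_def
  by (rule vmap_cong) (use assms in \<open>auto simp: Union_PartsOn two_rows_def\<close>)

context
  fixes f :: "nat \<Rightarrow> nat" assumes f: "inj f"
begin

text \<open>Equivariance is needed here for injections: the relabelling inside a tensor product is
  the shift by \<open>k\<close>, which is not a permutation.\<close>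

lemma inj_relabel': "inj (relabel f)"
  and card_relabel: "card (relabel f S) = card S"
proof -
  have img: "inj ((`) g)" if "inj g" for g :: "'a \<Rightarrow> 'b"
    by (rule injI) (simp only: inj_image_eq_iff[OF that])
  have 1: "inj ((`) (map_prod id f :: vertex \<Rightarrow> vertex))" by (rule img[OF inj_map_prod_id[OF f]])
  show "inj (relabel f)"
    unfolding relabel_def vmap_def using img[OF 1] .
  show "card (relabel f S) = card S"
    unfolding relabel_def vmap_def by (rule card_image, rule inj_on_subset[OF 1]) simp
qed

lemma merge_relabel': "merge (relabel f S) = relabel f (merge S)"
  unfolding relabel_def by (rule merge_vmap[OF inj_map_prod_id[OF f]])

lemma stack_relabel': "stack (relabel f p) (relabel f q) = relabel f (stack p q)"
  by (simp add: stack_def move_row_relabel merge_relabel' flip: relabel_Un)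

lemma part_comp_relabel': "part_comp (relabel f p) (relabel f q) = relabel f (part_comp p q)"
proof -
  have "map_prod id f ` C - {Mid} \<times> UNIV = map_prod id f ` (C - {Mid} \<times> UNIV)" for C :: "vertex set"
    by auto
  then show ?thesis
    unfolding part_comp_def stack_relabel' by (auto simp: relabel_def vmap_def image_image)
qed

lemma joined_relabel: "joined (f ` A) (relabel f p) = joined A p"
proof -
  have "id_on (f ` A) = relabel f (id_on A)"
    by (simp add: relabel_def vmap_def id_on_def image_image)
  then show ?thesis
    by (simp add: joined_def merge_relabel' card_relabel flip: relabel_Un)
qed

lemma geodesic_relabel: "geodesic (f ` A) (relabel f p1) (relabel f p2) \<longleftrightarrow> geodesic A p1 p2"
  by (simp add: geodesic_def stack_relabel' part_comp_relabel' joined_relabel card_relabel)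

lemma geodesic_pairs_relabel:
  "geodesic_pairs (f ` A) (relabel f p) = map_prod (relabel f) (relabel f) ` geodesic_pairs A p"
proof
  have inj: "inj_on f A" using f by (rule inj_on_subset) simp
  show "map_prod (relabel f) (relabel f) ` geodesic_pairs A p \<subseteq> geodesic_pairs (f ` A) (relabel f p)"
    using relabel_in_PartsOn[OF _ inj]
    by (auto simp: geodesic_pairs_def part_comp_relabel' geodesic_relabel)
  show "geodesic_pairs (f ` A) (relabel f p) \<subseteq> map_prod (relabel f) (relabel f) ` geodesic_pairs A p"
  proof clarify
    fix r1 r2 assume r: "(r1, r2) \<in> geodesic_pairs (f ` A) (relabel f p)"
    have pre: "\<exists>s\<in>PartsOn A. r = relabel f s" if r: "r \<in> PartsOn (f ` A)" for r
    proof
      have "relabel (inv f) r \<in> PartsOn (inv f ` f ` A)"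
        using r by (rule relabel_in_PartsOn) (rule inj_on_inv_into, auto)
      then show "relabel (inv f) r \<in> PartsOn A" by (simp add: image_image inv_f_f f)
      have "relabel f (relabel (inv f) r) = relabel id r"
        unfolding relabel_relabel by (rule relabel_cong[OF r]) (auto simp: f inv_f_f)
      then show "r = relabel f (relabel (inv f) r)" by simp
    qed
    have "r1 \<in> PartsOn (f ` A)" "r2 \<in> PartsOn (f ` A)" using r by (auto simp: geodesic_pairs_def)
    then obtain s1 s2 where s: "s1 \<in> PartsOn A" "s2 \<in> PartsOn A" "r1 = relabel f s1" "r2 = relabel f s2"
      using pre by blast
    then have "relabel f (part_comp s1 s2) = relabel f p" "geodesic A s1 s2"
      using r by (auto simp: geodesic_pairs_def part_comp_relabel' geodesic_relabel)
    then have "(s1, s2) \<in> geodesic_pairs A p"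
      using inj_relabel' s by (auto simp: geodesic_pairs_def dest: injD)
    then show "(r1, r2) \<in> map_prod (relabel f) (relabel f) ` geodesic_pairs A p"
      using s by force
  qed
qed

end

lemma same_orbit_refl: "p \<in> Parts k \<Longrightarrow> same_orbit p p"
  unfolding same_orbit_def using permutes_id relabel_id by metis

lemma orbit_exhaust:
  obtains k p where "p \<in> Parts k" "x = abs_orbit p"
proof (induction x rule: orbit.abs_induct)
  case (1 y)
  then show ?case by (auto elim: same_orbitE)
qed

lemma abs_orbit_eq_pdeg:
  assumes "p \<in> Parts k" "q \<in> Parts l" "abs_orbit p = abs_orbit q"
  shows "k = l"
proof -
  have "same_orbit p q"
    using Quotient3_rel[OF Quotient3_orbit, of p q] assms same_orbit_refl by blast
  then show ?thesis using assms pdeg_eq by (metis same_orbitE)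
qed

lemma Parts_0: "Parts 0 = {{}}"
  by (auto simp: Parts_def verts_def partition_on_def)

lemma abs_orbit_eq_empty_iff: "p \<in> Parts k \<Longrightarrow> abs_orbit p = abs_orbit {} \<longleftrightarrow> k = 0"
  using abs_orbit_eq_pdeg[OF _ empty_in_Parts] Parts_0 by auto

lemma orbit_tensor_abs_orbit:
  assumes "p \<in> Parts k" "q \<in> Parts l"
  shows "orbit_tensor (abs_orbit p) (abs_orbit q) = abs_orbit (part_tensor p q)"
  using assms by (intro orbit_tensor.abs_eq same_orbit_refl)

lemma part_tensor_eq: "p \<in> Parts k \<Longrightarrow> part_tensor p q = p \<union> relabel ((+) k) q"
  by (simp add: part_tensor_def pdeg_eq)

lemma part_tensor_empty_left [simp]: "part_tensor {} q = q"
proof -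
  have "relabel ((+) 0) q = relabel id q" by (rule arg_cong2[where f = relabel]) auto
  then show ?thesis by (simp add: part_tensor_eq[OF empty_in_Parts])
qed

lemma part_tensor_empty_right [simp]: "part_tensor p {} = p"
  by (simp add: part_tensor_def relabel_def vmap_def)

lemma orbit_tensor_empty [simp]:
  "orbit_tensor (abs_orbit {}) x = x" "orbit_tensor x (abs_orbit {}) = x"
proof -
  obtain k p where "p \<in> Parts k" "x = abs_orbit p" by (rule orbit_exhaust)
  then show "orbit_tensor (abs_orbit {}) x = x" "orbit_tensor x (abs_orbit {}) = x"
    using orbit_tensor_abs_orbit empty_in_Parts by simp_all
qed

lemma extend_form_coproduct_boxtimes:
  assumes "p \<in> Parts k"
  shows "extend_form h (coproduct_boxtimes_orbit (abs_orbit p)) =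
    (\<Sum>(p1, p2)\<in>geodesic_pairs {1..k} p. h (abs_orbit p1, abs_orbit p2))"
proof -
  have "coproduct_boxtimes_orbit (abs_orbit p) =
      (\<Sum>(p1, p2)\<in>boxtimes_pairs p. basis (abs_orbit p1, abs_orbit p2))"
    by (rule coproduct_boxtimes_orbit.abs_eq[OF same_orbit_refl[OF assms]])
  then show ?thesis
    by (simp only: boxtimes_pairs_eq[OF assms] extend_form_sum split_def extend_form_basis)
qed

text \<open>Each geodesic factorisation of the tensor product splits into one over the columns of
  \<open>p\<close> and one over the shifted columns of \<open>q\<close>. The shift is pulled out of
  the second factorisation and absorbed again by \<open>part_tensor\<close>.\<close>

lemma coproduct_boxtimes_tensor:
  "extend_form h (coproduct_boxtimes_orbit (orbit_tensor x y)) =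
    extend_form (\<lambda>(a, a'). extend_form (\<lambda>(b, b'). h (orbit_tensor a b, orbit_tensor a' b'))
      (coproduct_boxtimes_orbit y)) (coproduct_boxtimes_orbit x)"
proof -
  obtain k p where p: "p \<in> Parts k" "x = abs_orbit p" by (rule orbit_exhaust)
  obtain l q where q: "q \<in> Parts l" "y = abs_orbit q" by (rule orbit_exhaust)
  let ?A = "{1..k}" and ?L = "{1..l}" and ?s = "(+) k"
  let ?B = "?s ` ?L" and ?q = "relabel ?s q"
  have s: "inj ?s" by simp
  have q': "?q \<in> PartsOn ?B" using q by (intro relabel_in_PartsOn) (auto simp: Parts_eq)
  have AB: "?A \<inter> ?B = {}" by auto
  have kl: "{1..k + l} = ?A \<union> ?B" unfolding image_add_atLeastAtMost by auto
  have "extend_form h (coproduct_boxtimes_orbit (orbit_tensor x y)) =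
      (\<Sum>(r1, r2)\<in>geodesic_pairs (?A \<union> ?B) (p \<union> ?q). h (abs_orbit r1, abs_orbit r2))"
    using extend_form_coproduct_boxtimes[OF part_tensor_in_Parts[OF p(1) q(1)], of h]
    unfolding kl p(2) q(2) orbit_tensor_abs_orbit[OF p(1) q(1)] part_tensor_eq[OF p(1)] .
  also have "\<dots> = (\<Sum>z\<in>geodesic_pairs ?A p \<times> geodesic_pairs ?B ?q.
      case union_pair z of (r1, r2) \<Rightarrow> h (abs_orbit r1, abs_orbit r2))"
    by (rule sum.reindex_bij_betw[symmetric, OF bij_betw_geodesic_pairs_Un])
      (use p q' AB in \<open>auto simp: Parts_eq\<close>)
  also have "\<dots> = (\<Sum>u\<in>geodesic_pairs ?A p. \<Sum>v\<in>geodesic_pairs ?B ?q.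
      case union_pair (u, v) of (r1, r2) \<Rightarrow> h (abs_orbit r1, abs_orbit r2))"
    by (simp add: sum.cartesian_product split_def)
  also have "\<dots> = (\<Sum>u\<in>geodesic_pairs ?A p. \<Sum>w\<in>geodesic_pairs ?L q.
      case union_pair (u, map_prod (relabel ?s) (relabel ?s) w) of
        (r1, r2) \<Rightarrow> h (abs_orbit r1, abs_orbit r2))"
  proof (rule sum.cong[OF refl])
    fix u
    have "inj_on (map_prod (relabel ?s) (relabel ?s)) (geodesic_pairs ?L q)"
      by (rule inj_on_subset[OF prod.inj_map[OF inj_relabel'[OF s] inj_relabel'[OF s]]]) simp
    then show "(\<Sum>v\<in>geodesic_pairs ?B ?q. case union_pair (u, v) of (r1, r2) \<Rightarrow> h (abs_orbit r1, abs_orbit r2)) =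
      (\<Sum>w\<in>geodesic_pairs ?L q. case union_pair (u, map_prod (relabel ?s) (relabel ?s) w) of
        (r1, r2) \<Rightarrow> h (abs_orbit r1, abs_orbit r2))"
      unfolding geodesic_pairs_relabel[OF s] by (subst sum.reindex) simp_all
  qed
  also have "\<dots> = (\<Sum>(p1, p2)\<in>geodesic_pairs ?A p. \<Sum>(q1, q2)\<in>geodesic_pairs ?L q.
      h (orbit_tensor (abs_orbit p1) (abs_orbit q1), orbit_tensor (abs_orbit p2) (abs_orbit q2)))"
  proof (intro sum.cong refl, clarify, intro sum.cong refl, clarify)
    fix p1 p2 q1 q2 assume "(p1, p2) \<in> geodesic_pairs ?A p" "(q1, q2) \<in> geodesic_pairs ?L q"
    then have "p1 \<in> Parts k" "p2 \<in> Parts k" "q1 \<in> Parts l" "q2 \<in> Parts l"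
      by (auto simp: geodesic_pairs_def Parts_eq)
    then show "(case union_pair ((p1, p2), map_prod (relabel ?s) (relabel ?s) (q1, q2)) of
        (r1, r2) \<Rightarrow> h (abs_orbit r1, abs_orbit r2)) =
      h (orbit_tensor (abs_orbit p1) (abs_orbit q1), orbit_tensor (abs_orbit p2) (abs_orbit q2))"
      by (simp add: union_pair_def orbit_tensor_abs_orbit part_tensor_eq)
  qed
  finally show ?thesis
    unfolding p(2) q(2)
    by (simp only: extend_form_coproduct_boxtimes[OF p(1)] extend_form_coproduct_boxtimes[OF q(1)] prod.case)
qed

section \<open>The identity partition as unit of composition, and the counit of
  \<open>Boxtimes\<close>\<close>

lemma linked_part_comp:
  assumes p: "p1 \<in> PartsOn A" "p2 \<in> PartsOn A" and x: "x \<in> two_rows A" and y: "y \<in> two_rows A"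
  shows "linked (part_comp p1 p2) x y \<longleftrightarrow> linked (move_row Top Mid p1 \<union> move_row Bot Mid p2) x y"
proof -
  have m: "merge (part_comp p1 p2) = part_comp p1 p2"
    using part_comp_in_PartsOn[OF p] merge_partition by (simp add: PartsOn_def)
  obtain C where C: "C \<in> part_comp p1 p2" "x \<in> C" using Union_part_comp[OF p] x by blast
  then obtain D where D: "D \<in> stack p1 p2" "C = D - {Mid} \<times> UNIV" by (auto simp: part_comp_block)
  have "linked (part_comp p1 p2) x y \<longleftrightarrow> y \<in> C"
    using merge_mem_iff[of C "part_comp p1 p2" x y] C m by simp
  also have "\<dots> \<longleftrightarrow> y \<in> D" using y by (auto simp: D two_rows_def)
  also have "\<dots> \<longleftrightarrow> linked (move_row Top Mid p1 \<union> move_row Bot Mid p2) x y"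
    by (rule merge_mem_iff) (use C D in \<open>auto simp: stack_def\<close>)
  finally show ?thesis .
qed

text \<open>Here \<open>g\<close> collapses the middle row onto the outer row that carries the identity.\<close>

lemma part_comp_collapse:
  assumes p: "p1 \<in> PartsOn A" "p2 \<in> PartsOn A" and r: "r \<in> PartsOn A" and A: "finite A"
    and g: "g = row_move Mid s" and s: "s \<noteq> Mid"
    and edge: "\<And>i. i \<in> A \<Longrightarrow> {(s, i), (Mid, i)} \<in> move_row Top Mid p1 \<union> move_row Bot Mid p2"
    and collapse: "vmap g (move_row Top Mid p1 \<union> move_row Bot Mid p2) = r \<union> (\<lambda>i. {(s, i)}) ` A"
  shows "part_comp p1 p2 = r" and "card (stack p1 p2) = card r"
proof -
  let ?X = "move_row Top Mid p1 \<union> move_row Bot Mid p2"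
  have U: "\<Union>?X = {Top, Mid, Bot} \<times> A" by (rule Union_stack_parts[OF p])
  have gl: "linked ?X (g z) z" if "z \<in> \<Union>?X" for z
  proof (cases "fst z = Mid")
    case True
    moreover have "z \<in> {Top, Mid, Bot} \<times> A" using that by (simp only: U)
    ultimately obtain i where "z = (Mid, i)" "i \<in> A" by auto
    then show ?thesis using linked_block[OF edge] by (simp add: g)
  next
    case False
    then have "g z = z" by (cases z) (simp add: g)
    then show ?thesis using linked_refl[OF that] by simp
  qed
  have col: "linked ?X x y" if "x \<in> \<Union>?X" "y \<in> \<Union>?X" "g x = g y" for x y
    using linked_trans[OF linked_sym[OF gl[OF that(1)]]] gl[OF that(2)] unfolding that(3) .
  have lr: "linked (r \<union> (\<lambda>i. {(s, i)}) ` A) x y \<longleftrightarrow> linked r x y" for x y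
  proof
    assume "linked (r \<union> (\<lambda>i. {(s, i)}) ` A) x y"
    then show "linked r x y"
    proof (rule linked_subsume)
      fix B x y assume B: "B \<in> r \<union> (\<lambda>i. {(s, i)}) ` A" "x \<in> B" "y \<in> B"
      then consider "B \<in> r" | "x = y" "x \<in> two_rows A"
        using s row.exhaust[of s] by (auto simp: two_rows_def)
      then show "linked r x y"
      proof cases
        case 1 then show ?thesis using B by (intro linked_block[of B])
      next
        case 2 then show ?thesis using linked_refl[of x r] Union_PartsOn[OF r] by simp
      qed
    qed
  qed (rule linked_mono, auto)
  have eq: "linked (part_comp p1 p2) x y \<longleftrightarrow> linked r x y" if x: "x \<in> two_rows A" and y: "y \<in> two_rows A" for x y
  proof -
    have "linked (part_comp p1 p2) x y \<longleftrightarrow> linked ?X x y" by (rule linked_part_comp[OF p x y])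
    also have "\<dots> \<longleftrightarrow> linked (vmap g ?X) (g x) (g y)"
      by (rule linked_vmap[symmetric, OF col]) (use x y in \<open>auto simp only: U, auto simp: two_rows_def\<close>)
    finally have "linked (part_comp p1 p2) x y \<longleftrightarrow> linked r (g x) (g y)" unfolding collapse lr .
    moreover have "g x = x" "g y = y" using x y by (auto simp: g two_rows_def)
    ultimately show ?thesis by simp
  qed
  show c: "part_comp p1 p2 = r"
  proof -
    have "merge (part_comp p1 p2) = merge r"
      unfolding merge_eq_image Union_part_comp[OF p] Union_PartsOn[OF r]
    proof (rule image_cong[OF refl])
      fix x assume x: "x \<in> two_rows A"
      have "linked (part_comp p1 p2) x y \<longleftrightarrow> linked r x y" for y
      proof (cases "y \<in> two_rows A")
        case True then show ?thesis by (rule eq[OF x])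
      next
        case False
        then show ?thesis
          using linked_in[of "part_comp p1 p2" x y] linked_in[of r x y]
          unfolding Union_part_comp[OF p] Union_PartsOn[OF r] by blast
      qed
      then show "{y. linked (part_comp p1 p2) x y} = {y. linked r x y}" by simp
    qed
    then show ?thesis
      using part_comp_in_PartsOn[OF p] r merge_partition by (simp add: PartsOn_def)
  qed
  \<comment> \<open>Each middle vertex is linked to the vertex of its column in row
    \<open>s\<close>, so no component stays within the middle row.\<close>
  have "kappa p1 p2 = 0"
  proof -
    have "\<not> D \<subseteq> {Mid} \<times> UNIV" if D: "D \<in> stack p1 p2" for D
    proof
      assume sub: "D \<subseteq> {Mid} \<times> UNIV"
      have "D \<noteq> {}" using D partition_onD3[OF partition_on_merge] unfolding stack_def by metis
      then obtain z where z: "z \<in> D" by blast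
      then have zX: "z \<in> \<Union>?X" using Union_merge[of ?X] D unfolding stack_def by blast
      have "g z \<in> D"
        using merge_mem_iff[of D ?X z "g z"] linked_sym[OF gl[OF zX]] D z unfolding stack_def by blast
      moreover have "fst (g z) \<noteq> Mid" using s z sub by (cases z) (auto simp: g)
      ultimately show False using sub by auto
    qed
    then have "{C \<in> stack p1 p2. C \<subseteq> {Mid} \<times> UNIV} = {}" by blast
    then show ?thesis unfolding kappa_def by (metis card.empty)
  qed
  then show "card (stack p1 p2) = card r"
    using card_part_comp_kappa[OF p A] c by simp
qed

lemma merge_id_on: "merge (id_on A) = id_on A"
  using id_on_in_PartsOn[of A] merge_partition by (simp add: PartsOn_def)

lemma joined_id_on: "joined A (id_on A) = card A"
  by (simp add: joined_def merge_id_on card_id_on)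

text \<open>The geodesic equation holds because \<open>id_on A\<close> has \<open>card A\<close>
  blocks both by itself and after joining with the identity, so these contributions cancel.\<close>

lemma
  assumes r: "r \<in> PartsOn A" and A: "finite A"
  shows id_on_left: "part_comp (id_on A) r = r" "geodesic A (id_on A) r"
    and id_on_right: "part_comp r (id_on A) = r" "geodesic A r (id_on A)"
proof -
  have q1: "vmap (row_move Mid Top) (move_row Top Mid r) = r"
  proof -
    have "vmap (row_move Mid Top) (move_row Top Mid r) = vmap id r"
      unfolding move_row_eq vmap_vmap
      by (rule vmap_cong) (use Union_PartsOn[OF r] in \<open>auto simp: two_rows_def\<close>)
    then show ?thesis by simp
  qed
  have q2: "vmap (row_move Mid Bot) (move_row Bot Mid r) = r"
  proof -
    have "vmap (row_move Mid Bot) (move_row Bot Mid r) = vmap id r"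
      unfolding move_row_eq vmap_vmap
      by (rule vmap_cong) (use Union_PartsOn[OF r] in \<open>auto simp: two_rows_def\<close>)
    then show ?thesis by simp
  qed
  \<comment> \<open>\<open>id_on A\<close> is the lower diagram here, so its edges run from
    \<open>Mid\<close> to \<open>Bot\<close>.\<close>
  have l: "part_comp (id_on A) r = r" "card (stack (id_on A) r) = card r"
    by (rule part_comp_collapse[OF id_on_in_PartsOn r r A refl, of Bot];
      auto simp: vmap_Un q2; auto simp: move_row_eq vmap_def id_on_def image_image insert_commute)+
  have r': "part_comp r (id_on A) = r" "card (stack r (id_on A)) = card r"
    by (rule part_comp_collapse[OF r id_on_in_PartsOn r A refl, of Top];
      auto simp: vmap_Un q1; auto simp: move_row_eq vmap_def id_on_def image_image insert_commute)+
  show "part_comp (id_on A) r = r" "part_comp r (id_on A) = r" by fact+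
  show "geodesic A (id_on A) r" "geodesic A r (id_on A)"
    unfolding geodesic_def l r' joined_id_on card_id_on by simp_all
qed

text \<open>All permutations fix the identity partition, so its orbit has one member and the counit
  can be evaluated on representatives.\<close>

lemma abs_orbit_eq_id_iff:
  assumes "p \<in> Parts k"
  shows "(\<exists>j. abs_orbit p = abs_orbit (id_part j)) \<longleftrightarrow> p = id_on {1..k}"
proof
  assume "\<exists>j. abs_orbit p = abs_orbit (id_part j)"
  then obtain j where j: "abs_orbit (id_part j) = abs_orbit p" by auto
  have idj: "id_part j \<in> Parts j" by (simp add: Parts_eq id_part_eq id_on_in_PartsOn)
  have "j = k" by (rule abs_orbit_eq_pdeg[OF idj assms j])
  then obtain \<sigma> where "\<sigma> permutes {1..k}" "p = relabel \<sigma> (id_part k)"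
    using abs_orbit_eq_iff idj assms j by blast
  then show "p = id_on {1..k}" using id_part_relabel by (simp add: id_part_eq)
qed (auto simp: id_part_eq)

text \<open>A counit leaves only pairs with the identity as the corresponding factor, and then the
  other factor must be \<open>p\<close>.\<close>

lemma coproduct_boxtimes_counit:
  fixes g :: "orbit \<Rightarrow> complex"
  defines "\<epsilon> \<equiv> \<lambda>x. if \<exists>k. x = abs_orbit (id_part k) then 1 else 0"
  shows "extend_form (\<lambda>(a, b). \<epsilon> a * g b) (coproduct_boxtimes_orbit x) = g x"
    and "extend_form (\<lambda>(a, b). g a * \<epsilon> b) (coproduct_boxtimes_orbit x) = g x"
proof -
  obtain k p where p: "p \<in> Parts k" "x = abs_orbit p" by (rule orbit_exhaust)
  let ?A = "{1..k}" let ?G = "geodesic_pairs ?A p"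
  have p': "p \<in> PartsOn ?A" using p by (simp add: Parts_eq)
  have fin: "finite ?G" using finite_boxtimes_pairs[of p] boxtimes_pairs_eq[OF p(1)] by simp
  have eps: "\<epsilon> (abs_orbit q) = (if q = id_on ?A then 1 else 0)" if "q \<in> PartsOn ?A" for q
    using abs_orbit_eq_id_iff[of q k] that by (simp add: \<epsilon>_def Parts_eq)
  have "extend_form (\<lambda>(a, b). \<epsilon> a * g b) (coproduct_boxtimes_orbit x) =
      (\<Sum>z\<in>?G. if z = (id_on ?A, p) then g x else 0)"
    unfolding p(2) extend_form_coproduct_boxtimes[OF p(1)]
  proof (rule sum.cong[OF refl], clarify)
    fix a b assume "(a, b) \<in> ?G"
    then show "\<epsilon> (abs_orbit a) * g (abs_orbit b) = (if (a, b) = (id_on ?A, p) then g (abs_orbit p) else 0)"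
      by (cases "a = id_on ?A") (auto simp: geodesic_pairs_def eps id_on_left)
  qed
  also have "\<dots> = g x"
    using fin p' id_on_left[OF p'] id_on_in_PartsOn by (simp add: geodesic_pairs_def)
  finally show "extend_form (\<lambda>(a, b). \<epsilon> a * g b) (coproduct_boxtimes_orbit x) = g x" .
  have "extend_form (\<lambda>(a, b). g a * \<epsilon> b) (coproduct_boxtimes_orbit x) =
      (\<Sum>z\<in>?G. if z = (p, id_on ?A) then g x else 0)"
    unfolding p(2) extend_form_coproduct_boxtimes[OF p(1)]
  proof (rule sum.cong[OF refl], clarify)
    fix a b assume "(a, b) \<in> ?G"
    then show "g (abs_orbit a) * \<epsilon> (abs_orbit b) = (if (a, b) = (p, id_on ?A) then g (abs_orbit p) else 0)"
      by (cases "b = id_on ?A") (auto simp: geodesic_pairs_def eps id_on_right)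
  qed
  also have "\<dots> = g x"
    using fin p' id_on_right[OF p'] id_on_in_PartsOn by (simp add: geodesic_pairs_def)
  finally show "extend_form (\<lambda>(a, b). g a * \<epsilon> b) (coproduct_boxtimes_orbit x) = g x" .
qed

lemma id_orbit_tensor_iff:
  "(\<exists>k. orbit_tensor x y = abs_orbit (id_part k)) \<longleftrightarrow>
    (\<exists>k. x = abs_orbit (id_part k)) \<and> (\<exists>k. y = abs_orbit (id_part k))"
proof -
  obtain k p where p: "p \<in> Parts k" "x = abs_orbit p" by (rule orbit_exhaust)
  obtain l q where q: "q \<in> Parts l" "y = abs_orbit q" by (rule orbit_exhaust)
  let ?s = "(+) k"
  let ?B = "?s ` {1..l}"
  have s: "inj ?s" by simp
  have AB: "{1..k} \<inter> ?B = {}" by auto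
  have kl: "{1..k + l} = {1..k} \<union> ?B" unfolding image_add_atLeastAtMost by auto
  have q': "relabel ?s q \<in> PartsOn ?B" using q by (intro relabel_in_PartsOn) (auto simp: Parts_eq)
  have idr: "id_on ?B = relabel ?s (id_on {1..l})"
    by (simp add: relabel_def vmap_def id_on_def image_image del: image_add_atLeastAtMost)
  have "(\<exists>k. orbit_tensor x y = abs_orbit (id_part k)) \<longleftrightarrow> part_tensor p q = id_on {1..k + l}"
    unfolding p(2) q(2) orbit_tensor_abs_orbit[OF p(1) q(1)]
    by (rule abs_orbit_eq_id_iff[OF part_tensor_in_Parts[OF p(1) q(1)]])
  also have "\<dots> \<longleftrightarrow> p \<union> relabel ?s q = id_on {1..k} \<union> relabel ?s (id_on {1..l})"
    unfolding part_tensor_eq[OF p(1)] kl id_on_Un idr ..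
  also have "\<dots> \<longleftrightarrow> p = id_on {1..k} \<and> relabel ?s q = relabel ?s (id_on {1..l})"
    using restr_Un[OF _ q' AB, of p] p restr_Un[OF id_on_in_PartsOn id_on_in_PartsOn AB]
    unfolding idr Parts_eq by metis
  also have "relabel ?s q = relabel ?s (id_on {1..l}) \<longleftrightarrow> q = id_on {1..l}"
    using inj_relabel'[OF s] by (simp add: inj_eq)
  finally show ?thesis using abs_orbit_eq_id_iff p q by simp
qed


section \<open>Column-closed sets and the additive coproduct\<close>

text \<open>The orbit of a diagram with arbitrary finite column set, after renumbering its columns.\<close>

definition orbit_of :: "diagram \<Rightarrow> orbit" where
  "orbit_of p = (let A = snd ` \<Union>p in
     abs_orbit (relabel (SOME f. bij_betw f A {1..card A}) p))"

lemma relabel_bij_in_Parts: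
  assumes "p \<in> PartsOn A" "bij_betw f A {1..k}"
  shows "relabel f p \<in> Parts k"
  using relabel_in_PartsOn[OF assms(1), of f] assms(2) by (simp add: Parts_eq bij_betw_def)

lemma abs_orbit_relabel_bij:
  assumes p: "p \<in> PartsOn A" and f: "bij_betw f A {1..k}" and g: "bij_betw g A {1..k}"
  shows "abs_orbit (relabel f p) = abs_orbit (relabel g p)"
proof -
  \<comment> \<open>The change of numbering from \<open>f\<close> to \<open>g\<close>, extended by
    the identity as \<open>permutes\<close> demands.\<close>
  define \<sigma> where "\<sigma> i = (if i \<in> {1..k} then g (inv_into A f i) else i)" for i
  have "bij_betw (g \<circ> inv_into A f) {1..k} {1..k}"
    using bij_betw_inv_into[OF f] g by (rule bij_betw_trans)
  then have "bij_betw \<sigma> {1..k} {1..k}"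
    by (rule bij_betw_cong[THEN iffD1, rotated]) (simp add: \<sigma>_def)
  then have "\<sigma> permutes {1..k}" by (rule bij_imp_permutes) (auto simp: \<sigma>_def)
  moreover have "relabel g p = relabel \<sigma> (relabel f p)"
    unfolding relabel_relabel
  proof (rule relabel_cong[OF p])
    fix i assume i: "i \<in> A"
    then have "f i \<in> {1..k}" using f bij_betwE by blast
    then show "g i = (\<sigma> \<circ> f) i"
      using i f by (simp add: \<sigma>_def bij_betw_def)
  qed
  ultimately show ?thesis
    using abs_orbit_eq_iff relabel_bij_in_Parts[OF p f] relabel_bij_in_Parts[OF p g] by blast
qed

lemma orbit_of_eq:
  assumes p: "p \<in> PartsOn A" and f: "bij_betw f A {1..k}"
  shows "orbit_of p = abs_orbit (relabel f p)"
proof -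
  have A: "snd ` \<Union>p = A" unfolding Union_PartsOn[OF p] by (auto simp: two_rows_def image_iff)
  have k: "card A = k" using bij_betw_same_card[OF f] by simp
  have "bij_betw (SOME f. bij_betw f A {1..card A}) A {1..k}"
    unfolding k by (rule someI[where P = "\<lambda>f. bij_betw f A {1..k}", OF f])
  then show ?thesis
    unfolding orbit_of_def A Let_def using abs_orbit_relabel_bij[OF p _ f] by blast
qed

lemma ex_bij_betw_card: "finite A \<Longrightarrow> \<exists>f :: nat \<Rightarrow> nat. bij_betw f A {1..card A}"
  by (rule finite_same_card_bij) simp_all

lemma orbit_of_abs_orbit: "p \<in> Parts k \<Longrightarrow> orbit_of p = abs_orbit p"
  using orbit_of_eq[of p "{1..k}" id k] by (simp add: Parts_eq)

lemma orbit_of_in_Parts: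
  assumes "p \<in> PartsOn A" "finite A"
  obtains q where "q \<in> Parts (card A)" "orbit_of p = abs_orbit q"
proof -
  obtain f where "bij_betw f A {1..card A}" using ex_bij_betw_card[OF assms(2)] ..
  then show ?thesis using that orbit_of_eq[OF assms(1)] relabel_bij_in_Parts[OF assms(1)] by blast
qed

lemma orbit_of_relabel:
  assumes p: "p \<in> PartsOn A" and A: "finite A" and f: "inj_on f A"
  shows "orbit_of (relabel f p) = orbit_of p"
proof -
  obtain g where g: "bij_betw g (f ` A) {1..card (f ` A)}" using ex_bij_betw_card[of "f ` A"] A by auto
  have "bij_betw (g \<circ> f) A {1..card (f ` A)}"
    using inj_on_imp_bij_betw[OF f] g by (rule bij_betw_trans)
  then show ?thesis
    using orbit_of_eq[OF p] orbit_of_eq[OF relabel_in_PartsOn[OF p f] g] by (simp add: relabel_relabel)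
qed

text \<open>The columns of \<open>A\<close> are numbered first and those of \<open>B\<close> after
  them, which turns the union into \<open>part_tensor\<close>.\<close>

lemma orbit_of_Un:
  assumes p: "p \<in> PartsOn A" and q: "q \<in> PartsOn B" and AB: "A \<inter> B = {}" and fin: "finite A" "finite B"
  shows "orbit_of (p \<union> q) = orbit_tensor (orbit_of p) (orbit_of q)"
proof -
  let ?k = "card A" and ?l = "card B"
  obtain f where f: "bij_betw f A {1..?k}" using ex_bij_betw_card[OF fin(1)] ..
  obtain g where g: "bij_betw g B {1..?l}" using ex_bij_betw_card[OF fin(2)] ..
  let ?h = "\<lambda>i. if i \<in> A then f i else ?k + g i"
  have "bij_betw ((+) ?k) {1..?l} {?k + 1..?k + ?l}"
    by (rule bij_betw_byWitness[where f' = "\<lambda>i. i - ?k"]) auto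
  then have "bij_betw ((+) ?k \<circ> g) B {?k + 1..?k + ?l}" by (rule bij_betw_trans[OF g])
  then have hB: "bij_betw ?h B {?k + 1..?k + ?l}"
    by (rule bij_betw_cong[THEN iffD1, rotated]) (use AB in auto)
  have hA: "bij_betw ?h A {1..?k}"
    using f by (rule bij_betw_cong[THEN iffD1, rotated]) auto
  have "bij_betw ?h (A \<union> B) ({1..?k} \<union> {?k + 1..?k + ?l})"
    by (rule bij_betw_combine[OF hA hB]) auto
  moreover have "{1..?k} \<union> {?k + 1..?k + ?l} = {1..?k + ?l}" by auto
  ultimately have h: "bij_betw ?h (A \<union> B) {1..?k + ?l}" by simp
  have "relabel ?h p = relabel f p" by (rule relabel_cong[OF p]) simp
  moreover have "relabel ?h q = relabel ((+) ?k) (relabel g q)"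
    unfolding relabel_relabel by (rule relabel_cong[OF q]) (use AB in auto)
  ultimately have "relabel ?h (p \<union> q) = part_tensor (relabel f p) (relabel g q)"
    by (simp add: relabel_Un part_tensor_eq[OF relabel_bij_in_Parts[OF p f]])
  then show ?thesis
    by (simp add: orbit_of_eq[OF PartsOn_Un[OF p q AB] h] orbit_of_eq[OF p f] orbit_of_eq[OF q g]
        orbit_tensor_abs_orbit[OF relabel_bij_in_Parts[OF p f] relabel_bij_in_Parts[OF q g]])
qed

text \<open>The value on \<open>h\<close> of the additive coproduct of \<open>p\<close>, written
  without reference to a factorisation; \<open>extend_form_coproduct_boxplus\<close> identifies the
  two.\<close>

definition closed_sum :: "nat set \<Rightarrow> diagram \<Rightarrow> (orbit \<times> orbit \<Rightarrow> complex) \<Rightarrow> complex" where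
  "closed_sum A p h = (\<Sum>U\<in>closed_cols A p. h (orbit_of (restr p U), orbit_of (restr p (A - U))))"

lemma closed_cols_relabel:
  assumes p: "p \<in> PartsOn A" and f: "inj_on f A" and U: "U \<subseteq> A"
  shows "f ` U \<in> closed_cols (f ` A) (relabel f p) \<longleftrightarrow> U \<in> closed_cols A p"
    and "restr (relabel f p) (f ` U) = relabel f (restr p U)"
proof -
  have sub: "map_prod id f ` C \<subseteq> two_rows (f ` V) \<longleftrightarrow> C \<subseteq> two_rows V" if C: "C \<in> p" and V: "V \<subseteq> A" for C V
  proof -
    have CA: "C \<subseteq> two_rows A" by (rule PartsOn_block_subset[OF p C])
    have "map_prod id f x \<in> two_rows (f ` V) \<longleftrightarrow> x \<in> two_rows V" if "x \<in> C" for x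
    proof -
      have "snd x \<in> A" using CA that by (auto simp: two_rows_def)
      then have "f (snd x) \<in> f ` V \<longleftrightarrow> snd x \<in> V" using inj_on_image_mem_iff[OF f _ V] by blast
      then show ?thesis by (simp add: two_rows_def mem_Times_iff)
    qed
    then show ?thesis by (simp add: image_subset_iff subset_eq)
  qed
  have diff: "f ` A - f ` U = f ` (A - U)" using inj_on_image_set_diff[OF f _ U] by auto
  have "f ` U \<subseteq> f ` A" using U by blast
  then show "f ` U \<in> closed_cols (f ` A) (relabel f p) \<longleftrightarrow> U \<in> closed_cols A p"
    using U sub unfolding closed_cols_def mem_Collect_eq diff relabel_def vmap_def by auto
  show "restr (relabel f p) (f ` U) = relabel f (restr p U)"
    using sub[OF _ U] unfolding restr_def relabel_def vmap_def by blast
qed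

lemma closed_sum_relabel:
  assumes p: "p \<in> PartsOn A" and A: "finite A" and f: "inj_on f A"
  shows "closed_sum (f ` A) (relabel f p) h = closed_sum A p h"
proof -
  have "bij_betw ((`) f) (closed_cols A p) (closed_cols (f ` A) (relabel f p))"
    unfolding bij_betw_def
  proof
    show "inj_on ((`) f) (closed_cols A p)"
      using inj_on_image_Pow[OF f] by (rule inj_on_subset) (auto simp: closed_cols_def)
    have "V \<in> (`) f ` closed_cols A p" if V: "V \<in> closed_cols (f ` A) (relabel f p)" for V
    proof -
      obtain U where U: "U \<subseteq> A" "V = f ` U"
        using V by (auto simp: closed_cols_def subset_image_iff)
      then show ?thesis using V closed_cols_relabel(1)[OF p f U(1)] by blast
    qed
    moreover have "f ` U \<in> closed_cols (f ` A) (relabel f p)" if "U \<in> closed_cols A p" for U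
      using closed_cols_relabel(1)[OF p f] that by (auto simp: closed_cols_def)
    ultimately show "(`) f ` closed_cols A p = closed_cols (f ` A) (relabel f p)" by blast
  qed
  then have "closed_sum (f ` A) (relabel f p) h = (\<Sum>U\<in>closed_cols A p.
      h (orbit_of (restr (relabel f p) (f ` U)), orbit_of (restr (relabel f p) (f ` A - f ` U))))"
    unfolding closed_sum_def by (rule sum.reindex_bij_betw[symmetric])
  also have "\<dots> = closed_sum A p h"
    unfolding closed_sum_def
  proof (rule sum.cong[OF refl])
    fix U assume U: "U \<in> closed_cols A p"
    then have UA: "U \<subseteq> A" by (simp add: closed_cols_def)
    have "orbit_of (restr (relabel f p) (f ` V)) = orbit_of (restr p V)" if V: "V \<in> closed_cols A p" for V
    proof -
      have VA: "V \<subseteq> A" using V by (simp add: closed_cols_def)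
      then show ?thesis
        using orbit_of_relabel[OF restr_in_PartsOn[OF p V]] finite_subset[OF VA A] inj_on_subset[OF f VA]
        by (simp add: closed_cols_relabel(2)[OF p f VA])
    qed
    note this[OF U] this[OF closed_cols_compl[OF U]]
    moreover have "f ` A - f ` U = f ` (A - U)" using inj_on_image_set_diff[OF f _ UA] by auto
    ultimately show "h (orbit_of (restr (relabel f p) (f ` U)), orbit_of (restr (relabel f p) (f ` A - f ` U)))
      = h (orbit_of (restr p U), orbit_of (restr p (A - U)))" by simp
  qed
  finally show ?thesis .
qed

lemma closed_cols_Un:
  assumes p: "p \<in> PartsOn A" and q: "q \<in> PartsOn B" and AB: "A \<inter> B = {}" and U: "U \<subseteq> A" and V: "V \<subseteq> B"
  shows "U \<union> V \<in> closed_cols (A \<union> B) (p \<union> q) \<longleftrightarrow> U \<in> closed_cols A p \<and> V \<in> closed_cols B q"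
proof -
  have d: "two_rows A \<inter> two_rows B = {}" by (rule two_rows_disjoint[OF AB])
  have s: "two_rows W \<subseteq> two_rows W'" if "W \<subseteq> W'" for W W' using that by (auto simp: two_rows_def)
  have diff: "A \<union> B - (U \<union> V) = (A - U) \<union> (B - V)" using U V AB by blast
  have "C \<subseteq> two_rows (W \<union> W') \<longleftrightarrow> C \<subseteq> two_rows W" if "C \<in> p" "W \<subseteq> A" "W' \<subseteq> B" for C W W'
    using PartsOn_block_subset[OF p that(1)] d s[OF that(2)] s[OF that(3)] unfolding two_rows_Un by blast
  moreover have "C \<subseteq> two_rows (W \<union> W') \<longleftrightarrow> C \<subseteq> two_rows W'" if "C \<in> q" "W \<subseteq> A" "W' \<subseteq> B" for C W W'
    using PartsOn_block_subset[OF q that(1)] d s[OF that(2)] s[OF that(3)] unfolding two_rows_Un by blast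
  ultimately show ?thesis
    using U V unfolding closed_cols_def mem_Collect_eq diff by (simp add: ball_Un le_supI1 le_supI2)
qed

text \<open>A closed set of the union is the union of a closed set over \<open>A\<close> and one
  over \<open>B\<close>, in exactly one way, and restriction respects this.\<close>

lemma closed_sum_Un:
  assumes p: "p \<in> PartsOn A" and q: "q \<in> PartsOn B" and AB: "A \<inter> B = {}" and fin: "finite A" "finite B"
  shows "closed_sum (A \<union> B) (p \<union> q) h =
    closed_sum A p (\<lambda>(a, a'). closed_sum B q (\<lambda>(b, b'). h (orbit_tensor a b, orbit_tensor a' b')))"
proof -
  let ?F = "\<lambda>U. h (orbit_of (restr (p \<union> q) U), orbit_of (restr (p \<union> q) (A \<union> B - U)))"
  have "bij_betw (\<lambda>(U, V). U \<union> V) (closed_cols A p \<times> closed_cols B q) (closed_cols (A \<union> B) (p \<union> q))"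
  proof (rule bij_betw_byWitness[where f' = "\<lambda>W. (W \<inter> A, W \<inter> B)"])
    show "\<forall>x\<in>closed_cols A p \<times> closed_cols B q. (\<lambda>W. (W \<inter> A, W \<inter> B)) ((\<lambda>(U, V). U \<union> V) x) = x"
      using AB by (auto simp: closed_cols_def)
    show "\<forall>W\<in>closed_cols (A \<union> B) (p \<union> q). (\<lambda>(U, V). U \<union> V) (W \<inter> A, W \<inter> B) = W"
      by (auto simp: closed_cols_def)
    show "(\<lambda>(U, V). U \<union> V) ` (closed_cols A p \<times> closed_cols B q) \<subseteq> closed_cols (A \<union> B) (p \<union> q)"
    proof clarify
      fix U V assume UV: "U \<in> closed_cols A p" "V \<in> closed_cols B q"
      then have "U \<subseteq> A" "V \<subseteq> B" by (simp_all add: closed_cols_def)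
      then show "U \<union> V \<in> closed_cols (A \<union> B) (p \<union> q)" using UV closed_cols_Un[OF p q AB] by blast
    qed
    show "(\<lambda>W. (W \<inter> A, W \<inter> B)) ` closed_cols (A \<union> B) (p \<union> q) \<subseteq> closed_cols A p \<times> closed_cols B q"
    proof clarify
      fix W assume W: "W \<in> closed_cols (A \<union> B) (p \<union> q)"
      then have "(W \<inter> A) \<union> (W \<inter> B) = W" by (auto simp: closed_cols_def)
      then show "W \<inter> A \<in> closed_cols A p \<and> W \<inter> B \<in> closed_cols B q"
        using W closed_cols_Un[OF p q AB, of "W \<inter> A" "W \<inter> B"] by simp
    qed
  qed
  then have "closed_sum (A \<union> B) (p \<union> q) h =
      (\<Sum>z\<in>closed_cols A p \<times> closed_cols B q. ?F ((\<lambda>(U, V). U \<union> V) z))"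
    unfolding closed_sum_def by (rule sum.reindex_bij_betw[symmetric])
  also have "\<dots> = (\<Sum>U\<in>closed_cols A p. \<Sum>V\<in>closed_cols B q. ?F (U \<union> V))"
    by (simp add: sum.cartesian_product split_def)
  also have "\<dots> = closed_sum A p (\<lambda>(a, a'). closed_sum B q (\<lambda>(b, b'). h (orbit_tensor a b, orbit_tensor a' b')))"
    unfolding closed_sum_def prod.case
  proof (intro sum.cong refl)
    fix U V assume UV: "U \<in> closed_cols A p" "V \<in> closed_cols B q"
    have *: "orbit_of (restr (p \<union> q) (W \<union> W')) = orbit_tensor (orbit_of (restr p W)) (orbit_of (restr q W'))"
      if W: "W \<in> closed_cols A p" "W' \<in> closed_cols B q" for W W'
    proof -
      have sub: "W \<subseteq> A" "W' \<subseteq> B" using W by (simp_all add: closed_cols_def)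
      have "W \<inter> W' = {}" "finite W" "finite W'" using sub AB fin finite_subset by blast+
      then show ?thesis
        unfolding restr_Un_disjoint[OF p q AB sub]
        by (rule orbit_of_Un[OF restr_in_PartsOn[OF p W(1)] restr_in_PartsOn[OF q W(2)]])
    qed
    have "U \<subseteq> A" "V \<subseteq> B" using UV by (simp_all add: closed_cols_def)
    then have "A \<union> B - (U \<union> V) = (A - U) \<union> (B - V)" using AB by blast
    then show "?F (U \<union> V) = h (orbit_tensor (orbit_of (restr p U)) (orbit_of (restr q V)),
        orbit_tensor (orbit_of (restr p (A - U))) (orbit_of (restr q (B - V))))"
      using *[OF UV] *[OF closed_cols_compl[OF UV(1)] closed_cols_compl[OF UV(2)]] by simp
  qed
  finally show ?thesis .
qed

lemma closed_sum_part_tensor: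
  assumes p: "p \<in> Parts k" and q: "q \<in> Parts l"
  shows "closed_sum {1..k + l} (part_tensor p q) h = closed_sum {1..k} p
    (\<lambda>(a, a'). closed_sum {1..l} q (\<lambda>(b, b'). h (orbit_tensor a b, orbit_tensor a' b')))"
proof -
  have q': "q \<in> PartsOn {1..l}" using q by (simp add: Parts_eq)
  have inj: "inj_on ((+) k) {1..l}" by simp
  have kl: "{1..k + l} = {1..k} \<union> (+) k ` {1..l}" unfolding image_add_atLeastAtMost by auto
  have "closed_sum {1..k + l} (part_tensor p q) h =
      closed_sum ({1..k} \<union> (+) k ` {1..l}) (p \<union> relabel ((+) k) q) h"
    unfolding kl part_tensor_eq[OF p] ..
  also have "\<dots> = closed_sum {1..k} p (\<lambda>(a, a'). closed_sum ((+) k ` {1..l}) (relabel ((+) k) q)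
      (\<lambda>(b, b'). h (orbit_tensor a b, orbit_tensor a' b')))"
    by (rule closed_sum_Un[OF _ relabel_in_PartsOn[OF q' inj]]) (use p in \<open>auto simp: Parts_eq\<close>)
  finally show ?thesis
    unfolding closed_sum_relabel[OF q' finite_atLeastAtMost inj] .
qed

section \<open>Irreducible factors and the additive coproduct\<close>

lemma trivial_closed_cols: "p \<in> PartsOn A \<Longrightarrow> {} \<in> closed_cols A p" "p \<in> PartsOn A \<Longrightarrow> A \<in> closed_cols A p"
  using PartsOn_block_subset by (auto simp: closed_cols_def)

text \<open>A closed set separates its columns from the others in \<open>p \<or> id\<close>, and
  conversely the columns of a component form a closed set. The condition \<open>k \<ge> 1\<close>
  excludes the empty diagram, which has no component at all.\<close>

lemma irreducible_part_iff:
  assumes p: "p \<in> Parts k"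
  shows "irreducible_part p \<longleftrightarrow> k \<ge> 1 \<and> closed_cols {1..k} p = {{}, {1..k}}"
proof -
  let ?A = "{1..k}" let ?S = "p \<union> id_on ?A"
  have p': "p \<in> PartsOn ?A" using p by (simp add: Parts_eq)
  have U: "\<Union>?S = two_rows ?A" using p' by (simp add: Union_PartsOn Union_id_on)
  have irr: "irreducible_part p \<longleftrightarrow> card (merge ?S) = 1"
  proof -
    have "irreducible_part p \<longleftrightarrow> nc (part_join p (id_part k)) = 1"
      using p abs_orbit_eq_pdeg unfolding irreducible_part_def by blast
    then show ?thesis by (simp add: nc_def part_join_def id_part_eq)
  qed
  show ?thesis
  proof
    assume "irreducible_part p"
    then obtain C where C: "merge ?S = {C}" unfolding irr by (rule card_1_singletonE)
    then have CU: "C = two_rows ?A" using Union_merge[of ?S] unfolding U by simp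
    have "C \<noteq> {}" using partition_onD3[OF partition_on_merge[of ?S]] C by auto
    then have k: "k \<ge> 1" unfolding CU by (auto simp: two_rows_def)
    have "V = {} \<or> V = ?A" if V: "V \<in> closed_cols ?A p" for V
    proof (rule ccontr)
      assume "\<not> (V = {} \<or> V = ?A)"
      moreover have VA: "V \<subseteq> ?A" using V by (simp add: closed_cols_def)
      ultimately obtain i j where ij: "i \<in> V" "j \<in> ?A" "j \<notin> V" by blast
      have "linked ?S (Top, i) (Top, j)"
        using merge_mem_iff[of C ?S "(Top, i)" "(Top, j)"] C CU ij VA by (auto simp: two_rows_def)
      then have "(snd (Top, i) \<in> V) = (snd (Top, j) \<in> V)"
      proof (rule linked_invariant)
        fix B x y assume B: "B \<in> ?S" "x \<in> B" "y \<in> B"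
        then have "B \<subseteq> two_rows V \<or> B \<subseteq> two_rows (?A - V)"
          using V by (auto simp: closed_cols_def id_on_def two_rows_def)
        then show "(snd x \<in> V) = (snd y \<in> V)" using B by (auto simp: two_rows_def)
      qed
      then show False using ij by simp
    qed
    then show "k \<ge> 1 \<and> closed_cols ?A p = {{}, ?A}" using k trivial_closed_cols[OF p'] by blast
  next
    assume k: "k \<ge> 1 \<and> closed_cols ?A p = {{}, ?A}"
    \<comment> \<open>The columns reached from the first one. Testing top vertices suffices, since
      the identity links the two vertices of each column.\<close>
    define V where "V = {i \<in> ?A. linked ?S (Top, 1) (Top, i)}"
    have TB: "linked ?S (Top, i) (Bot, i)" if "i \<in> ?A" for i
      by (rule linked_block[of "{(Top, i), (Bot, i)}"]) (use that in \<open>auto simp: id_on_def\<close>)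
    have inV: "snd x \<in> V \<longleftrightarrow> linked ?S (Top, 1) x" if x: "x \<in> two_rows ?A" for x
    proof -
      obtain r i where i: "x = (r, i)" "i \<in> ?A" "r = Top \<or> r = Bot" using x by (auto simp: two_rows_def)
      show ?thesis
        using i TB[OF i(2)] linked_trans[of ?S "(Top, 1)" "(Top, i)" "(Bot, i)"]
          linked_trans[of ?S "(Top, 1)" "(Bot, i)" "(Top, i)"] linked_sym[OF TB[OF i(2)]]
        by (auto simp: V_def)
    qed
    have mem: "V \<in> closed_cols ?A p"
      unfolding closed_cols_def
    proof (intro CollectI conjI ballI)
      fix C assume C: "C \<in> p"
      have CA: "C \<subseteq> two_rows ?A" by (rule PartsOn_block_subset[OF p' C])
      have CC: "linked ?S x y" if "x \<in> C" "y \<in> C" for x y using C that by (intro linked_block[of C]) auto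
      have "snd x \<in> V \<longleftrightarrow> snd y \<in> V" if xy: "x \<in> C" "y \<in> C" for x y
      proof -
        have xyA: "x \<in> two_rows ?A" "y \<in> two_rows ?A" using CA xy by blast+
        have "linked ?S (Top, 1) x \<longleftrightarrow> linked ?S (Top, 1) y"
          using linked_trans[OF _ CC[OF xy]] linked_trans[OF _ CC[OF xy(2,1)]] by (rule iffI)
        then show ?thesis using inV[OF xyA(1)] inV[OF xyA(2)] by argo
      qed
      moreover have "x \<in> two_rows W \<longleftrightarrow> snd x \<in> W" if "x \<in> C" for x W
        using CA that by (cases x) (auto simp: two_rows_def)
      moreover have "snd x \<in> ?A" if "x \<in> C" for x using CA that by (auto simp: two_rows_def)
      ultimately show "C \<subseteq> two_rows V \<or> C \<subseteq> two_rows (?A - V)" by blast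
    qed (auto simp: V_def)
    have "linked ?S (Top, 1) (Top, 1)"
      by (rule linked_refl) (use k in \<open>simp only: U, simp add: two_rows_def\<close>)
    then have "V \<noteq> {}" using k by (auto simp: V_def)
    then have V: "V = ?A" using mem k by blast
    have all: "linked ?S (Top, 1) x" if "x \<in> \<Union>?S" for x
    proof -
      have x: "x \<in> two_rows ?A" using that unfolding U .
      then have "snd x \<in> ?A" by (auto simp: two_rows_def)
      then show ?thesis using inV[OF x] V by blast
    qed
    \<comment> \<open>All vertices are linked, so a constant labelling has the right kernel.\<close>
    have "card (merge ?S) = card ((\<lambda>_. ()) ` \<Union>?S)"
      by (rule card_merge) (simp only: linked_trans[OF linked_sym[OF all] all] simp_thms)
    also have "\<Union>?S \<noteq> {}" unfolding U using k by (auto simp: two_rows_def)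
    then have "card ((\<lambda>_. ()) ` \<Union>?S) = 1" by (simp only: image_constant_conv if_False) simp
    finally show "irreducible_part p" unfolding irr .
  qed
qed

text \<open>An irreducible orbit is primitive: only the two trivial closed sets contribute, and they
  are distinct because \<open>k \<ge> 1\<close>.\<close>

lemma closed_sum_irreducible:
  assumes p: "p \<in> Parts k" and irr: "irreducible_part p"
  shows "closed_sum {1..k} p h = h (abs_orbit {}, abs_orbit p) + h (abs_orbit p, abs_orbit {})"
proof -
  have k: "k \<ge> 1" and c: "closed_cols {1..k} p = {{}, {1..k}}"
    using irr irreducible_part_iff[OF p] by blast+
  have p': "p \<in> PartsOn {1..k}" using p by (simp add: Parts_eq)
  have e: "restr p {} = {}"
    using empty_notin_PartsOn[OF p'] by (auto simp: restr_def two_rows_def)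
  have "orbit_of {} = abs_orbit {}" by (rule orbit_of_abs_orbit[OF empty_in_Parts])
  moreover have "{} \<noteq> {1..k}" using k by auto
  ultimately show ?thesis
    by (simp only: closed_sum_def c sum.insert finite.intros sum.empty empty_iff insert_iff simp_thms
        e Diff_empty Diff_cancel restr_self[OF p'] orbit_of_abs_orbit[OF p] add_0_right)
qed

lemma part_tensor_list_Cons: "part_tensor_list (p # ps) = part_tensor p (part_tensor_list ps)"
  by (simp add: part_tensor_list_def)

lemma part_tensor_list_in_Parts:
  assumes "\<forall>p\<in>set ps. irreducible_part p"
  shows "\<exists>k. part_tensor_list ps \<in> Parts k"
  using assms
proof (induction ps)
  case Nil
  then show ?case using empty_in_Parts by (auto simp: part_tensor_list_def)
next
  case (Cons p ps)
  then obtain k l where "p \<in> Parts l" "part_tensor_list ps \<in> Parts k"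
    by (auto simp: irreducible_part_def)
  then show ?case unfolding part_tensor_list_Cons using part_tensor_in_Parts by blast
qed

text \<open>Position 0 is the head of a list and \<open>Suc\<close> leads to the positions of its
  tail, so the subsets are sorted by whether they select the head.\<close>

lemma sum_Pow_lessThan_Suc:
  fixes F :: "nat set \<Rightarrow> 'a::comm_monoid_add"
  shows "(\<Sum>I\<in>Pow {..<Suc n}. F I) = (\<Sum>J\<in>Pow {..<n}. F (Suc ` J)) + (\<Sum>J\<in>Pow {..<n}. F (insert 0 (Suc ` J)))"
proof -
  let ?B = "Suc ` {..<n}"
  have P: "Pow ?B = (`) Suc ` Pow {..<n}" by (rule image_Pow_surj[symmetric]) simp
  have inj: "inj_on ((`) Suc) (Pow {..<n})" by (rule inj_on_image_Pow) simp
  have "Pow {..<Suc n} = Pow ?B \<union> insert 0 ` Pow ?B"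
    by (simp only: lessThan_Suc_eq_insert_0 Pow_insert)
  moreover have "Pow ?B \<inter> insert 0 ` Pow ?B = {}" by auto
  ultimately have "(\<Sum>I\<in>Pow {..<Suc n}. F I) = (\<Sum>I\<in>Pow ?B. F I) + (\<Sum>I\<in>insert 0 ` Pow ?B. F I)"
    by (simp add: sum.union_disjoint)
  also have "(\<Sum>I\<in>insert 0 ` Pow ?B. F I) = (\<Sum>I\<in>Pow ?B. F (insert 0 I))"
  proof (rule sum.reindex_cong)
    show "inj_on (insert 0) (Pow ?B)"
    proof (rule inj_onI)
      fix I J assume "I \<in> Pow ?B" "J \<in> Pow ?B" "insert 0 I = insert 0 J"
      moreover have "0 \<notin> I" "0 \<notin> J" using calculation by auto
      ultimately show "I = J" by (metis insert_ident)
    qed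
  qed simp_all
  finally show ?thesis unfolding P by (simp add: sum.reindex[OF inj])
qed

text \<open>The head of the list goes left or right, matching the two terms of
  \<open>closed_sum_irreducible\<close>. It is absorbed into \<open>h\<close> on that side, which is
  why \<open>h\<close> varies in the induction.\<close>

lemma sum_sublists_eq_closed_sum:
  assumes "\<forall>p\<in>set ps. irreducible_part p" "part_tensor_list ps \<in> Parts k"
  shows "(\<Sum>I\<in>Pow {..<length ps}. h (abs_orbit (part_tensor_list (nths ps I)),
      abs_orbit (part_tensor_list (nths ps ({..<length ps} - I))))) =
    closed_sum {1..k} (part_tensor_list ps) h"
  using assms
proof (induction ps arbitrary: k h)
  case Nil
  have "k = 0" using Nil.prems(2) pdeg_eq[of "{}" k] pdeg_eq[OF empty_in_Parts] by (simp add: part_tensor_list_def)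
  moreover have "closed_cols {} {} = {{}}" "restr {} {} = {}" by (auto simp: closed_cols_def restr_def)
  ultimately show ?case
    by (simp add: closed_sum_def part_tensor_list_def orbit_of_abs_orbit[OF empty_in_Parts])
next
  case (Cons p ps)
  let ?n = "length ps"
  have irr: "irreducible_part p" "\<forall>p\<in>set ps. irreducible_part p" using Cons.prems by auto
  obtain k' where p: "p \<in> Parts k'" using irr(1) by (auto simp: irreducible_part_def)
  obtain l where l: "part_tensor_list ps \<in> Parts l" using part_tensor_list_in_Parts[OF irr(2)] ..
  have k: "k = k' + l"
    using part_tensor_in_Parts[OF p l] Cons.prems(2) pdeg_eq unfolding part_tensor_list_Cons by metis
  have sub: "\<exists>j. part_tensor_list (nths ps I) \<in> Parts j" for I
    by (rule part_tensor_list_in_Parts) (use irr(2) set_nths_subset in fast)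
  have cons: "abs_orbit (part_tensor_list (p # nths ps I)) =
      orbit_tensor (abs_orbit p) (abs_orbit (part_tensor_list (nths ps I)))" for I
    using sub[of I] orbit_tensor_abs_orbit[OF p] by (auto simp: part_tensor_list_Cons)
  have n1: "nths (p # ps) (Suc ` J) = nths ps J"
    "nths (p # ps) (insert 0 (Suc ` J)) = p # nths ps J" for J
    by (simp_all add: nths_Cons inj_image_mem_iff)
  have e: "{j. Suc j \<in> {..<Suc ?n} - Suc ` J} = {..<?n} - J"
     "{j. Suc j \<in> {..<Suc ?n} - insert 0 (Suc ` J)} = {..<?n} - J" for J
    by auto
  have n2: "nths (p # ps) ({..<Suc ?n} - Suc ` J) = p # nths ps ({..<?n} - J)"
    "nths (p # ps) ({..<Suc ?n} - insert 0 (Suc ` J)) = nths ps ({..<?n} - J)" for J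
    unfolding nths_Cons e by auto
  have "(\<Sum>I\<in>Pow {..<length (p # ps)}. h (abs_orbit (part_tensor_list (nths (p # ps) I)),
      abs_orbit (part_tensor_list (nths (p # ps) ({..<length (p # ps)} - I))))) =
    (\<Sum>J\<in>Pow {..<?n}. (\<lambda>(b, b'). h (b, orbit_tensor (abs_orbit p) b'))
      (abs_orbit (part_tensor_list (nths ps J)), abs_orbit (part_tensor_list (nths ps ({..<?n} - J))))) +
    (\<Sum>J\<in>Pow {..<?n}. (\<lambda>(b, b'). h (orbit_tensor (abs_orbit p) b, b'))
      (abs_orbit (part_tensor_list (nths ps J)), abs_orbit (part_tensor_list (nths ps ({..<?n} - J)))))"
    by (simp only: list.size(4) add_0_right add_Suc_right One_nat_def sum_Pow_lessThan_Suc
        n1 n2 cons prod.case)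
  also have "\<dots> = closed_sum {1..l} (part_tensor_list ps) (\<lambda>(b, b'). h (b, orbit_tensor (abs_orbit p) b')) +
      closed_sum {1..l} (part_tensor_list ps) (\<lambda>(b, b'). h (orbit_tensor (abs_orbit p) b, b'))"
    by (simp only: Cons.IH[OF irr(2) l])
  also have "\<dots> = closed_sum {1..k} (part_tensor_list (p # ps)) h"
    unfolding part_tensor_list_Cons k closed_sum_part_tensor[OF p l] closed_sum_irreducible[OF p irr(1)]
    by simp
  finally show ?case .
qed

lemma part_tensor_assoc:
  assumes "p \<in> Parts k" "q \<in> Parts l" "r \<in> Parts m"
  shows "part_tensor (part_tensor p q) r = part_tensor p (part_tensor q r)"
proof -
  have "relabel ((+) (k + l)) r = relabel ((+) k \<circ> (+) l) r"
    by (rule arg_cong2[where f = relabel]) (auto simp: add.assoc)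
  then show ?thesis
    using part_tensor_eq[OF part_tensor_in_Parts[OF assms(1,2)], of r]
    by (simp add: part_tensor_eq[OF assms(1)] part_tensor_eq[OF assms(2)] relabel_Un relabel_relabel Un_assoc)
qed

lemma abs_orbit_part_tensor_list_append:
  assumes "\<forall>p\<in>set (ps @ qs). irreducible_part p"
  shows "abs_orbit (part_tensor_list (ps @ qs)) =
    orbit_tensor (abs_orbit (part_tensor_list ps)) (abs_orbit (part_tensor_list qs))"
proof -
  have "part_tensor_list (ps @ qs) = part_tensor (part_tensor_list ps) (part_tensor_list qs)"
    using assms
  proof (induction ps)
    case Nil then show ?case by (simp add: part_tensor_list_def)
  next
    case (Cons p ps)
    obtain k where "p \<in> Parts k" using Cons.prems by (auto simp: irreducible_part_def)
    moreover obtain l where "part_tensor_list ps \<in> Parts l"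
      using part_tensor_list_in_Parts[of ps] Cons.prems by auto
    moreover obtain m where "part_tensor_list qs \<in> Parts m"
      using part_tensor_list_in_Parts[of qs] Cons.prems by auto
    ultimately show ?case
      using Cons by (simp add: part_tensor_list_Cons part_tensor_assoc)
  qed
  moreover obtain l where "part_tensor_list ps \<in> Parts l"
    using part_tensor_list_in_Parts[of ps] assms by auto
  moreover obtain m where "part_tensor_list qs \<in> Parts m"
    using part_tensor_list_in_Parts[of qs] assms by auto
  ultimately show ?thesis by (simp add: orbit_tensor_abs_orbit)
qed

text \<open>A reducible diagram has a proper non-empty closed set; it and its complement have fewer
  columns. Renumbering rearranges columns, so only the orbit is recovered. This existence validates
  the choice in \<open>irreducible_factors\<close>.\<close>

lemma ex_irreducible_factors:
  "p \<in> Parts k \<Longrightarrow> \<exists>ps. (\<forall>p\<in>set ps. irreducible_part p) \<and> abs_orbit (part_tensor_list ps) = abs_orbit p"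
proof (induction k arbitrary: p rule: less_induct)
  case (less k)
  have p': "p \<in> PartsOn {1..k}" using less.prems by (simp add: Parts_eq)
  consider "k = 0" | "irreducible_part p" | "k \<ge> 1" "\<not> irreducible_part p" by linarith
  then show ?case
  proof cases
    case 1
    then have "p = {}" using less.prems Parts_0 by auto
    then show ?thesis by (intro exI[of _ "[]"]) (simp add: part_tensor_list_def)
  next
    case 2
    then show ?thesis by (intro exI[of _ "[p]"]) (simp add: part_tensor_list_def)
  next
    case 3
    then have "closed_cols {1..k} p \<noteq> {{}, {1..k}}" using irreducible_part_iff[OF less.prems] by blast
    then obtain U where U: "U \<in> closed_cols {1..k} p" "U \<noteq> {}" "U \<noteq> {1..k}"
      using trivial_closed_cols[OF p'] by blast
    let ?V = "{1..k} - U"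
    have UA: "U \<subseteq> {1..k}" using U by (simp add: closed_cols_def)
    have V: "?V \<in> closed_cols {1..k} p" by (rule closed_cols_compl[OF U(1)])
    have fin: "finite U" "finite ?V" using UA finite_subset by auto
    have "U \<subset> {1..k}" using UA U(3) by blast
    then have "card U < card {1..k}" by (intro psubset_card_mono) auto
    then have cU: "card U < k" by simp
    have "?V \<subset> {1..k}" using UA U(2) by blast
    then have "card ?V < card {1..k}" by (intro psubset_card_mono) auto
    then have cV: "card ?V < k" by simp
    obtain a where a: "a \<in> Parts (card U)" "orbit_of (restr p U) = abs_orbit a"
      by (rule orbit_of_in_Parts[OF restr_in_PartsOn[OF p' U(1)] fin(1)])
    obtain b where b: "b \<in> Parts (card ?V)" "orbit_of (restr p ?V) = abs_orbit b"
      by (rule orbit_of_in_Parts[OF restr_in_PartsOn[OF p' V] fin(2)])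
    obtain ps where ps: "\<forall>p\<in>set ps. irreducible_part p" "abs_orbit (part_tensor_list ps) = abs_orbit a"
      using less.IH[OF cU a(1)] by blast
    obtain qs where qs: "\<forall>p\<in>set qs. irreducible_part p" "abs_orbit (part_tensor_list qs) = abs_orbit b"
      using less.IH[OF cV b(1)] by blast
    have "abs_orbit p = orbit_of (restr p U \<union> restr p ?V)"
      using restr_Un_compl[OF U(1)] orbit_of_abs_orbit[OF less.prems] by simp
    also have "\<dots> = orbit_tensor (orbit_of (restr p U)) (orbit_of (restr p ?V))"
      by (rule orbit_of_Un[OF restr_in_PartsOn[OF p' U(1)] restr_in_PartsOn[OF p' V] _ fin]) auto
    also have "\<dots> = abs_orbit (part_tensor_list (ps @ qs))"
      using ps qs a b by (subst abs_orbit_part_tensor_list_append) auto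
    finally show ?thesis using ps qs by (intro exI[of _ "ps @ qs"]) auto
  qed
qed

text \<open>The chosen list gives some diagram in the orbit of \<open>p\<close>, and
  \<open>closed_sum\<close> is unchanged by relabelling, so the choice leaves no trace.\<close>

lemma extend_form_coproduct_boxplus:
  assumes p: "p \<in> Parts k"
  shows "extend_form h (coproduct_boxplus_orbit (abs_orbit p)) = closed_sum {1..k} p h"
proof -
  define ps where "ps = irreducible_factors (abs_orbit p)"
  have "(\<forall>p\<in>set ps. irreducible_part p) \<and> abs_orbit (part_tensor_list ps) = abs_orbit p"
    unfolding ps_def irreducible_factors_def by (rule someI_ex[OF ex_irreducible_factors[OF p]])
  then have ps: "\<forall>p\<in>set ps. irreducible_part p" "abs_orbit (part_tensor_list ps) = abs_orbit p" by auto
  let ?q = "part_tensor_list ps"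
  obtain l where "?q \<in> Parts l" using part_tensor_list_in_Parts[OF ps(1)] ..
  then have q: "?q \<in> Parts k" using abs_orbit_eq_pdeg[OF _ p ps(2)] by blast
  obtain \<sigma> where \<sigma>: "\<sigma> permutes {1..k}" "p = relabel \<sigma> ?q"
    using abs_orbit_eq_iff[OF q p] ps(2) by blast
  have "extend_form h (coproduct_boxplus_orbit (abs_orbit p)) = closed_sum {1..k} ?q h"
    unfolding coproduct_boxplus_orbit_def Let_def ps_def[symmetric] extend_form_sum extend_form_basis
    by (rule sum_sublists_eq_closed_sum[OF ps(1) q])
  also have "\<dots> = closed_sum (\<sigma> ` {1..k}) (relabel \<sigma> ?q) h"
    by (rule closed_sum_relabel[symmetric]) (use q permutes_inj_on[OF \<sigma>(1)] in \<open>auto simp: Parts_eq\<close>)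
  also have "\<dots> = closed_sum {1..k} p h"
    unfolding permutes_image[OF \<sigma>(1)] \<sigma>(2)[symmetric] ..
  finally show ?thesis .
qed

lemma coproduct_boxplus_tensor:
  "extend_form h (coproduct_boxplus_orbit (orbit_tensor x y)) =
    extend_form (\<lambda>(a, a'). extend_form (\<lambda>(b, b'). h (orbit_tensor a b, orbit_tensor a' b'))
      (coproduct_boxplus_orbit y)) (coproduct_boxplus_orbit x)"
proof -
  obtain k p where p: "p \<in> Parts k" "x = abs_orbit p" by (rule orbit_exhaust)
  obtain l q where q: "q \<in> Parts l" "y = abs_orbit q" by (rule orbit_exhaust)
  show ?thesis
    unfolding p(2) q(2) orbit_tensor_abs_orbit[OF p(1) q(1)]
    by (simp only: extend_form_coproduct_boxplus[OF part_tensor_in_Parts[OF p(1) q(1)]]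
        extend_form_coproduct_boxplus[OF p(1)] extend_form_coproduct_boxplus[OF q(1)]
        closed_sum_part_tensor[OF p(1) q(1)])
qed

section \<open>The counit of \<open>Boxplus\<close>\<close>

lemma finite_closed_cols: "finite A \<Longrightarrow> finite (closed_cols A p)"
  by (rule finite_subset[of _ "Pow A"]) (auto simp: closed_cols_def)

lemma orbit_of_eq_empty_iff:
  assumes "p \<in> PartsOn A" "finite A"
  shows "orbit_of p = abs_orbit {} \<longleftrightarrow> A = {}"
proof -
  obtain q where "q \<in> Parts (card A)" "orbit_of p = abs_orbit q" by (rule orbit_of_in_Parts[OF assms])
  then show ?thesis using abs_orbit_eq_empty_iff assms by auto
qed

lemma coproduct_boxplus_counit:
  fixes g :: "orbit \<Rightarrow> complex"
  defines "\<epsilon> \<equiv> \<lambda>x. if x = abs_orbit {} then 1 else 0"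
  shows "extend_form (\<lambda>(a, b). \<epsilon> a * g b) (coproduct_boxplus_orbit x) = g x"
    and "extend_form (\<lambda>(a, b). g a * \<epsilon> b) (coproduct_boxplus_orbit x) = g x"
proof -
  obtain k p where p: "p \<in> Parts k" "x = abs_orbit p" by (rule orbit_exhaust)
  let ?A = "{1..k}" let ?G = "closed_cols ?A p"
  have p': "p \<in> PartsOn ?A" using p by (simp add: Parts_eq)
  have fin: "finite ?G" by (rule finite_closed_cols) simp
  have eps: "\<epsilon> (orbit_of (restr p U)) = (if U = {} then 1 else 0)" if U: "U \<in> ?G" for U
  proof -
    have "finite U" using U finite_subset[of U ?A] by (auto simp: closed_cols_def)
    then show ?thesis using orbit_of_eq_empty_iff[OF restr_in_PartsOn[OF p' U]] by (simp add: \<epsilon>_def)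
  qed
  have x: "orbit_of (restr p ?A) = x"
    unfolding restr_self[OF p'] p(2) by (rule orbit_of_abs_orbit[OF p(1)])
  have "extend_form (\<lambda>(a, b). \<epsilon> a * g b) (coproduct_boxplus_orbit x) =
      (\<Sum>U\<in>?G. if U = {} then g x else 0)"
    unfolding p(2) extend_form_coproduct_boxplus[OF p(1)] closed_sum_def prod.case
  proof (rule sum.cong[OF refl])
    fix U assume U: "U \<in> ?G"
    show "\<epsilon> (orbit_of (restr p U)) * g (orbit_of (restr p (?A - U))) = (if U = {} then g (abs_orbit p) else 0)"
      unfolding eps[OF U] using x p(2) by simp
  qed
  also have "\<dots> = g x" using fin trivial_closed_cols(1)[OF p'] by simp
  finally show "extend_form (\<lambda>(a, b). \<epsilon> a * g b) (coproduct_boxplus_orbit x) = g x" .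
  have "extend_form (\<lambda>(a, b). g a * \<epsilon> b) (coproduct_boxplus_orbit x) =
      (\<Sum>U\<in>?G. if U = ?A then g x else 0)"
    unfolding p(2) extend_form_coproduct_boxplus[OF p(1)] closed_sum_def prod.case
  proof (rule sum.cong[OF refl])
    fix U assume U: "U \<in> ?G"
    have "?A - U = {} \<longleftrightarrow> U = ?A" using U by (auto simp: closed_cols_def)
    then show "g (orbit_of (restr p U)) * \<epsilon> (orbit_of (restr p (?A - U))) = (if U = ?A then g (abs_orbit p) else 0)"
      unfolding eps[OF closed_cols_compl[OF U]] using x p(2) by simp
  qed
  also have "\<dots> = g x" using fin trivial_closed_cols(2)[OF p'] by simp
  finally show "extend_form (\<lambda>(a, b). g a * \<epsilon> b) (coproduct_boxplus_orbit x) = g x" .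
qed

lemma orbit_tensor_eq_empty_iff:
  "orbit_tensor x y = abs_orbit {} \<longleftrightarrow> x = abs_orbit {} \<and> y = abs_orbit {}"
proof -
  obtain k p where p: "p \<in> Parts k" "x = abs_orbit p" by (rule orbit_exhaust)
  obtain l q where q: "q \<in> Parts l" "y = abs_orbit q" by (rule orbit_exhaust)
  show ?thesis
    unfolding p(2) q(2) orbit_tensor_abs_orbit[OF p(1) q(1)]
    using abs_orbit_eq_empty_iff[OF part_tensor_in_Parts[OF p(1) q(1)]]
      abs_orbit_eq_empty_iff[OF p(1)] abs_orbit_eq_empty_iff[OF q(1)] by simp
qed

section \<open>Truncation by degree\<close>

definition orbits_upto :: "nat \<Rightarrow> orbit set" where
  "orbits_upto n = (\<Union>k\<le>n. abs_orbit ` Parts k)"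

lemma finite_orbits_upto: "finite (orbits_upto n)"
  by (simp add: orbits_upto_def finite_Parts)

lemma orbits_uptoI: "p \<in> Parts k \<Longrightarrow> k \<le> n \<Longrightarrow> abs_orbit p \<in> orbits_upto n"
  by (auto simp: orbits_upto_def)

text \<open>Pairing with an indicator function reads off coefficients from the formulas for the
  coproducts tested against \<open>h\<close>.\<close>

lemma lookup_eq_extend_form: "Poly_Mapping.lookup v y = extend_form (\<lambda>z. if z = y then 1 else 0) v"
  by (simp add: extend_form_def if_distrib in_keys_iff cong: if_cong)

text \<open>A non-zero coefficient needs a non-zero summand. \<open>Boxtimes\<close> keeps the
  degree in both factors, while \<open>Boxplus\<close> divides the columns between them; hence the
  truncation is by degree at most \<open>n\<close>.\<close>

lemma coproduct_keys:
  assumes "x \<in> orbits_upto n"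
  shows "Poly_Mapping.keys (coproduct c (basis x)) \<subseteq> orbits_upto n \<times> orbits_upto n"
proof
  fix y assume "y \<in> Poly_Mapping.keys (coproduct c (basis x))"
  then have nz: "extend_form (\<lambda>z. if z = y then 1 else 0) (coproduct c (basis x)) \<noteq> 0"
    by (simp add: in_keys_iff lookup_eq_extend_form)
  obtain k p where k: "k \<le> n" and p: "p \<in> Parts k" "x = abs_orbit p"
    using assms by (auto simp: orbits_upto_def)
  show "y \<in> orbits_upto n \<times> orbits_upto n"
  proof (cases c)
    case Boxplus
    then have "closed_sum {1..k} p (\<lambda>z. if z = y then 1 else 0) \<noteq> 0"
      using nz extend_form_coproduct_boxplus[OF p(1)] by (simp only: p(2) coproduct.simps extend_map_basis simp_thms)
    then obtain U where U: "U \<in> closed_cols {1..k} p"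
      and "(if (orbit_of (restr p U), orbit_of (restr p ({1..k} - U))) = y then 1 else 0 :: complex) \<noteq> 0"
      unfolding closed_sum_def by (rule sum.not_neutral_contains_not_neutral)
    then have y: "y = (orbit_of (restr p U), orbit_of (restr p ({1..k} - U)))" by (auto split: if_splits)
    have "orbit_of (restr p V) \<in> orbits_upto n" if V: "V \<in> closed_cols {1..k} p" for V
    proof -
      have VA: "V \<subseteq> {1..k}" using V by (simp add: closed_cols_def)
      then have fin: "finite V" using finite_subset by auto
      have "card V \<le> n" using card_mono[OF finite_atLeastAtMost VA] k by simp
      moreover obtain q where "q \<in> Parts (card V)" "orbit_of (restr p V) = abs_orbit q"
        by (rule orbit_of_in_Parts[OF restr_in_PartsOn[OF _ V] fin]) (use p in \<open>simp_all add: Parts_eq\<close>)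
      ultimately show ?thesis by (simp add: orbits_uptoI)
    qed
    then show ?thesis using U closed_cols_compl[OF U] y by simp
  next
    case Boxtimes
    then have "(\<Sum>z\<in>geodesic_pairs {1..k} p.
        case z of (p1, p2) \<Rightarrow> if (abs_orbit p1, abs_orbit p2) = y then 1 else (0 :: complex)) \<noteq> 0"
      using nz extend_form_coproduct_boxtimes[OF p(1)] by (simp only: p(2) coproduct.simps extend_map_basis simp_thms)
    then obtain z where z: "z \<in> geodesic_pairs {1..k} p"
      and "(case z of (p1, p2) \<Rightarrow> if (abs_orbit p1, abs_orbit p2) = y then 1 else (0 :: complex)) \<noteq> 0"
      by (rule sum.not_neutral_contains_not_neutral)
    then have "y = (abs_orbit (fst z), abs_orbit (snd z))" by (auto split: if_splits prod.splits)
    moreover have "fst z \<in> Parts k" "snd z \<in> Parts k" using z by (auto simp: geodesic_pairs_def Parts_eq)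
    ultimately show ?thesis using k by (simp add: orbits_uptoI)
  qed
qed


section \<open>Convolution exponentials\<close>

lemma extend_form_add_fun: "extend_form (\<lambda>z. f z + g z) v = extend_form f v + extend_form g v"
  by (simp add: extend_form_def algebra_simps sum.distrib)

lemma extend_form_mult_left: "extend_form (\<lambda>z. k * f z) v = k * extend_form f v"
  by (simp add: extend_form_def sum_distrib_left mult.left_commute)

lemma coproduct_tensor:
  "extend_form h (coproduct c (basis (orbit_tensor x y))) =
    extend_form (\<lambda>(a, a'). extend_form (\<lambda>(b, b'). h (orbit_tensor a b, orbit_tensor a' b'))
      (coproduct c (basis y))) (coproduct c (basis x))"
  by (cases c) (simp_all only: coproduct.simps extend_map_basis coproduct_boxplus_tensor coproduct_boxtimes_tensor)

lemma coproduct_counit: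
  shows "extend_form (\<lambda>(a, b). counit c (basis a) * g b) (coproduct c (basis x)) = g x"
    and "extend_form (\<lambda>(a, b). g a * counit c (basis b)) (coproduct c (basis x)) = g x"
  by (cases c; simp only: coproduct.simps counit.simps extend_map_basis extend_form_basis
      coproduct_boxplus_counit coproduct_boxtimes_counit)+

lemma counit_tensor:
  "counit c (basis (orbit_tensor x y)) = counit c (basis x) * counit c (basis y)"
  by (cases c) (simp_all add: orbit_tensor_eq_empty_iff id_orbit_tensor_iff)

lemma counit_empty: "counit c (basis (abs_orbit {})) = 1"
proof -
  have "abs_orbit {} = abs_orbit (id_part 0)" by (simp add: id_part_def)
  then show ?thesis by (cases c) auto
qed

lemma linear_form_counit: "linear_form (counit c)"
  by (cases c) (simp_all add: linear_form_extend_form)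

lemma linear_form_eqI:
  assumes "linear_form \<phi>" "linear_form \<psi>" "\<And>x. \<phi> (basis x) = \<psi> (basis x)"
  shows "\<phi> = \<psi>"
  using linear_form_eq_extend_form[OF assms(1)] linear_form_eq_extend_form[OF assms(2)] assms(3) by simp

lemma convolve_basis:
  "convolve c \<phi> \<psi> (basis x) =
    extend_form (\<lambda>(a, b). \<phi> (basis a) * \<psi> (basis b)) (coproduct c (basis x))"
  by (simp add: convolve_def tensor_form_def)

text \<open>Row \<open>x\<close>, column \<open>y\<close> of the matrix of convolution by
  \<open>\<phi>\<close> on the orbits of degree at most \<open>n\<close>.\<close>

definition conv_coeff ::
  "convolution \<Rightarrow> (orbit_space \<Rightarrow> complex) \<Rightarrow> nat \<Rightarrow> orbit \<Rightarrow> orbit \<Rightarrow> complex" where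
  "conv_coeff c \<phi> n x y =
    (\<Sum>a\<in>orbits_upto n. Poly_Mapping.lookup (coproduct c (basis x)) (a, y) * \<phi> (basis a))"

lemma extend_form_coproduct_left:
  assumes "x \<in> orbits_upto n"
  shows "extend_form (\<lambda>(a, b). \<phi> (basis a) * g b) (coproduct c (basis x)) =
    (\<Sum>y\<in>orbits_upto n. conv_coeff c \<phi> n x y * g y)"
proof -
  let ?D = "orbits_upto n" and ?v = "coproduct c (basis x)"
  have "extend_form (\<lambda>(a, b). \<phi> (basis a) * g b) ?v =
      (\<Sum>z\<in>?D \<times> ?D. Poly_Mapping.lookup ?v z * (case z of (a, b) \<Rightarrow> \<phi> (basis a) * g b))"
    by (rule extend_form_superset) (simp_all add: finite_orbits_upto coproduct_keys[OF assms])
  also have "\<dots> = (\<Sum>a\<in>?D. \<Sum>b\<in>?D. Poly_Mapping.lookup ?v (a, b) * (\<phi> (basis a) * g b))"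
    by (simp add: sum.cartesian_product split_def)
  also have "\<dots> = (\<Sum>b\<in>?D. \<Sum>a\<in>?D. Poly_Mapping.lookup ?v (a, b) * (\<phi> (basis a) * g b))"
    by (rule sum.swap)
  finally show ?thesis by (simp add: conv_coeff_def sum_distrib_right mult.assoc)
qed

lemma convolve_coeff:
  "x \<in> orbits_upto n \<Longrightarrow>
    convolve c \<phi> \<psi> (basis x) = (\<Sum>y\<in>orbits_upto n. conv_coeff c \<phi> n x y * \<psi> (basis y))"
  unfolding convolve_basis by (rule extend_form_coproduct_left)

lemma ex_orbits_upto: obtains n where "x \<in> orbits_upto n"
  using orbit_exhaust[of x] orbits_uptoI by (metis order_refl)

lemma orbits_upto_mono: "m \<le> n \<Longrightarrow> orbits_upto m \<subseteq> orbits_upto n"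
  unfolding orbits_upto_def by (intro UN_mono) auto

section \<open>Uniqueness and existence of the exponential\<close>

lemma conv_exponentialD:
  assumes "conv_exponential c \<phi> e"
  shows "t \<ge> 0 \<Longrightarrow> linear_form (e t)" "\<not> t \<ge> 0 \<Longrightarrow> e t = undefined" "e 0 = counit c"
    and "t \<ge> 0 \<Longrightarrow> ((\<lambda>t. e t (basis x)) has_vector_derivative convolve c \<phi> (e t) (basis x)) (at t within {0..})"
  using assms by (auto simp: conv_exponential_def PiE_iff extensional_def)

lemma conv_exponential_unique:
  assumes e: "conv_exponential c \<phi> e" and e': "conv_exponential c \<phi> e'"
  shows "e = e'"
proof
  fix t :: real
  show "e t = e' t"
  proof (cases "t \<ge> 0")
    case True
    show ?thesis
    proof (rule linear_form_eqI)
      fix x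
      obtain n where n: "x \<in> orbits_upto n" by (rule ex_orbits_upto)
      have "e t (basis x) - e' t (basis x) = 0"
      proof (rule linear_ode_zero[OF finite_orbits_upto _ _ n True])
        fix y and s :: real assume y: "y \<in> orbits_upto n" and s: "0 \<le> s"
        show "((\<lambda>t. e t (basis y) - e' t (basis y)) has_vector_derivative
          (\<Sum>z\<in>orbits_upto n. conv_coeff c \<phi> n y z * (e s (basis z) - e' s (basis z)))) (at s within {0..})"
          using has_vector_derivative_diff[OF conv_exponentialD(4)[OF e s, of y] conv_exponentialD(4)[OF e' s, of y]]
          by (simp add: convolve_coeff[OF y] right_diff_distrib sum_subtractf)
      qed (simp add: conv_exponentialD(3)[OF e] conv_exponentialD(3)[OF e'])
      then show "e t (basis x) = e' t (basis x)" by simp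
    qed (use True conv_exponentialD(1) e e' in auto)
  next
    case False
    \<comment> \<open>At negative times both families are \<open>undefined\<close> by
      extensionality.\<close>
    then show ?thesis using conv_exponentialD(2) e e' by metis
  qed
qed

primrec conv_power :: "convolution \<Rightarrow> (orbit_space \<Rightarrow> complex) \<Rightarrow> nat \<Rightarrow> orbit_space \<Rightarrow> complex" where
  "conv_power c \<phi> 0 = counit c"
| "conv_power c \<phi> (Suc n) = convolve c \<phi> (conv_power c \<phi> n)"

text \<open>The solution is the exponential series in the convolution powers of
  \<open>\<phi>\<close>, formed on each orbit separately; every orbit lies in a finite truncation,
  where \<open>linear_ode_series\<close> applies.\<close>

lemma conv_exponential_exists: "\<exists>e. conv_exponential c \<phi> e"
proof -
  let ?a = "\<lambda>n x. conv_power c \<phi> n (basis x)"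
  define u where "u t x = suminf (\<lambda>n. ?a n x / fact n * of_real t ^ n)" for t :: real and x
  define e where "e t = (if t \<ge> 0 then extend_form (u t) else undefined)" for t
  have e_basis: "e t (basis x) = u t x" if "t \<ge> 0" for t x using that by (simp add: e_def)
  have "((\<lambda>t. e t (basis x)) has_vector_derivative convolve c \<phi> (e s) (basis x)) (at s within {0..})"
    if s: "s \<ge> 0" for s x
  proof -
    obtain n where n: "x \<in> orbits_upto n" by (rule ex_orbits_upto)
    have "((\<lambda>t. u t x) has_vector_derivative
        (\<Sum>y\<in>orbits_upto n. conv_coeff c \<phi> n x y * u s y)) (at s within {0..})"
      unfolding u_def
      by (rule linear_ode_series[where a = ?a, OF finite_orbits_upto _ n]) (simp add: convolve_coeff)
    \<comment> \<open>\<open>e\<close> and \<open>u\<close> are identified only on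
      \<open>{0..}\<close>, which is the set within which the derivative is taken.\<close>
    then have "((\<lambda>t. e t (basis x)) has_vector_derivative
        (\<Sum>y\<in>orbits_upto n. conv_coeff c \<phi> n x y * u s y)) (at s within {0..})"
      by (rule has_vector_derivative_transform[rotated -1]) (use s e_basis in auto)
    then show ?thesis using s by (simp add: convolve_coeff[OF n] e_basis)
  qed
  moreover have "e 0 = counit c"
  proof (rule linear_form_eqI)
    fix x
    show "e 0 (basis x) = counit c (basis x)"
      using powser_zero[of "\<lambda>n. ?a n x / fact n"] by (simp add: e_basis u_def)
  qed (simp_all add: linear_form_counit linear_form_extend_form e_def)
  ultimately have "conv_exponential c \<phi> e"
    by (auto simp: conv_exponential_def PiE_iff extensional_def e_def linear_form_extend_form)
  then show ?thesis by blast
qed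

section \<open>Infinitesimal characters against characters\<close>

text \<open>
  Since the coproduct is multiplicative, \<open>\<phi>\<close> acts on a tensor product as a derivation. The products
  \<open>e t x * e t y\<close> obviously satisfy the same system.
\<close>

lemma convolve_infinitesimal_tensor:
  assumes inf: "infinitesimal_character c \<phi>" and x: "x \<in> orbits_upto n" and y: "y \<in> orbits_upto n"
  shows "convolve c \<phi> \<psi> (basis (orbit_tensor x y)) =
    (\<Sum>a\<in>orbits_upto n. conv_coeff c \<phi> n x a * \<psi> (basis (orbit_tensor a y))) +
    (\<Sum>b\<in>orbits_upto n. conv_coeff c \<phi> n y b * \<psi> (basis (orbit_tensor x b)))"
proof -
  let ?\<epsilon> = "\<lambda>x. counit c (basis x)" and ?\<phi> = "\<lambda>x. \<phi> (basis x)" and ?\<psi> = "\<lambda>x. \<psi> (basis x)"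
  let ?G = "\<lambda>a'. extend_form (\<lambda>(b, b'). ?\<phi> b * ?\<psi> (orbit_tensor a' b')) (coproduct c (basis y))"
  \<comment> \<open>The Leibniz rule splits \<open>?\<phi> (orbit_tensor a b)\<close>; in the term
    with \<open>?\<epsilon> b\<close> the left counit law for \<open>y\<close> replaces
    \<open>b'\<close> by \<open>y\<close>.\<close>
  have inner: "extend_form (\<lambda>(b, b'). ?\<phi> (orbit_tensor a b) * ?\<psi> (orbit_tensor a' b')) (coproduct c (basis y)) =
      ?\<phi> a * ?\<psi> (orbit_tensor a' y) + ?\<epsilon> a * ?G a'" for a a'
  proof -
    have "(\<lambda>(b, b'). ?\<phi> (orbit_tensor a b) * ?\<psi> (orbit_tensor a' b')) =
        (\<lambda>z. ?\<phi> a * (case z of (b, b') \<Rightarrow> ?\<epsilon> b * ?\<psi> (orbit_tensor a' b')) +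
          ?\<epsilon> a * (case z of (b, b') \<Rightarrow> ?\<phi> b * ?\<psi> (orbit_tensor a' b')))"
      using inf by (auto simp: infinitesimal_character_def algebra_simps)
    then show ?thesis
      by (simp only: extend_form_add_fun extend_form_mult_left coproduct_counit)
  qed
  have "convolve c \<phi> \<psi> (basis (orbit_tensor x y)) =
      extend_form (\<lambda>z. (case z of (a, a') \<Rightarrow> ?\<phi> a * ?\<psi> (orbit_tensor a' y)) +
        (case z of (a, a') \<Rightarrow> ?\<epsilon> a * ?G a')) (coproduct c (basis x))"
    unfolding convolve_basis coproduct_tensor prod.case inner by (simp add: split_def)
  \<comment> \<open>Now the left counit law for \<open>x\<close> contracts
    \<open>?\<epsilon> a\<close> and replaces \<open>a'\<close> by \<open>x\<close>.\<close>
  also have "\<dots> = extend_form (\<lambda>(a, a'). ?\<phi> a * ?\<psi> (orbit_tensor a' y)) (coproduct c (basis x)) + ?G x"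
    by (simp only: extend_form_add_fun coproduct_counit)
  finally show ?thesis
    by (simp only: extend_form_coproduct_left[OF x, of \<phi> "\<lambda>a. ?\<psi> (orbit_tensor a y)"]
        extend_form_coproduct_left[OF y, of \<phi> "\<lambda>b. ?\<psi> (orbit_tensor x b)"])
qed

text \<open>A Kronecker sum of two matrices applied to \<open>w\<close>: in each summand the delta
  freezes one coordinate of the pair.\<close>

lemma sum_Times_delta:
  fixes f g :: "'a \<Rightarrow> complex"
  assumes "finite D" "x \<in> D" "y \<in> D"
  shows "(\<Sum>z\<in>D \<times> D. ((if snd z = y then f (fst z) else 0) + (if fst z = x then g (snd z) else 0)) * w z) =
    (\<Sum>a\<in>D. f a * w (a, y)) + (\<Sum>b\<in>D. g b * w (x, b))"
proof -
  have "(\<Sum>z\<in>D \<times> D. ((if snd z = y then f (fst z) else 0) + (if fst z = x then g (snd z) else 0)) * w z) =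
      (\<Sum>a\<in>D. \<Sum>b\<in>D. (if b = y then f a * w (a, b) else 0)) + (\<Sum>a\<in>D. \<Sum>b\<in>D. (if a = x then g b * w (a, b) else 0))"
    unfolding sum.distrib[symmetric] sum.cartesian_product
    by (rule sum.cong) (auto simp: algebra_simps)
  also have "(\<Sum>a\<in>D. \<Sum>b\<in>D. (if a = x then g b * w (a, b) else 0)) = (\<Sum>b\<in>D. \<Sum>a\<in>D. (if a = x then g b * w (a, b) else 0))"
    by (rule sum.swap)
  finally show ?thesis using assms by simp
qed

lemma character_conv_exponential:
  assumes e: "conv_exponential c \<phi> e" and inf: "infinitesimal_character c \<phi>" and t: "t \<ge> 0"
  shows "character (e t)"
  unfolding character_def
proof (intro conjI allI)
  show "linear_form (e t)" by (rule conv_exponentialD(1)[OF e t])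
next
  let ?o = "abs_orbit {}"
  have D: "orbits_upto 0 = {?o}" by (simp add: orbits_upto_def Parts_0)
  \<comment> \<open>The empty orbit is idempotent for the tensor product and has counit 1, so the
    Leibniz rule doubles its value. It is the only orbit of degree 0, so \<open>e t\<close> is then
    constant on it.\<close>
  have "\<phi> (basis ?o) = \<phi> (basis ?o) + \<phi> (basis ?o)"
    using inf orbit_tensor_empty(1)[of ?o] counit_empty[of c]
    unfolding infinitesimal_character_def by (metis mult.left_neutral mult.right_neutral)
  then have \<phi>0: "\<phi> (basis ?o) = 0" by simp
  have "e t (basis x) - 1 = 0" if x: "x \<in> {?o}" for x
  proof (rule linear_ode_zero[of "{?o}" "\<lambda>x t. e t (basis x) - 1" "\<lambda>_ _. 0", OF _ _ _ x t])
    fix x and s :: real assume x: "x \<in> {?o}" and s: "0 \<le> s"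
    have "convolve c \<phi> (e s) (basis x) = 0"
      using x convolve_coeff[of x 0 c \<phi> "e s"] by (simp add: D conv_coeff_def \<phi>0)
    then show "((\<lambda>t. e t (basis x) - 1) has_vector_derivative
        (\<Sum>y\<in>{?o}. 0 * (e s (basis y) - 1))) (at s within {0..})"
      using has_vector_derivative_diff_const[of "\<lambda>t. e t (basis x)" 1] conv_exponentialD(4)[OF e s, of x] by simp
  qed (simp_all add: conv_exponentialD(3)[OF e] counit_empty)
  then show "e t (basis ?o) = 1" by simp
next
  fix x y
  obtain m where m: "x \<in> orbits_upto m" by (rule ex_orbits_upto)
  obtain k where k: "y \<in> orbits_upto k" by (rule ex_orbits_upto)
  define n where "n = max m k"
  let ?D = "orbits_upto n"
  have xy: "x \<in> ?D" "y \<in> ?D" using m k orbits_upto_mono[of m n] orbits_upto_mono[of k n] by (auto simp: n_def)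
  \<comment> \<open>The defect of multiplicativity, as an unknown indexed by pairs. Its system has
    as matrix \<open>?M\<close> the Kronecker sum of \<open>conv_coeff c \<phi> n\<close> with
    itself.\<close>
  let ?W = "\<lambda>z t. e t (basis (orbit_tensor (fst z) (snd z))) - e t (basis (fst z)) * e t (basis (snd z))"
  let ?M = "\<lambda>z z'. (if snd z' = snd z then conv_coeff c \<phi> n (fst z) (fst z') else 0) +
      (if fst z' = fst z then conv_coeff c \<phi> n (snd z) (snd z') else 0)"
  have "?W (x, y) t = 0"
  proof (rule linear_ode_zero[of "?D \<times> ?D" ?W ?M, OF _ _ _ _ t])
    fix z and s :: real assume z: "z \<in> ?D \<times> ?D" and s: "0 \<le> s"
    obtain u v where uv: "z = (u, v)" "u \<in> ?D" "v \<in> ?D" using z by auto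
    note d = conv_exponentialD(4)[OF e s]
    let ?K = "conv_coeff c \<phi> n"
    have "(?W z has_vector_derivative (convolve c \<phi> (e s) (basis (orbit_tensor u v)) -
        (e s (basis u) * convolve c \<phi> (e s) (basis v) + convolve c \<phi> (e s) (basis u) * e s (basis v))))
        (at s within {0..})"
      unfolding uv fst_conv snd_conv
      by (intro has_vector_derivative_diff has_vector_derivative_mult d)
    also have "convolve c \<phi> (e s) (basis (orbit_tensor u v)) -
        (e s (basis u) * convolve c \<phi> (e s) (basis v) + convolve c \<phi> (e s) (basis u) * e s (basis v)) =
      (\<Sum>a\<in>?D. ?K u a * ?W (a, v) s) + (\<Sum>b\<in>?D. ?K v b * ?W (u, b) s)"
      unfolding convolve_infinitesimal_tensor[OF inf uv(2,3)] convolve_coeff[OF uv(2)] convolve_coeff[OF uv(3)]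
      by (simp add: sum_distrib_left sum_distrib_right sum_subtractf[symmetric] sum.distrib[symmetric] algebra_simps)
    also have "\<dots> = (\<Sum>z'\<in>?D \<times> ?D. ?M z z' * ?W z' s)"
      unfolding uv(1) fst_conv snd_conv
      by (subst sum_Times_delta[OF finite_orbits_upto uv(2,3)]) simp
    finally show "(?W z has_vector_derivative (\<Sum>z'\<in>?D \<times> ?D. ?M z z' * ?W z' s)) (at s within {0..})" .
  qed (use xy in \<open>auto simp: finite_orbits_upto conv_exponentialD(3)[OF e] counit_tensor\<close>)
  then show "e t (basis (orbit_tensor x y)) = e t (basis x) * e t (basis y)" by simp
qed

text \<open>By the right counit law the initial derivative
  \<open>convolve c \<phi> (counit c)\<close> equals \<open>\<phi>\<close> on every orbit, and the
  product rule at 0 produces the two counit terms.\<close>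

lemma infinitesimal_character_of_characters:
  assumes \<phi>: "linear_form \<phi>" and e: "conv_exponential c \<phi> e" and ch: "\<And>t. t \<ge> 0 \<Longrightarrow> character (e t)"
  shows "infinitesimal_character c \<phi>"
  unfolding infinitesimal_character_def
proof (intro conjI allI)
  fix x y
  have d: "((\<lambda>t. e t (basis z)) has_vector_derivative \<phi> (basis z)) (at 0 within {0..})" for z
    using conv_exponentialD(4)[OF e order_refl, of z]
    unfolding conv_exponentialD(3)[OF e] convolve_basis coproduct_counit .
  have "((\<lambda>t. e t (basis x) * e t (basis y)) has_vector_derivative
      (e 0 (basis x) * \<phi> (basis y) + \<phi> (basis x) * e 0 (basis y))) (at 0 within {0..})"
    by (intro has_vector_derivative_mult d)
  then have "((\<lambda>t. e t (basis (orbit_tensor x y))) has_vector_derivative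
      (e 0 (basis x) * \<phi> (basis y) + \<phi> (basis x) * e 0 (basis y))) (at 0 within {0..})"
    by (rule has_vector_derivative_transform[rotated -1]) (use ch in \<open>auto simp: character_def\<close>)
  \<comment> \<open>The one-sided derivative is unique because 0 is a limit point of the
    half-line.\<close>
  moreover have "at (0::real) within {0..} \<noteq> bot"
    by (simp add: at_within_Ici_at_right trivial_limit_at_right_real)
  ultimately have "\<phi> (basis (orbit_tensor x y)) = e 0 (basis x) * \<phi> (basis y) + \<phi> (basis x) * e 0 (basis y)"
    using d vector_derivative_unique_within by blast
  then show "\<phi> (basis (orbit_tensor x y)) = \<phi> (basis x) * counit c (basis y) + counit c (basis x) * \<phi> (basis y)"
    by (simp add: conv_exponentialD(3)[OF e] add.commute)
qed (rule \<phi>)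

theorem theorem4p1:
  fixes c :: convolution and \<phi> :: "orbit_space \<Rightarrow> complex"
  assumes "linear_form \<phi>"
  shows "(\<exists>!e. conv_exponential c \<phi> e) \<and>
    (\<forall>e. conv_exponential c \<phi> e \<longrightarrow>
      (infinitesimal_character c \<phi> \<longleftrightarrow> (\<forall>t\<ge>0. character (e t))))"
  using conv_exponential_exists conv_exponential_unique character_conv_exponential
    infinitesimal_character_of_characters[OF assms] by blast

end
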